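(* Let $-\infty<a<b<\infty$, let $k>0$, let $H=L^2[a,b]$, and let $A$ be the self-adjoint operator in $H$ given by $Af=-f''+kf$ on the domain $$\mathcal{D}(A)=\{f:[a,b]\to\mathbb{C}\mid f,f'\in AC[a,b];\ f''\in L^2[a,b];\ f(a)=-f(b);\ f'(a)=-f'(b)\}.$$ Let $n\in\mathbb{N}$ and let $H_n=(V_n,(\cdot,\cdot)_n)$ be the $n^{th}$ left-definite space associated with the pair $(L^2[a,b],A)$. Define the operator $A_n:\mathcal{D}(A_n)\subset H_n\to H_n$ by $$\mathcal{D}(A_n):=V_{n+2}=\{f:[a,b]\to\mathbb{C}\mid f^{(j)}\in AC[a,b],\ f^{(j)}(a)=-f^{(j)}(b)\ (j=0,1,\ldots,n+1);\ f^{(n+2)}\in L^2[a,b]\},$$ $$(A_nf)(x):=-f''(x)+kf(x)\quad(f\in\mathcal{D}(A_n)).$$ Then $A_n$ is the $n^{th}$ left-definite operator associated with the pair $(H,A)$. In particular, $A_n$ is self-adjoint in $H_n$, and the spectrum $\sigma(A_n)$ is a purely discrete point spectrum given explicitly by $$\sigma(A_n)=\sigma(A)=\left\{\left(\frac{(2m-1)\pi}{b-a}\right)^2+k\ \Big|\ m\in\mathbb{N}\right\}.$$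
   Context: $\mathbb{N}=\{1,2,3,\ldots\}$. $L^2[a,b]$ is the complex Hilbert space with $(f,g)_{L^2[a,b]}=\int_a^b f(x)\overline{g}(x)\,dx$; $AC[a,b]$ denotes the complex-valued absolutely continuous functions on $[a,b]$. The operator $A$ is self-adjoint and bounded below by $kI$ in $H$. Definition (left-definite space). Let $A$ be a self-adjoint operator in a Hilbert space $H$ with inner product $(\cdot,\cdot)$, bounded below by $kI$ for some $k>0$, and let $r>0$. Let $V_r$ be a linear manifold of $H$ and $(\cdot,\cdot)_r$ an inner product on $V_r$. Then $H_r=(V_r,(\cdot,\cdot)_r)$ is an $r^{th}$ left-definite space associated with $(H,A)$ if: (1) $H_r$ is a Hilbert space; (2) $\mathcal{D}(A^r)$ is a linear manifold of $V_r$; (3) $\mathcal{D}(A^r)$ is dense in $H_r$; (4) $(x,x)_r\ge k^r(x,x)$ for all $x\in V_r$; (5) $(x,y)_r=(A^rx,y)$ for all $x\in\mathcal{D}(A^r)$, $y\in V_r$. By a known theorem (Littlejohn–Wellman) it exists and is unique, with $V_r=\mathcal{D}(A^{r/2})$, $(x,y)_r=(A^{r/2}x,A^{r/2}y)$. For the semi-periodic operator $A$ of the claim and $n\in\mathbb{N}$, the $n^{th}$ left-definite space is given explicitly by $$V_n=\{f:[a,b]\to\mathbb{C}\mid f^{(j)}\in AC[a,b],\ f^{(j)}(a)=-f^{(j)}(b)\ (j=0,\ldots,n-1);\ f^{(n)}\in L^2[a,b]\},$$ $$(f,g)_n=\sum_{j=0}^{n}\binom{n}{j}k^{n-j}\int_a^b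 f^{(j)}(x)\,\overline{g}^{(j)}(x)\,dx.$$ Definition (left-definite operator). For $r>0$, with $H_r$ the $r^{th}$ left-definite space associated with $(H,A)$, an $r^{th}$ left-definite operator associated with $(H,A)$ is a self-adjoint operator $A_r:\mathcal{D}(A_r)\subset H_r\to H_r$ that is a restriction of $A$, i.e. $\mathcal{D}(A_r)\subset\mathcal{D}(A)$ and $A_rf=Af$ for $f\in\mathcal{D}(A_r)$. By a known theorem (Littlejohn–Wellman) it exists and is unique for each $r>0$. *)

theory Defs
  imports "HOL-Analysis.Analysis"
begin

section \<open>Complex vector spaces\<close>

class complex_vector = ab_group_add +
  fixes scaleC :: "complex \<Rightarrow> 'a \<Rightarrow> 'a"  (infixr \<open>*\<^sub>C\<close> 75)
  assumes scaleC_add_right: "c *\<^sub>C (x + y) = c *\<^sub>C x + c *\<^sub>C y"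
    and scaleC_add_left: "(c + d) *\<^sub>C x = c *\<^sub>C x + d *\<^sub>C x"
    and scaleC_scaleC: "c *\<^sub>C d *\<^sub>C x = (c * d) *\<^sub>C x"
    and scaleC_one: "1 *\<^sub>C x = x"

global_interpretation complex_vector: vector_space "scaleC :: complex \<Rightarrow> 'a \<Rightarrow> 'a::complex_vector"
  by unfold_locales
    (simp_all add: scaleC_add_right scaleC_add_left scaleC_scaleC scaleC_one)


section \<open>Hilbert spaces and unbounded operators\<close>

text \<open>
  An inner product space is given by its set of vectors inside an ambient complex vector space
  (whose operations it inherits) and its inner product, which is only meaningful on that set.
  This makes it possible for two spaces with different inner products to consist of the same kind
  of vectors, one being a linear manifold of the other.
\<close>

record 'v ipspace =
  vecs :: "'v set"
  ip :: "'v \<Rightarrow> 'v \<Rightarrow> complex"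

definition ip_norm :: "'v ipspace \<Rightarrow> 'v \<Rightarrow> real" where
  "ip_norm H x = sqrt (Re (ip H x x))"

definition inner_product_space :: "'v::complex_vector ipspace \<Rightarrow> bool" where
  "inner_product_space H \<longleftrightarrow>
     complex_vector.subspace (vecs H) \<and>
     (\<forall>x\<in>vecs H. \<forall>y\<in>vecs H. \<forall>z\<in>vecs H. ip H (x + y) z = ip H x z + ip H y z) \<and>
     (\<forall>c. \<forall>x\<in>vecs H. \<forall>y\<in>vecs H. ip H (c *\<^sub>C x) y = c * ip H x y) \<and>
     (\<forall>x\<in>vecs H. \<forall>y\<in>vecs H. ip H y x = cnj (ip H x y)) \<and>
     (\<forall>x\<in>vecs H. x \<noteq> 0 \<longrightarrow> Re (ip H x x) > 0)"

definition hilbert_space :: "'v::complex_vector ipspace \<Rightarrow> bool" where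
  "hilbert_space H \<longleftrightarrow>
     inner_product_space H \<and>
     (\<forall>X. (\<forall>i. X i \<in> vecs H) \<and>
          (\<forall>e>0. \<exists>N::nat. \<forall>i\<ge>N. \<forall>j\<ge>N. ip_norm H (X i - X j) < e) \<longrightarrow>
          (\<exists>x\<in>vecs H. (\<lambda>i. ip_norm H (X i - x)) \<longlonglongrightarrow> 0))"

definition dense_in :: "'v::complex_vector ipspace \<Rightarrow> 'v set \<Rightarrow> bool" where
  "dense_in H D \<longleftrightarrow> D \<subseteq> vecs H \<and> (\<forall>x\<in>vecs H. \<forall>e>0. \<exists>d\<in>D. ip_norm H (x - d) < e)"

text \<open>
  An operator is identified with its graph. Thus \<^term>\<open>Domain T\<close> is its domain, inclusion
  of operators is inclusion of graphs, and \<^term>\<open>T ^^ n\<close> is the power of \<^term>\<open>T\<close>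
  on its natural domain.
\<close>

type_synonym 'v operator = "('v \<times> 'v) set"

definition linear_operator :: "'v::complex_vector ipspace \<Rightarrow> 'v operator \<Rightarrow> bool" where
  "linear_operator H T \<longleftrightarrow>
     T \<subseteq> vecs H \<times> vecs H \<and> single_valued T \<and> (0, 0) \<in> T \<and>
     (\<forall>x y x' y'. (x, y) \<in> T \<longrightarrow> (x', y') \<in> T \<longrightarrow> (x + x', y + y') \<in> T) \<and>
     (\<forall>c x y. (x, y) \<in> T \<longrightarrow> (c *\<^sub>C x, c *\<^sub>C y) \<in> T)"

definition adjoint_operator :: "'v ipspace \<Rightarrow> 'v operator \<Rightarrow> 'v operator" where
  "adjoint_operator H T =
     {(y, z). y \<in> vecs H \<and> z \<in> vecs H \<and> (\<forall>(x, w)\<in>T. ip H w y = ip H x z)}"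

definition self_adjoint :: "'v::complex_vector ipspace \<Rightarrow> 'v operator \<Rightarrow> bool" where
  "self_adjoint H T \<longleftrightarrow>
     linear_operator H T \<and> dense_in H (Domain T) \<and> adjoint_operator H T = T"

text \<open>Used for self-adjoint operators only, for which \<^term>\<open>ip H y x\<close> below is real.\<close>

definition bounded_below_by :: "'v ipspace \<Rightarrow> 'v operator \<Rightarrow> real \<Rightarrow> bool" where
  "bounded_below_by H T k \<longleftrightarrow> (\<forall>(x, y)\<in>T. Re (ip H y x) \<ge> k * Re (ip H x x))"

definition resolvent_set :: "'v::complex_vector ipspace \<Rightarrow> 'v operator \<Rightarrow> complex set" where
  "resolvent_set H T =
     {z. (\<forall>v\<in>vecs H. \<exists>!x. \<exists>y. (x, y) \<in> T \<and> y - z *\<^sub>C x = v) \<and>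
         (\<exists>C. \<forall>(x, y)\<in>T. ip_norm H x \<le> C * ip_norm H (y - z *\<^sub>C x))}"

definition spectrum :: "'v::complex_vector ipspace \<Rightarrow> 'v operator \<Rightarrow> complex set" where
  "spectrum H T = - resolvent_set H T"

definition eigenspace :: "'v::complex_vector operator \<Rightarrow> complex \<Rightarrow> 'v set" where
  "eigenspace T z = {x. (x, z *\<^sub>C x) \<in> T}"

text \<open>Every point of the spectrum is an isolated eigenvalue of finite multiplicity.\<close>

definition purely_discrete_point_spectrum ::
    "'v::complex_vector ipspace \<Rightarrow> 'v operator \<Rightarrow> bool" where
  "purely_discrete_point_spectrum H T \<longleftrightarrow>
     (\<forall>z\<in>spectrum H T.
        z isolated_in spectrum H T \<and>
        (\<exists>x\<in>eigenspace T z. x \<noteq> 0) \<and>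
        (\<exists>B. finite B \<and> eigenspace T z \<subseteq> complex_vector.span B))"


section \<open>Left-definite spaces and operators\<close>

text \<open>
  Only positive integer orders \<^term>\<open>r\<close> are covered, so that \<^term>\<open>A ^^ r\<close> is an ordinary
  power. The standing assumptions on \<^term>\<open>H\<close>, \<^term>\<open>A\<close>, \<^term>\<open>k\<close> and
  \<^term>\<open>r\<close> are part of the definition.
\<close>

definition left_definite_space ::
    "'v::complex_vector ipspace \<Rightarrow> 'v operator \<Rightarrow> real \<Rightarrow> nat \<Rightarrow> 'v ipspace \<Rightarrow> bool" where
  "left_definite_space H A k r Hr \<longleftrightarrow>
     hilbert_space H \<and> self_adjoint H A \<and> 0 < k \<and> bounded_below_by H A k \<and> 0 < r \<and>
     complex_vector.subspace (vecs Hr) \<and> vecs Hr \<subseteq> vecs H \<and>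
     hilbert_space Hr \<and>
     complex_vector.subspace (Domain (A ^^ r)) \<and> Domain (A ^^ r) \<subseteq> vecs Hr \<and>
     dense_in Hr (Domain (A ^^ r)) \<and>
     (\<forall>x\<in>vecs Hr. Re (ip Hr x x) \<ge> k ^ r * Re (ip H x x)) \<and>
     (\<forall>(x, w)\<in>A ^^ r. \<forall>y\<in>vecs Hr. ip Hr x y = ip H w y)"

definition left_definite_operator ::
    "'v::complex_vector ipspace \<Rightarrow> 'v operator \<Rightarrow> real \<Rightarrow> nat \<Rightarrow> 'v ipspace \<Rightarrow> 'v operator \<Rightarrow> bool"
  where
  "left_definite_operator H A k r Hr B \<longleftrightarrow>
     left_definite_space H A k r Hr \<and> self_adjoint Hr B \<and> B \<subseteq> A"


section \<open>Functions modulo equality almost everywhere\<close>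

definition ae_eq :: "(real \<Rightarrow> complex) \<Rightarrow> (real \<Rightarrow> complex) \<Rightarrow> bool" where
  "ae_eq f g \<longleftrightarrow> (AE x in lebesgue. f x = g x)"

quotient_type aefun = "real \<Rightarrow> complex" / ae_eq
proof (rule equivpI)
  show "reflp ae_eq"
    by (simp add: ae_eq_def reflp_def)
  show "symp ae_eq"
    by (auto simp: ae_eq_def symp_def elim: eventually_mono)
  show "transp ae_eq"
    unfolding ae_eq_def by (rule transpI, erule (1) eventually_elim2) simp
qed

instantiation aefun :: complex_vector
begin

lift_definition zero_aefun :: aefun is "\<lambda>x. 0" .

lift_definition plus_aefun :: "aefun \<Rightarrow> aefun \<Rightarrow> aefun" is "\<lambda>f g x. f x + g x"
  unfolding ae_eq_def by (erule (1) eventually_elim2) simp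

lift_definition minus_aefun :: "aefun \<Rightarrow> aefun \<Rightarrow> aefun" is "\<lambda>f g x. f x - g x"
  unfolding ae_eq_def by (erule (1) eventually_elim2) simp

lift_definition uminus_aefun :: "aefun \<Rightarrow> aefun" is "\<lambda>f x. - f x"
  unfolding ae_eq_def by (erule eventually_mono) simp

lift_definition scaleC_aefun :: "complex \<Rightarrow> aefun \<Rightarrow> aefun" is "\<lambda>c f x. c * f x"
  unfolding ae_eq_def by (erule eventually_mono) simp

instance
  by standard (transfer, simp add: ae_eq_def algebra_simps)+

end

lemma integral_lebesgue_on_cong_ae_eq:
  fixes f g :: "real \<Rightarrow> complex"
  assumes eq: "AE x in lebesgue. f x = g x" and S: "S \<in> sets lebesgue"
  shows "(LINT x|lebesgue_on S. f x) = (LINT x|lebesgue_on S. g x)"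
proof -
  have N: "negligible {x. f x \<noteq> g x}"
    using eq by (metis eventually_ae_filter_negligible negligible_subset)
  have iff: "integrable (lebesgue_on S) f \<longleftrightarrow> integrable (lebesgue_on S) g"
    using absolutely_integrable_spike_eq[of "{x. f x \<noteq> g x}" S f g, OF N] S
    by (auto simp: set_integrable_def integrable_restrict_space)
  show ?thesis
  proof (cases "integrable (lebesgue_on S) f")
    case True
    have "integral S f = integral S g"
      by (rule integral_spike[OF N]) auto
    then show ?thesis
      using True iff S by (simp add: lebesgue_integral_eq_integral)
  next
    case False
    then show ?thesis
      using iff by (simp add: not_integrable_integral_eq)
  qed
qed

text \<open>
  A function on the interval is turned into a vector by extending it by zero; \<open>L2 a b\<close>
  therefore consists of classes of functions on the real line that vanish off the interval.
\<close>

definition ae_class :: "real \<Rightarrow> real \<Rightarrow> (real \<Rightarrow> complex) \<Rightarrow> aefun" where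
  "ae_class a b f = abs_aefun (\<lambda>x. if x \<in> {a..b} then f x else 0)"

definition square_integrable :: "real \<Rightarrow> real \<Rightarrow> (real \<Rightarrow> complex) \<Rightarrow> bool" where
  "square_integrable a b f \<longleftrightarrow>
     f \<in> borel_measurable (lebesgue_on {a..b}) \<and>
     integrable (lebesgue_on {a..b}) (\<lambda>x. (norm (f x))\<^sup>2)"

lift_definition L2_ip :: "real \<Rightarrow> real \<Rightarrow> aefun \<Rightarrow> aefun \<Rightarrow> complex" is
  "\<lambda>a b f g. LINT x|lebesgue_on {a..b}. f x * cnj (g x)"
  unfolding ae_eq_def
  by (rule integral_lebesgue_on_cong_ae_eq, erule (1) eventually_elim2) auto

definition L2 :: "real \<Rightarrow> real \<Rightarrow> aefun ipspace" where
  "L2 a b = \<lparr>vecs = ae_class a b ` {f. square_integrable a b f}, ip = L2_ip a b\<rparr>"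


section \<open>Absolutely continuous functions and iterated derivatives\<close>

definition absolutely_continuous_fun :: "real \<Rightarrow> real \<Rightarrow> (real \<Rightarrow> complex) \<Rightarrow> bool" where
  "absolutely_continuous_fun a b f \<longleftrightarrow>
     (\<forall>e>0. \<exists>d>0. \<forall>I :: (real \<times> real) set.
        finite I \<and> (\<forall>(u, v)\<in>I. a \<le> u \<and> u \<le> v \<and> v \<le> b) \<and>
        disjoint_family_on (\<lambda>(u, v). {u<..<v}) I \<and> (\<Sum>(u, v)\<in>I. v - u) < d \<longrightarrow>
        (\<Sum>(u, v)\<in>I. norm (f v - f u)) < e)"

definition deriv_on :: "real \<Rightarrow> real \<Rightarrow> nat \<Rightarrow> (real \<Rightarrow> complex) \<Rightarrow> real \<Rightarrow> complex" where
  "deriv_on a b j = (\<lambda>g x. vector_derivative g (at x within {a..b})) ^^ j"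


section \<open>The semi-periodic operators\<close>

text \<open>
  The third and fourth conjuncts only make explicit that the derivatives being mentioned exist:
  those of order less than \<^term>\<open>n\<close> everywhere (one-sided at the end points), the last one
  almost everywhere.
\<close>

definition semi_periodic_funs :: "real \<Rightarrow> real \<Rightarrow> nat \<Rightarrow> (real \<Rightarrow> complex) set" where
  "semi_periodic_funs a b n =
     {f. (\<forall>j<n. absolutely_continuous_fun a b (deriv_on a b j f)) \<and>
         (\<forall>j<n. deriv_on a b j f a = - deriv_on a b j f b) \<and>
         (\<forall>j. Suc j < n \<longrightarrow>
            (\<forall>x\<in>{a..b}. deriv_on a b j f differentiable (at x within {a..b}))) \<and>
         (\<forall>j. Suc j = n \<longrightarrow>
            (AE x in lebesgue_on {a..b}. deriv_on a b j f differentiable (at x within {a..b}))) \<and>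
         square_integrable a b (deriv_on a b n f)}"

definition semi_periodic_ip ::
    "real \<Rightarrow> real \<Rightarrow> real \<Rightarrow> nat \<Rightarrow> (real \<Rightarrow> complex) \<Rightarrow> (real \<Rightarrow> complex) \<Rightarrow> complex" where
  "semi_periodic_ip a b k n f g =
     (\<Sum>j=0..n. of_nat (n choose j) * of_real (k ^ (n - j)) *
        (LINT x|lebesgue_on {a..b}. deriv_on a b j f x * cnj (deriv_on a b j g x)))"

text \<open>
  For \<^term>\<open>n > 0\<close> a class contains at most one member of \<^term>\<open>semi_periodic_funs a b n\<close>,
  up to values off the interval.
\<close>

definition semi_periodic_rep :: "real \<Rightarrow> real \<Rightarrow> nat \<Rightarrow> aefun \<Rightarrow> real \<Rightarrow> complex" where
  "semi_periodic_rep a b n u = (SOME f. f \<in> semi_periodic_funs a b n \<and> ae_class a b f = u)"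

definition semi_periodic_space :: "real \<Rightarrow> real \<Rightarrow> real \<Rightarrow> nat \<Rightarrow> aefun ipspace" where
  "semi_periodic_space a b k n =
     \<lparr>vecs = ae_class a b ` semi_periodic_funs a b n,
      ip = (\<lambda>u v. semi_periodic_ip a b k n (semi_periodic_rep a b n u) (semi_periodic_rep a b n v))\<rparr>"

definition semi_periodic_operator_on ::
    "real \<Rightarrow> real \<Rightarrow> real \<Rightarrow> (real \<Rightarrow> complex) set \<Rightarrow> aefun operator" where
  "semi_periodic_operator_on a b k D =
     {(ae_class a b f, ae_class a b (\<lambda>x. - deriv_on a b 2 f x + of_real k * f x)) | f. f \<in> D}"

abbreviation semi_periodic_A :: "real \<Rightarrow> real \<Rightarrow> real \<Rightarrow> aefun operator" where
  "semi_periodic_A a b k \<equiv> semi_periodic_operator_on a b k (semi_periodic_funs a b 2)"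

abbreviation semi_periodic_A_n :: "real \<Rightarrow> real \<Rightarrow> real \<Rightarrow> nat \<Rightarrow> aefun operator" where
  "semi_periodic_A_n a b k n \<equiv> semi_periodic_operator_on a b k (semi_periodic_funs a b (n + 2))"

end

theory Submission
  imports Defs
begin

text \<open>
  On semi-periodic functions \<open>d/dx\<close> has the bounded skew-symmetric inverse \<open>T\<close> that picks the primitive
  with opposite end values, and \<open>V\<^sub>n = T\<^sup>n L\<^sup>2\<close>, \<open>A = k - (d/dx)\<^sup>2\<close>. Everything about \<open>A\<close> is
  derived from \<open>T\<close>: self-adjointness because \<open>A\<close> is symmetric and onto, and the spectrum because
  \<open>A - z = - (d/dx - \<sigma>) (d/dx + \<sigma>)\<close> for \<open>\<sigma>\<^sup>2 = k - z\<close>, where \<open>d/dx - \<sigma>\<close> is inverted by variation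
  of constants unless \<open>exp (\<sigma> (b - a)) = - 1\<close>. All hypotheses on \<open>T\<close> survive the passage from a
  space with inner product \<open>(f, g)\<close> to the range of \<open>T\<close> with \<open>k (f, g) + (f', g')\<close>; by Pascal's rule
  \<open>n\<close> such steps starting from \<open>L\<^sup>2\<close> give the inner product \<open>(f, g)\<^sub>n\<close>, whence \<open>A\<^sub>n\<close> in \<open>H\<^sub>n\<close> has the
  properties of \<open>A\<close> in \<open>L\<^sup>2\<close>. A left-definite space is the completion of the domain of \<open>A\<^sup>n\<close> in the
  form of \<open>A\<^sup>n\<close>, hence unique.
\<close>

section \<open>Hilbert spaces and left-definite spaces\<close>

text \<open>Working with \<open>T\<close> instead of \<open>D\<close> means that every map is
  bounded and defined everywhere: the domain of a power of \<open>D\<close> is merely the range of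
  the same power of \<open>T\<close>, and regularity questions become questions about ranges.
  Neither the spectral theorem nor compactness nor a square root of \<open>A\<close> enters.
  Factoring into first-order operators leaves only a scalar first-order equation to solve. Since
  \<open>T\<close> is skew, no real number lies in \<open>S\<close>; hence 0 belongs to the
  resolvent set of \<open>A\<close>, so \<open>A\<close> is onto. The delicate hypothesis of the
  passage to the next space is the resolvent estimate. It bounds \<open>T h\<close>, the solution
  itself, and not \<open>h\<close>, its derivative. The conditions on a left-definite space say
  nothing about its inner product off its vectors. Uniqueness therefore gives agreement on vectors
  only, and every property must be transported along such agreement.\<close>

lemmas scaleC_simps = scaleC_add_right scaleC_add_left
  complex_vector.scale_right_diff_distrib complex_vector.scale_left_diff_distrib

section \<open>Geometry of inner product spaces\<close>

locale inner_product =
  fixes H :: "'v::complex_vector ipspace"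
  assumes inner_product_space: "inner_product_space H"
begin

lemma subspace_vecs: "complex_vector.subspace (vecs H)"
  using inner_product_space by (simp add: inner_product_space_def)

lemma vecs_closed [simp, intro]:
  "0 \<in> vecs H"
  "x \<in> vecs H \<Longrightarrow> y \<in> vecs H \<Longrightarrow> x + y \<in> vecs H"
  "x \<in> vecs H \<Longrightarrow> y \<in> vecs H \<Longrightarrow> x - y \<in> vecs H"
  "x \<in> vecs H \<Longrightarrow> - x \<in> vecs H"
  "x \<in> vecs H \<Longrightarrow> c *\<^sub>C x \<in> vecs H"
  using subspace_vecs
  by (simp_all add: complex_vector.subspace_0 complex_vector.subspace_add
      complex_vector.subspace_diff complex_vector.subspace_neg complex_vector.subspace_scale)

lemmas inner_product_conjuncts = inner_product_space[unfolded inner_product_space_def]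

lemma ip_add_left: "\<lbrakk>x \<in> vecs H; y \<in> vecs H; z \<in> vecs H\<rbrakk> \<Longrightarrow> ip H (x + y) z = ip H x z + ip H y z"
  by (rule inner_product_conjuncts[THEN conjunct2, THEN conjunct1, rule_format])

lemma ip_scale_left: "\<lbrakk>x \<in> vecs H; y \<in> vecs H\<rbrakk> \<Longrightarrow> ip H (c *\<^sub>C x) y = c * ip H x y"
  by (rule inner_product_conjuncts[THEN conjunct2, THEN conjunct2, THEN conjunct1, rule_format])

lemma ip_commute: "\<lbrakk>x \<in> vecs H; y \<in> vecs H\<rbrakk> \<Longrightarrow> ip H y x = cnj (ip H x y)"
  by (rule inner_product_conjuncts[THEN conjunct2, THEN conjunct2, THEN conjunct2, THEN conjunct1, rule_format])

lemma ip_self_pos: "\<lbrakk>x \<in> vecs H; x \<noteq> 0\<rbrakk> \<Longrightarrow> Re (ip H x x) > 0"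
  by (rule inner_product_conjuncts[THEN conjunct2, THEN conjunct2, THEN conjunct2, THEN conjunct2, rule_format])

lemma ip_zero_left [simp]: "x \<in> vecs H \<Longrightarrow> ip H 0 x = 0"
  using ip_scale_left[of 0 x 0] by simp

lemma ip_minus_left: "\<lbrakk>x \<in> vecs H; y \<in> vecs H\<rbrakk> \<Longrightarrow> ip H (- x) y = - ip H x y"
  using ip_scale_left[of x y "-1"] by simp

lemma ip_diff_left: "\<lbrakk>x \<in> vecs H; y \<in> vecs H; z \<in> vecs H\<rbrakk> \<Longrightarrow> ip H (x - y) z = ip H x z - ip H y z"
  using ip_add_left[of x "- y" z] by (simp add: ip_minus_left)

lemma ip_add_right: "\<lbrakk>x \<in> vecs H; y \<in> vecs H; z \<in> vecs H\<rbrakk> \<Longrightarrow> ip H z (x + y) = ip H z x + ip H z y"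
  using ip_commute[of "x + y" z] ip_commute[of x z] ip_commute[of y z] by (simp add: ip_add_left)

lemma ip_scale_right: "\<lbrakk>x \<in> vecs H; y \<in> vecs H\<rbrakk> \<Longrightarrow> ip H y (c *\<^sub>C x) = cnj c * ip H y x"
  using ip_commute[of "c *\<^sub>C x" y] ip_commute[of x y] by (simp add: ip_scale_left)

lemma ip_diff_right: "\<lbrakk>x \<in> vecs H; y \<in> vecs H; z \<in> vecs H\<rbrakk> \<Longrightarrow> ip H z (x - y) = ip H z x - ip H z y"
  using ip_commute[of "x - y" z] ip_commute[of x z] ip_commute[of y z] by (simp add: ip_diff_left)

lemma ip_zero_right [simp]: "x \<in> vecs H \<Longrightarrow> ip H x 0 = 0"
  using ip_commute[of 0 x] by simp

lemmas ip_simps = ip_add_left ip_scale_left ip_minus_left ip_diff_left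
  ip_add_right ip_scale_right ip_diff_right

lemma ip_self_nonneg: "x \<in> vecs H \<Longrightarrow> Re (ip H x x) \<ge> 0"
  by (cases "x = 0") (auto dest: ip_self_pos intro: less_imp_le)

lemma Im_ip_self: "x \<in> vecs H \<Longrightarrow> Im (ip H x x) = 0"
  using ip_commute[of x x] by (simp add: complex_eq_iff)

lemma ip_self_eq_0: "\<lbrakk>x \<in> vecs H; ip H x x = 0\<rbrakk> \<Longrightarrow> x = 0"
  using ip_self_pos[of x] by auto

lemma norm_square: "x \<in> vecs H \<Longrightarrow> (ip_norm H x)\<^sup>2 = Re (ip H x x)"
  by (simp add: ip_norm_def ip_self_nonneg)

lemma ip_self: "x \<in> vecs H \<Longrightarrow> ip H x x = of_real ((ip_norm H x)\<^sup>2)"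
  by (simp add: norm_square complex_eq_iff Im_ip_self)

lemma norm_nonneg [simp]: "x \<in> vecs H \<Longrightarrow> ip_norm H x \<ge> 0"
  by (simp add: ip_norm_def ip_self_nonneg)

lemma norm_scale: "x \<in> vecs H \<Longrightarrow> ip_norm H (c *\<^sub>C x) = cmod c * ip_norm H x"
proof -
  assume x: "x \<in> vecs H"
  have "ip H (c *\<^sub>C x) (c *\<^sub>C x) = (c * cnj c) * ip H x x"
    using x by (simp add: ip_simps)
  also have "\<dots> = of_real ((cmod c)\<^sup>2 * Re (ip H x x))"
    unfolding ip_self[OF x] norm_square[OF x, symmetric] of_real_mult complex_norm_square[symmetric]
    by (simp only: Re_complex_of_real)
  finally show ?thesis
    by (simp add: ip_norm_def real_sqrt_mult)
qed

lemma norm_minus_commute: "\<lbrakk>x \<in> vecs H; y \<in> vecs H\<rbrakk> \<Longrightarrow> ip_norm H (x - y) = ip_norm H (y - x)"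
  using norm_scale[of "y - x" "-1"] by simp

text \<open>The coefficient \<open>t\<close> is that of the orthogonal projection onto the line of
  \<open>y\<close>, so this is Pythagoras. Nonnegativity of the left side is Cauchy-Schwarz; the
  exact value drives the variational argument in
  \<open>dense_in_if_orthogonal_trivial\<close>.\<close>

lemma norm_minus_projection:
  assumes x: "x \<in> vecs H" and y: "y \<in> vecs H" "y \<noteq> 0"
  defines "t \<equiv> ip H x y / of_real ((ip_norm H y)\<^sup>2)"
  shows "(ip_norm H (x - t *\<^sub>C y))\<^sup>2 = (ip_norm H x)\<^sup>2 - (cmod (ip H x y))\<^sup>2 / (ip_norm H y)\<^sup>2"
    and "(ip_norm H y)\<^sup>2 > 0"
proof -
  let ?n = "(ip_norm H y)\<^sup>2"
  show n: "?n > 0" using y norm_square ip_self_pos by simp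
  have "ip H (x - t *\<^sub>C y) (x - t *\<^sub>C y) =
      ip H x x - cnj t * ip H x y - t * (ip H y x - cnj t * ip H y y)"
    using x y by (simp add: ip_simps algebra_simps)
  also have "ip H y x - cnj t * ip H y y = 0"
    using n y ip_commute[OF x y(1)] by (simp add: t_def ip_self)
  also have "cnj t * ip H x y = of_real ((cmod (ip H x y))\<^sup>2 / ?n)"
    by (simp add: t_def complex_norm_square mult.commute del: of_real_power)
  finally show "(ip_norm H (x - t *\<^sub>C y))\<^sup>2 = (ip_norm H x)\<^sup>2 - (cmod (ip H x y))\<^sup>2 / ?n"
    using x y by (simp add: norm_square)
qed

lemma Cauchy_Schwarz:
  assumes x: "x \<in> vecs H" and y: "y \<in> vecs H"
  shows "cmod (ip H x y) \<le> ip_norm H x * ip_norm H y"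
proof (cases "y = 0")
  case False
  have "0 \<le> (ip_norm H x)\<^sup>2 - (cmod (ip H x y))\<^sup>2 / (ip_norm H y)\<^sup>2"
    using norm_minus_projection(1)[OF x y False] zero_le_power2 by metis
  then have "(cmod (ip H x y))\<^sup>2 \<le> (ip_norm H x * ip_norm H y)\<^sup>2"
    using norm_minus_projection(2)[OF x y False] by (simp add: field_simps)
  then show ?thesis
    using x y by (auto intro: power2_le_imp_le)
qed (use x y in auto)

lemma norm_triangle:
  assumes x: "x \<in> vecs H" and y: "y \<in> vecs H"
  shows "ip_norm H (x + y) \<le> ip_norm H x + ip_norm H y"
proof (rule power2_le_imp_le)
  have "(ip_norm H (x + y))\<^sup>2 = (ip_norm H x)\<^sup>2 + (ip_norm H y)\<^sup>2 + 2 * Re (ip H x y)"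
    using x y ip_commute[OF x y] by (simp add: norm_square ip_simps)
  moreover have "Re (ip H x y) \<le> ip_norm H x * ip_norm H y"
    using Cauchy_Schwarz[OF x y] complex_Re_le_cmod order_trans by blast
  ultimately show "(ip_norm H (x + y))\<^sup>2 \<le> (ip_norm H x + ip_norm H y)\<^sup>2"
    by (simp add: power2_sum)
qed (use x y in auto)

lemma norm_triangle_sub:
  assumes "x \<in> vecs H" "y \<in> vecs H" "z \<in> vecs H"
  shows "ip_norm H (x - z) \<le> ip_norm H (x - y) + ip_norm H (y - z)"
  using norm_triangle[of "x - y" "y - z"] assms by simp

lemma parallelogram:
  assumes x: "x \<in> vecs H" and y: "y \<in> vecs H"
  shows "(ip_norm H (x + y))\<^sup>2 + (ip_norm H (x - y))\<^sup>2 = 2 * (ip_norm H x)\<^sup>2 + 2 * (ip_norm H y)\<^sup>2"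
  using x y by (simp add: norm_square ip_simps)

lemma limit_ip:
  assumes lim: "(\<lambda>i. ip_norm H (X i - x)) \<longlonglongrightarrow> 0"
    and X: "\<And>i. X i \<in> vecs H" and x: "x \<in> vecs H" and y: "y \<in> vecs H"
  shows "(\<lambda>i. ip H (X i) y) \<longlonglongrightarrow> ip H x y"
proof (rule Lim_transform2[OF tendsto_const])
  have "(\<lambda>i. ip_norm H (X i - x) * ip_norm H y) \<longlonglongrightarrow> 0"
    by (rule tendsto_mult_left_zero[OF lim])
  then show "(\<lambda>i. ip H x y - ip H (X i) y) \<longlonglongrightarrow> 0"
  proof (rule Lim_null_comparison[rotated], intro always_eventually allI)
    show "cmod (ip H x y - ip H (X i) y) \<le> ip_norm H (X i - x) * ip_norm H y" for i
      using Cauchy_Schwarz[of "X i - x" y] X x y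
      by (simp add: ip_diff_left norm_minus_commute Real_Vector_Spaces.norm_minus_commute)
  qed
qed

text \<open>Inner products with the fixed vector \<open>x - y\<close> converge to two limits that
  must agree, which makes \<open>x - y\<close> orthogonal to itself.\<close>

lemma limit_unique:
  assumes "(\<lambda>i. ip_norm H (X i - x)) \<longlonglongrightarrow> 0" "(\<lambda>i. ip_norm H (X i - y)) \<longlonglongrightarrow> 0"
    and "\<And>i. X i \<in> vecs H" "x \<in> vecs H" "y \<in> vecs H"
  shows "x = y"
proof -
  have "ip H x (x - y) = ip H y (x - y)"
    by (rule LIMSEQ_unique[OF limit_ip[OF assms(1)] limit_ip[OF assms(2)]]) (use assms in auto)
  then have "x - y = 0"
    using assms by (intro ip_self_eq_0) (auto simp: ip_diff_left)
  then show ?thesis by simp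
qed

lemma convergent_Cauchy:
  assumes lim: "(\<lambda>i. ip_norm H (X i - x)) \<longlonglongrightarrow> 0"
    and X: "\<And>i. X i \<in> vecs H" and x: "x \<in> vecs H" and e: "0 < e"
  shows "\<exists>N::nat. \<forall>i\<ge>N. \<forall>j\<ge>N. ip_norm H (X i - X j) < e"
proof -
  obtain N where N: "\<And>i. i \<ge> N \<Longrightarrow> ip_norm H (X i - x) < e / 2"
    using LIMSEQ_D[OF lim, of "e / 2"] e X x by auto
  have "ip_norm H (X i - X j) < e" if "i \<ge> N" "j \<ge> N" for i j
    using norm_triangle_sub[of "X i" x "X j"] norm_minus_commute[of x "X j"] N[of i] N[of j] that X x
    by fastforce
  then show ?thesis by blast
qed

end

section \<open>Completeness, density and self-adjointness\<close>

lemma inner_productI: "hilbert_space H \<Longrightarrow> inner_product H"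
  by (simp add: inner_product_def hilbert_space_def)

lemma hilbert_complete:
  assumes "hilbert_space H" "\<And>i. X i \<in> vecs H"
    and "\<And>e. e > 0 \<Longrightarrow> \<exists>N::nat. \<forall>i\<ge>N. \<forall>j\<ge>N. ip_norm H (X i - X j) < e"
  obtains x where "x \<in> vecs H" "(\<lambda>i. ip_norm H (X i - x)) \<longlonglongrightarrow> 0"
  using assms unfolding hilbert_space_def by blast

text \<open>The notion evaluates the inner product at vectors only, and differences of vectors are
  vectors.\<close>

lemma hilbert_space_cong:
  assumes hilbert: "hilbert_space H" and V: "vecs H' = vecs H"
    and eq: "\<And>x y. x \<in> vecs H \<Longrightarrow> y \<in> vecs H \<Longrightarrow> ip H' x y = ip H x y"
  shows "hilbert_space H'"
proof -
  interpret H: inner_product H by (rule inner_productI[OF hilbert])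
  have "inner_product_space H'"
    unfolding inner_product_space_def V
  proof (intro conjI ballI allI impI)
    fix x y assume "x \<in> vecs H" "y \<in> vecs H"
    then show "ip H' y x = cnj (ip H' x y)"
      using eq H.ip_commute by metis
  qed (use eq H.subspace_vecs H.ip_self_pos in \<open>simp_all add: H.ip_add_left H.ip_scale_left\<close>)
  moreover have norm_eq: "ip_norm H' (x - y) = ip_norm H (x - y)" if "x \<in> vecs H" "y \<in> vecs H" for x y
    using that by (simp add: ip_norm_def eq)
  ultimately show ?thesis
    unfolding hilbert_space_def V
  proof (intro conjI allI impI)
    fix X assume A: "(\<forall>i::nat. X i \<in> vecs H) \<and>
      (\<forall>e>0. \<exists>N. \<forall>i\<ge>N. \<forall>j\<ge>N. ip_norm H' (X i - X j) < e)"
    then have X: "\<And>i. X i \<in> vecs H" by blast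
    obtain x where x: "x \<in> vecs H" "(\<lambda>i. ip_norm H (X i - x)) \<longlonglongrightarrow> 0"
      using hilbert_complete[of H X, OF hilbert X] A norm_eq[OF X X] by auto
    then show "\<exists>x\<in>vecs H. (\<lambda>i. ip_norm H' (X i - x)) \<longlonglongrightarrow> 0"
      using norm_eq[OF X] by auto
  qed simp
qed

text \<open>The projection theorem without closedness: a sequence in \<open>D\<close> minimizing the
  distance to \<open>x\<close> converges to some \<open>p\<close> that need not lie in
  \<open>D\<close>, yet \<open>x - p\<close> is orthogonal to \<open>D\<close>. The hypothesis then
  forces \<open>p = x\<close>, so the sequence itself approximates \<open>x\<close>.\<close>

theorem dense_in_if_orthogonal_trivial:
  fixes H :: "'v::complex_vector ipspace"
  assumes hilbert: "hilbert_space H"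
    and subD: "complex_vector.subspace D" and D: "D \<subseteq> vecs H"
    and trivial: "\<And>y. y \<in> vecs H \<Longrightarrow> (\<And>d. d \<in> D \<Longrightarrow> ip H d y = 0) \<Longrightarrow> y = 0"
  shows "dense_in H D"
proof -
  interpret inner_product H by (rule inner_productI[OF hilbert])
  have "\<exists>d\<in>D. ip_norm H (x - d) < e" if x: "x \<in> vecs H" and e: "e > 0" for x e
  proof -
    define s where "s = (INF d\<in>D. (ip_norm H (x - d))\<^sup>2)"
    have D0: "D \<noteq> {}" using subD complex_vector.subspace_0 by blast
    have bdd: "bdd_below ((\<lambda>d. (ip_norm H (x - d))\<^sup>2) ` D)"
      by (rule bdd_belowI2[of _ 0]) simp
    have low: "s \<le> (ip_norm H (x - d))\<^sup>2" if "d \<in> D" for d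
      unfolding s_def by (rule cINF_lower[OF bdd that])
    have "\<exists>d\<in>D. (ip_norm H (x - d))\<^sup>2 < s + inverse (real (Suc i))" for i
      using cINF_less_iff[OF D0 bdd, of "s + inverse (real (Suc i))"] by (simp add: s_def)
    then obtain X where X: "\<And>i. X i \<in> D" and
      Xs: "\<And>i. (ip_norm H (x - X i))\<^sup>2 < s + inverse (real (Suc i))"
      by metis
    have XH: "X i \<in> vecs H" for i using X D by blast
    \<comment> \<open>The midpoint of \<open>X i\<close> and \<open>X j\<close> lies in
      \<open>D\<close>, so its squared distance to \<open>x\<close> is at least \<open>s\<close>;
      the parallelogram law turns this into smallness of \<open>X i - X j\<close>.\<close>
    have par: "(ip_norm H (X i - X j))\<^sup>2 \<le> 2 * inverse (real (Suc i)) + 2 * inverse (real (Suc j))" for i j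
    proof -
      let ?m = "(1/2) *\<^sub>C (X i + X j)"
      have "?m \<in> D" using X subD by (simp add: complex_vector.subspace_add complex_vector.subspace_scale)
      then have "4 * s \<le> (ip_norm H (2 *\<^sub>C (x - ?m)))\<^sup>2"
        using low[of ?m] x D by (subst norm_scale) (auto simp: power_mult_distrib)
      also have "2 *\<^sub>C (x - ?m) = (x - X i) + (x - X j)"
        using scaleC_add_left[of 1 1 x]
        by (simp add: scaleC_simps scaleC_scaleC scaleC_one)
      finally have "4 * s + (ip_norm H ((x - X i) - (x - X j)))\<^sup>2 \<le>
          2 * (ip_norm H (x - X i))\<^sup>2 + 2 * (ip_norm H (x - X j))\<^sup>2"
        using parallelogram[of "x - X i" "x - X j"] x XH by simp
      moreover have "(x - X i) - (x - X j) = X j - X i" by simp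
      ultimately show ?thesis
        using Xs[of i] Xs[of j] norm_minus_commute[OF XH XH, of i j] by simp
    qed
    have cau: "\<exists>N::nat. \<forall>i\<ge>N. \<forall>j\<ge>N. ip_norm H (X i - X j) < \<epsilon>" if \<epsilon>: "\<epsilon> > 0" for \<epsilon>
    proof -
      obtain N where N: "inverse (real (Suc N)) < \<epsilon>\<^sup>2 / 4"
        using reals_Archimedean[of "\<epsilon>\<^sup>2 / 4"] \<epsilon> by auto
      have "ip_norm H (X i - X j) < \<epsilon>" if "i \<ge> N" "j \<ge> N" for i j
      proof (rule power2_less_imp_less)
        have "inverse (real (Suc i)) \<le> inverse (real (Suc N))" "inverse (real (Suc j)) \<le> inverse (real (Suc N))"
          using that by auto
        then show "(ip_norm H (X i - X j))\<^sup>2 < \<epsilon>\<^sup>2"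
          using par[of i j] N by linarith
      qed (use \<epsilon> in simp)
      then show ?thesis by blast
    qed
    obtain p where p: "p \<in> vecs H" and lim: "(\<lambda>i. ip_norm H (X i - p)) \<longlonglongrightarrow> 0"
      using hilbert_complete[of H X, OF hilbert XH cau] by blast
    have "x - p = 0"
    proof (rule trivial)
      fix d assume dD: "d \<in> D"
      then have d: "d \<in> vecs H" using D by blast
      show "ip H d (x - p) = 0"
      proof (cases "d = 0")
        case False
        let ?n = "(ip_norm H d)\<^sup>2"
        have n: "?n > 0" using False d norm_square ip_self_pos by simp
        \<comment> \<open>Moving \<open>X i\<close> along \<open>d\<close> by the best coefficient
          stays in \<open>D\<close>, so it can lower the squared distance by no more than its excess
          over \<open>s\<close>.\<close>
        have est: "(cmod (ip H (x - X i) d))\<^sup>2 \<le> ?n * inverse (real (Suc i))" for i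
        proof -
          define z where "z = x - X i"
          have z: "z \<in> vecs H" using x XH by (simp add: z_def)
          define t where "t = ip H z d / of_real ?n"
          have "s \<le> (ip_norm H (x - (X i + t *\<^sub>C d)))\<^sup>2"
            by (rule low) (use X dD subD in \<open>simp add: complex_vector.subspace_add complex_vector.subspace_scale\<close>)
          also have "x - (X i + t *\<^sub>C d) = z - t *\<^sub>C d" by (simp add: z_def)
          also have "(ip_norm H (z - t *\<^sub>C d))\<^sup>2 = (ip_norm H z)\<^sup>2 - (cmod (ip H z d))\<^sup>2 / ?n"
            unfolding t_def by (rule norm_minus_projection(1)[OF z d False])
          finally have "(cmod (ip H z d))\<^sup>2 / ?n \<le> inverse (real (Suc i))"
            using Xs[of i] by (simp add: z_def)
          then show ?thesis using n by (simp add: z_def field_simps)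
        qed
        have "(\<lambda>i. ip H (x - X i) d) \<longlonglongrightarrow> ip H (x - p) d"
        proof (rule limit_ip)
          show "(\<lambda>i. ip_norm H (x - X i - (x - p))) \<longlonglongrightarrow> 0"
            using lim by (simp add: norm_minus_commute[OF p XH])
        qed (use x p XH d in auto)
        then have "(\<lambda>i. (cmod (ip H (x - X i) d))\<^sup>2) \<longlonglongrightarrow> (cmod (ip H (x - p) d))\<^sup>2"
          by (intro tendsto_intros)
        moreover have "(\<lambda>i. ?n * inverse (real (Suc i))) \<longlonglongrightarrow> ?n * 0"
          by (intro tendsto_mult tendsto_const LIMSEQ_inverse_real_of_nat)
        ultimately have "(cmod (ip H (x - p) d))\<^sup>2 \<le> ?n * 0"
          by (rule LIMSEQ_le) (use est in blast)
        then show ?thesis using ip_commute[of "x - p" d] x p d by simp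
      qed (use x p in simp)
    qed (use x p in simp)
    then obtain i where "ip_norm H (X i - x) < e"
      using LIMSEQ_D[OF lim e] XH p by auto
    then show ?thesis using X norm_minus_commute[OF x XH] by metis
  qed
  then show ?thesis using D by (simp add: dense_in_def)
qed

text \<open>A symmetric operator that is onto automatically has dense domain.\<close>

theorem self_adjointI:
  assumes hilbert: "hilbert_space H" and lin: "linear_operator H A"
    and sym: "\<And>x w y z. (x, w) \<in> A \<Longrightarrow> (y, z) \<in> A \<Longrightarrow> ip H w y = ip H x z"
    and onto: "\<And>v. v \<in> vecs H \<Longrightarrow> \<exists>x. (x, v) \<in> A"
  shows "self_adjoint H A"
proof -
  interpret inner_product H by (rule inner_productI[OF hilbert])
  have A: "A \<subseteq> vecs H \<times> vecs H" "single_valued A" "(0, 0) \<in> A"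
    using lin by (auto simp: linear_operator_def)
  have "dense_in H (Domain A)"
  proof (rule dense_in_if_orthogonal_trivial[OF hilbert])
    show "complex_vector.subspace (Domain A)"
      using lin unfolding linear_operator_def complex_vector.subspace_def by blast
    fix y assume y: "y \<in> vecs H" and orth: "\<And>d. d \<in> Domain A \<Longrightarrow> ip H d y = 0"
    obtain u where u: "(u, y) \<in> A" using onto[OF y] by blast
    then have uH: "u \<in> vecs H" using A by blast
    obtain x where x: "(x, u) \<in> A" using onto[OF uH] by blast
    have "ip H u u = ip H x y" using sym[OF x u] .
    also have "\<dots> = 0" using orth x by blast
    finally have "u = 0" using uH ip_self_eq_0 by blast
    then show "y = 0" using u A by (auto dest: single_valuedD)
  qed (use A in blast)
  moreover have "adjoint_operator H A = A"
  proof
    show "A \<subseteq> adjoint_operator H A"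
      using A sym by (auto simp: adjoint_operator_def)
    show "adjoint_operator H A \<subseteq> A"
    proof (clarify)
      fix y z assume "(y, z) \<in> adjoint_operator H A"
      then have y: "y \<in> vecs H" and z: "z \<in> vecs H"
        and adj: "\<And>x w. (x, w) \<in> A \<Longrightarrow> ip H w y = ip H x z"
        by (auto simp: adjoint_operator_def)
      obtain u where u: "(u, z) \<in> A" using onto[OF z] by blast
      then have uH: "u \<in> vecs H" using A by blast
      obtain x where x: "(x, y - u) \<in> A" using onto[of "y - u"] y uH by blast
      have "ip H (y - u) (y - u) = 0"
        using adj[OF x] sym[OF x u] y uH by (simp add: ip_simps)
      then have "y - u = 0" using y uH by (intro ip_self_eq_0) auto
      then show "(y, z) \<in> A" using u by simp
    qed
  qed
  ultimately show ?thesis using lin by (simp add: self_adjoint_def)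
qed

text \<open>Taking adjoints reverses inclusions, so \<open>B \<subseteq> A\<close> also yields
  \<open>A \<subseteq> B\<close>.\<close>

lemma self_adjoint_maximal:
  assumes "self_adjoint H A" "self_adjoint H B" "B \<subseteq> A"
  shows "B = A"
proof -
  have "adjoint_operator H A \<subseteq> adjoint_operator H B"
    using assms(3) by (auto simp: adjoint_operator_def)
  then show ?thesis using assms by (simp add: self_adjoint_def)
qed

text \<open>The norms of \<open>K\<close> and \<open>L\<close> agree on the domain of
  \<open>A ^^ r\<close>, so a sequence from it converging in \<open>K\<close> is Cauchy in
  \<open>L\<close>. Both norms dominate a multiple of the norm of \<open>H\<close>, where the two
  limits can be compared.\<close>

lemma left_definite_space_limit:
  assumes K: "left_definite_space H A k r K" and L: "left_definite_space H A k r L"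
    and x: "x \<in> vecs K"
  obtains X where "x \<in> vecs L" "\<And>i. X i \<in> Domain (A ^^ r)"
    "(\<lambda>i. ip_norm K (X i - x)) \<longlonglongrightarrow> 0" "(\<lambda>i. ip_norm L (X i - x)) \<longlonglongrightarrow> 0"
proof -
  let ?D = "Domain (A ^^ r)"
  have H: "hilbert_space H" and hK: "hilbert_space K" and hL: "hilbert_space L"
    and k: "0 < k" and subD: "complex_vector.subspace ?D"
    and DK: "?D \<subseteq> vecs K" and DL: "?D \<subseteq> vecs L"
    and KH: "vecs K \<subseteq> vecs H" and LH: "vecs L \<subseteq> vecs H"
    and dense: "dense_in K ?D"
    and K2: "\<And>x. x \<in> vecs K \<Longrightarrow> Re (ip K x x) \<ge> k ^ r * Re (ip H x x)"
    and L2: "\<And>x. x \<in> vecs L \<Longrightarrow> Re (ip L x x) \<ge> k ^ r * Re (ip H x x)"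
    using K L unfolding left_definite_space_def by blast+
  interpret H: inner_product H by (rule inner_productI[OF H])
  interpret K: inner_product K by (rule inner_productI[OF hK])
  interpret L: inner_product L by (rule inner_productI[OF hL])
  \<comment> \<open>Condition (5) computes both norms of \<open>d\<close> from the same inner
    product in \<open>H\<close>.\<close>
  have same: "ip_norm K d = ip_norm L d" if "d \<in> ?D" for d
    using that K L DK DL unfolding left_definite_space_def ip_norm_def by force
  have tendsto_H: "(\<lambda>i. ip_norm H (X i)) \<longlonglongrightarrow> 0"
    if lim: "(\<lambda>i. ip_norm M (X i)) \<longlonglongrightarrow> 0"
      and M: "\<And>i. X i \<in> vecs H" "\<And>i. Re (ip M (X i) (X i)) \<ge> k ^ r * Re (ip H (X i) (X i))" for M X
  proof (rule Lim_null_comparison, intro always_eventually allI)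
    show "norm (ip_norm H (X i)) \<le> ip_norm M (X i) / sqrt (k ^ r)" for i
      using M[of i] k unfolding ip_norm_def
      by (simp add: H.ip_self_nonneg real_sqrt_divide[symmetric] pos_le_divide_eq mult.commute)
    show "(\<lambda>i. ip_norm M (X i) / sqrt (k ^ r)) \<longlonglongrightarrow> 0"
      using tendsto_divide_zero[OF lim] .
  qed
  have "\<exists>d\<in>?D. ip_norm K (x - d) < inverse (real (Suc i))" for i
    using dense x unfolding dense_in_def by simp
  then obtain X where XD: "\<And>i. X i \<in> ?D" and Xi: "\<And>i. ip_norm K (x - X i) < inverse (real (Suc i))"
    by metis
  have XK: "X i \<in> vecs K" and XL: "X i \<in> vecs L" for i using XD DK DL by blast+
  have limK: "(\<lambda>i. ip_norm K (X i - x)) \<longlonglongrightarrow> 0"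
  proof (rule Lim_null_comparison[OF _ LIMSEQ_inverse_real_of_nat], intro always_eventually allI)
    show "norm (ip_norm K (X i - x)) \<le> inverse (real (Suc i))" for i
      using Xi[of i] K.norm_minus_commute[OF x XK] XK x by simp
  qed
  have diff: "ip_norm L (X i - X j) = ip_norm K (X i - X j)" for i j
    using same[of "X i - X j"] XD subD by (simp add: complex_vector.subspace_diff)
  obtain y where y: "y \<in> vecs L" and limL: "(\<lambda>i. ip_norm L (X i - y)) \<longlonglongrightarrow> 0"
    using hilbert_complete[of L X, OF hL XL K.convergent_Cauchy[OF limK XK x, folded diff]] by metis
  have "x = y"
  proof (rule H.limit_unique)
    show "(\<lambda>i. ip_norm H (X i - x)) \<longlonglongrightarrow> 0"
      using x XK KH by (intro tendsto_H[OF limK]) (auto intro!: K2)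
    show "(\<lambda>i. ip_norm H (X i - y)) \<longlonglongrightarrow> 0"
      using y XL LH by (intro tendsto_H[OF limL]) (auto intro!: L2)
  qed (use x y XK KH LH in blast)+
  with that limK limL XD y show thesis by blast
qed

text \<open>Against a fixed \<open>y\<close>, condition (5) prescribes the inner product on the
  domain of \<open>A ^^ r\<close>; approximation in both norms at once extends the agreement to all
  vectors.\<close>

theorem left_definite_space_unique:
  assumes K: "left_definite_space H A k r K" and L: "left_definite_space H A k r L"
  shows "vecs K = vecs L" "\<lbrakk>x \<in> vecs K; y \<in> vecs K\<rbrakk> \<Longrightarrow> ip K x y = ip L x y"
proof -
  show eq: "vecs K = vecs L"
    using left_definite_space_limit[OF K L] left_definite_space_limit[OF L K] by blast
  assume x: "x \<in> vecs K" and y: "y \<in> vecs K"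
  interpret K: inner_product K
    using K by (auto simp: left_definite_space_def intro: inner_productI)
  interpret L: inner_product L
    using L by (auto simp: left_definite_space_def intro: inner_productI)
  obtain X where X: "\<And>i. X i \<in> Domain (A ^^ r)"
    and limK: "(\<lambda>i. ip_norm K (X i - x)) \<longlonglongrightarrow> 0" and limL: "(\<lambda>i. ip_norm L (X i - x)) \<longlonglongrightarrow> 0"
    using left_definite_space_limit[OF K L x] by metis
  have XK: "X i \<in> vecs K" for i
    using X K unfolding left_definite_space_def by blast
  have "ip K (X i) y = ip L (X i) y" for i
    using X[of i] K L y eq unfolding left_definite_space_def by force
  then have "(\<lambda>i. ip K (X i) y) \<longlonglongrightarrow> ip L x y"
    using L.limit_ip[OF limL, of y] XK x y eq by simp
  with K.limit_ip[OF limK XK x y] show "ip K x y = ip L x y"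
    using LIMSEQ_unique by blast
qed

text \<open>Needed because \<open>semi_periodic_space\<close> evaluates its inner product through
  chosen representatives, which is meaningful for its vectors only.\<close>

lemma left_definite_space_cong:
  assumes K: "left_definite_space H A k r K" and V: "vecs K' = vecs K"
    and eq: "\<And>x y. x \<in> vecs K \<Longrightarrow> y \<in> vecs K \<Longrightarrow> ip K' x y = ip K x y"
  shows "left_definite_space H A k r K'"
proof -
  have hK: "hilbert_space K" and D: "Domain (A ^^ r) \<subseteq> vecs K" and dense: "dense_in K (Domain (A ^^ r))"
    and lower: "\<And>x. x \<in> vecs K \<Longrightarrow> Re (ip K x x) \<ge> k ^ r * Re (ip H x x)"
    and ip: "\<And>x w y. (x, w) \<in> A ^^ r \<Longrightarrow> y \<in> vecs K \<Longrightarrow> ip K x y = ip H w y"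
    using K unfolding left_definite_space_def by blast+
  interpret inner_product K by (rule inner_productI[OF hK])
  have norm: "ip_norm K' (x - d) = ip_norm K (x - d)" if "x \<in> vecs K" "d \<in> Domain (A ^^ r)" for x d
    using that D by (auto simp: ip_norm_def intro!: arg_cong[of _ _ Re] eq)
  have "\<exists>d\<in>Domain (A ^^ r). ip_norm K' (x - d) < e" if "x \<in> vecs K" "e > 0" for x e
    using dense that norm[OF that(1)] unfolding dense_in_def by auto
  then have "dense_in K' (Domain (A ^^ r))"
    using D unfolding dense_in_def V by blast
  moreover have "ip K' x y = ip H w y" if "(x, w) \<in> A ^^ r" "y \<in> vecs K" for x w y
    using ip[OF that] eq[of x y] that D by auto
  moreover have "Re (ip K' x x) \<ge> k ^ r * Re (ip H x x)" if "x \<in> vecs K" for x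
    using lower[OF that] eq[OF that that] by simp
  ultimately show ?thesis
    using K hilbert_space_cong[OF hK V eq] unfolding left_definite_space_def V by auto
qed

section \<open>Operators of the form \<open>k - D\<^sup>2\<close> with \<open>D\<close> skew-adjoint\<close>

text \<open>
  \<open>T\<close> plays the role of the inverse of the skew-adjoint operator \<open>D = d/dx\<close>, and \<open>S\<close> that of
  the spectrum of \<open>D\<close>. The equation \<open>h - \<sigma> T h = v\<close> says that \<open>x = T h\<close> solves
  \<open>D x - \<sigma> x = v\<close>.
\<close>

locale skew_inverse =
  fixes K :: "'v::complex_vector ipspace" and T D :: "'v \<Rightarrow> 'v" and k :: real and S :: "complex set"
  assumes hilbert: "hilbert_space K"
    and T_in [simp]: "x \<in> vecs K \<Longrightarrow> T x \<in> vecs K"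
    and T_add: "\<lbrakk>x \<in> vecs K; y \<in> vecs K\<rbrakk> \<Longrightarrow> T (x + y) = T x + T y"
    and T_scale: "x \<in> vecs K \<Longrightarrow> T (c *\<^sub>C x) = c *\<^sub>C T x"
    and T_bounded: "\<exists>C. \<forall>x\<in>vecs K. ip_norm K (T x) \<le> C * ip_norm K x"
    and D_T [simp]: "x \<in> vecs K \<Longrightarrow> D (T x) = x"
    and T_skew: "\<lbrakk>x \<in> vecs K; y \<in> vecs K\<rbrakk> \<Longrightarrow> ip K (T x) y = - ip K x (T y)"
    and k_pos: "0 < k"
    and eigenvector: "\<tau> \<in> S \<Longrightarrow> \<exists>u\<in>vecs K. u \<noteq> 0 \<and> u = T (\<tau> *\<^sub>C u)"
    and eigenspace_finite:
      "\<exists>B. finite B \<and> {u \<in> vecs K. u = T (\<tau> *\<^sub>C u)} \<subseteq> complex_vector.span B"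
    and resolvent_inj: "\<lbrakk>\<sigma> \<notin> S; h \<in> vecs K; h = \<sigma> *\<^sub>C T h\<rbrakk> \<Longrightarrow> h = 0"
    and resolvent_surj: "\<sigma> \<notin> S \<Longrightarrow>
      \<exists>C. \<forall>v\<in>vecs K. \<exists>h\<in>vecs K. h - \<sigma> *\<^sub>C T h = v \<and> ip_norm K (T h) \<le> C * ip_norm K v"

sublocale skew_inverse \<subseteq> inner_product K
  by (rule inner_productI[OF hilbert])

text \<open>Carries the whole structure to a left-definite space that uniqueness identifies up to
  values of the inner product off the vectors.\<close>

lemma skew_inverse_cong:
  assumes "skew_inverse K T D k S" and V: "vecs K' = vecs K"
    and eq: "\<And>x y. x \<in> vecs K \<Longrightarrow> y \<in> vecs K \<Longrightarrow> ip K' x y = ip K x y"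
  shows "skew_inverse K' T D k S"
proof -
  interpret skew_inverse K T D k S by fact
  have norm: "ip_norm K' x = ip_norm K x" if "x \<in> vecs K" for x
    using that by (simp add: ip_norm_def eq)
  have bounded: "\<exists>C. \<forall>x\<in>vecs K. ip_norm K' (T x) \<le> C * ip_norm K' x"
    using T_bounded norm T_in by metis
  have surj: "\<exists>C. \<forall>v\<in>vecs K. \<exists>h\<in>vecs K. h - \<sigma> *\<^sub>C T h = v \<and> ip_norm K' (T h) \<le> C * ip_norm K' v"
    if "\<sigma> \<notin> S" for \<sigma>
  proof -
    obtain C where "\<forall>v\<in>vecs K. \<exists>h\<in>vecs K. h - \<sigma> *\<^sub>C T h = v \<and> ip_norm K (T h) \<le> C * ip_norm K v"
      using resolvent_surj[OF \<open>\<sigma> \<notin> S\<close>] by blast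
    then show ?thesis
      by (intro exI[of _ C]) (simp add: norm cong: conj_cong bex_cong)
  qed
  have skew: "ip K' (T x) y = - ip K' x (T y)" if "x \<in> vecs K" "y \<in> vecs K" for x y
    using that T_skew by (simp add: eq)
  show ?thesis
    by (unfold_locales, unfold V)
      (blast intro: hilbert_space_cong[OF hilbert V eq] T_in T_add T_scale D_T k_pos
        bounded skew surj eigenvector eigenspace_finite resolvent_inj)+
qed

section \<open>The space one derivative higher\<close>

context skew_inverse
begin

lemma T_zero [simp]: "T 0 = 0"
  using T_scale[of 0 0] by simp

lemma T_minus: "x \<in> vecs K \<Longrightarrow> T (- x) = - T x"
  using T_scale[of x "-1"] by simp

lemma T_diff: "\<lbrakk>x \<in> vecs K; y \<in> vecs K\<rbrakk> \<Longrightarrow> T (x - y) = T x - T y"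
  using T_add[of x "- y"] by (simp add: T_minus)

lemmas T_linear = T_add T_scale T_minus T_diff

lemma T_eq_iff: "\<lbrakk>x \<in> vecs K; y \<in> vecs K\<rbrakk> \<Longrightarrow> T x = T y \<longleftrightarrow> x = y"
  using D_T by metis

lemma subspace_range: "complex_vector.subspace (T ` vecs K)"
  unfolding complex_vector.subspace_def
  by (auto simp: T_linear[symmetric] intro: image_eqI[of 0 T 0])

lemma Re_ip_T_self: "x \<in> vecs K \<Longrightarrow> Re (ip K (T x) x) = 0"
  using arg_cong[OF T_skew[of x x], of Re] arg_cong[OF ip_commute[of "T x" x], of Re] by simp

text \<open>
  The passage from \<open>H\<^sub>n\<close> to \<open>H\<^bsub>n+1\<^esub>\<close>.
\<close>

definition step :: "'v ipspace" where
  "step = \<lparr>vecs = T ` vecs K, ip = (\<lambda>x y. of_real k * ip K x y + ip K (D x) (D y))\<rparr>"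

lemma vecs_step: "vecs step = T ` vecs K"
  and ip_step: "ip step x y = of_real k * ip K x y + ip K (D x) (D y)"
  by (simp_all add: step_def)

lemma norm_step: "h \<in> vecs K \<Longrightarrow> ip_norm step (T h) = sqrt (k * (ip_norm K (T h))\<^sup>2 + (ip_norm K h)\<^sup>2)"
  by (simp add: ip_norm_def[of step] ip_step norm_square)

lemma inner_product_space_step: "inner_product_space step"
  unfolding inner_product_space_def vecs_step
proof (intro conjI ballI allI impI)
  show "complex_vector.subspace (T ` vecs K)" by (rule subspace_range)
next
  fix x y z assume "x \<in> T ` vecs K" "y \<in> T ` vecs K" "z \<in> T ` vecs K"
  then obtain f g h where *: "f \<in> vecs K" "g \<in> vecs K" "h \<in> vecs K" "x = T f" "y = T g" "z = T h"
    by blast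
  then have "D (x + y) = f + g" by (simp add: T_add[symmetric])
  then show "ip step (x + y) z = ip step x z + ip step y z"
    using * by (simp add: ip_step ip_simps algebra_simps)
next
  fix c x y assume "x \<in> T ` vecs K" "y \<in> T ` vecs K"
  then obtain f g where *: "f \<in> vecs K" "g \<in> vecs K" "x = T f" "y = T g"
    by blast
  then have "D (c *\<^sub>C x) = c *\<^sub>C f" by (simp add: T_scale[symmetric])
  then show "ip step (c *\<^sub>C x) y = c * ip step x y"
    using * by (simp add: ip_step ip_simps algebra_simps)
next
  fix x y assume "x \<in> T ` vecs K" "y \<in> T ` vecs K"
  then obtain f g where *: "f \<in> vecs K" "g \<in> vecs K" "x = T f" "y = T g"
    by blast
  then show "ip step y x = cnj (ip step x y)"
    using ip_commute[of f g] ip_commute[of x y] by (simp add: ip_step)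
next
  fix x assume "x \<in> T ` vecs K" "x \<noteq> 0"
  then obtain f where "f \<in> vecs K" "x = T f" by blast
  then show "0 < Re (ip step x x)"
    using \<open>x \<noteq> 0\<close> k_pos ip_self_pos[of x] ip_self_nonneg[of f] by (simp add: ip_step add_pos_nonneg)
qed

text \<open>The new norm of \<open>T h\<close> dominates the old norm of \<open>h\<close>. Hence a
  Cauchy sequence of vectors \<open>T h\<close> has Cauchy preimages, and boundedness of
  \<open>T\<close> carries their limit back in both parts of the norm.\<close>

lemma hilbert_space_step: "hilbert_space step"
  unfolding hilbert_space_def
proof (intro conjI allI impI inner_product_space_step)
  fix X assume A: "(\<forall>i. X i \<in> vecs step) \<and>
    (\<forall>e>0. \<exists>N::nat. \<forall>i\<ge>N. \<forall>j\<ge>N. ip_norm step (X i - X j) < e)"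
  obtain C where C: "\<And>x. x \<in> vecs K \<Longrightarrow> ip_norm K (T x) \<le> C * ip_norm K x"
    using T_bounded by blast
  from A obtain Y where Y: "\<And>i. Y i \<in> vecs K" and XY: "\<And>i. X i = T (Y i)"
    unfolding vecs_step image_iff by metis
  have le: "ip_norm K (Y i - Y j) \<le> ip_norm step (X i - X j)" for i j
    using Y k_pos by (simp add: XY T_diff[symmetric] norm_step real_le_rsqrt)
  have "\<exists>N::nat. \<forall>i\<ge>N. \<forall>j\<ge>N. ip_norm K (Y i - Y j) < e" if "e > 0" for e
    using A that le by (meson order_le_less_trans)
  then obtain y where y: "y \<in> vecs K" and lim: "(\<lambda>i. ip_norm K (Y i - y)) \<longlonglongrightarrow> 0"
    using hilbert_complete[of K Y, OF hilbert Y] by blast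
  have "(\<lambda>i. ip_norm K (T (Y i - y))) \<longlonglongrightarrow> 0"
  proof (rule Lim_null_comparison, intro always_eventually allI)
    show "norm (ip_norm K (T (Y i - y))) \<le> C * ip_norm K (Y i - y)" for i
      using C[of "Y i - y"] Y y by simp
    show "(\<lambda>i. C * ip_norm K (Y i - y)) \<longlonglongrightarrow> 0"
      by (rule tendsto_mult_right_zero[OF lim])
  qed
  then have "(\<lambda>i. sqrt (k * (ip_norm K (T (Y i - y)))\<^sup>2 + (ip_norm K (Y i - y))\<^sup>2)) \<longlonglongrightarrow> sqrt (k * 0\<^sup>2 + 0\<^sup>2)"
    by (intro tendsto_intros lim)
  then have "(\<lambda>i. ip_norm step (X i - T y)) \<longlonglongrightarrow> 0"
    using Y y by (simp add: XY T_diff[symmetric] norm_step)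
  then show "\<exists>x\<in>vecs step. (\<lambda>i. ip_norm step (X i - x)) \<longlonglongrightarrow> 0"
    using y unfolding vecs_step by blast
qed

text \<open>The absolute value appears because the constants in the boundedness hypotheses may be
  negative; the proof squares the estimates.\<close>

lemma norm_step_mono:
  assumes "h \<in> vecs K" "h' \<in> vecs K"
    and "ip_norm K (T h) \<le> C * ip_norm K (T h')" "ip_norm K h \<le> C * ip_norm K h'"
  shows "ip_norm step (T h) \<le> \<bar>C\<bar> * ip_norm step (T h')"
proof -
  have "(ip_norm K (T h))\<^sup>2 \<le> C\<^sup>2 * (ip_norm K (T h'))\<^sup>2" "(ip_norm K h)\<^sup>2 \<le> C\<^sup>2 * (ip_norm K h')\<^sup>2"
    using assms by (auto simp: power_mult_distrib[symmetric] intro!: power_mono)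
  then have "k * (ip_norm K (T h))\<^sup>2 + (ip_norm K h)\<^sup>2 \<le> C\<^sup>2 * (k * (ip_norm K (T h'))\<^sup>2 + (ip_norm K h')\<^sup>2)"
    using k_pos mult_left_mono[of "(ip_norm K (T h))\<^sup>2" "C\<^sup>2 * (ip_norm K (T h'))\<^sup>2" k]
    by (simp add: distrib_left mult.left_commute[of "C\<^sup>2" k] add_mono)
  then have "sqrt (k * (ip_norm K (T h))\<^sup>2 + (ip_norm K h)\<^sup>2) \<le> sqrt (C\<^sup>2 * (k * (ip_norm K (T h'))\<^sup>2 + (ip_norm K h')\<^sup>2))"
    by simp
  then show ?thesis
    using assms by (simp add: norm_step real_sqrt_mult)
qed

lemma step_skew_inverse: "skew_inverse step T D k S"
proof (unfold_locales, unfold vecs_step)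
  show "hilbert_space step" by (rule hilbert_space_step)
  show "\<exists>C. \<forall>x\<in>T ` vecs K. ip_norm step (T x) \<le> C * ip_norm step x"
  proof -
    obtain C where "\<And>x. x \<in> vecs K \<Longrightarrow> ip_norm K (T x) \<le> C * ip_norm K x"
      using T_bounded by blast
    then have "ip_norm step (T (T h)) \<le> \<bar>C\<bar> * ip_norm step (T h)" if "h \<in> vecs K" for h
      using that by (intro norm_step_mono) auto
    then show ?thesis by blast
  qed
  show "\<exists>u\<in>T ` vecs K. u \<noteq> 0 \<and> u = T (\<tau> *\<^sub>C u)" if \<tau>: "\<tau> \<in> S" for \<tau>
  proof -
    obtain u where "u \<in> vecs K" "u \<noteq> 0" "u = T (\<tau> *\<^sub>C u)"
      using eigenvector[OF \<tau>] by blast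
    then show ?thesis
      by (intro bexI[of _ u] image_eqI[of u T "\<tau> *\<^sub>C u"]) auto
  qed
  show "\<exists>B. finite B \<and> {u \<in> T ` vecs K. u = T (\<tau> *\<^sub>C u)} \<subseteq> complex_vector.span B" for \<tau>
    using eigenspace_finite[of \<tau>] by fastforce
  show "\<exists>C. \<forall>v\<in>T ` vecs K. \<exists>h\<in>T ` vecs K. h - \<sigma> *\<^sub>C T h = v \<and> ip_norm step (T h) \<le> C * ip_norm step v"
    if \<sigma>: "\<sigma> \<notin> S" for \<sigma>
  \<comment> \<open>Solving for \<open>w\<close> gives \<open>h\<close>, and \<open>T h\<close> then
    solves for \<open>T w\<close>. The new norm of \<open>T (T h)\<close> needs old bounds for
    \<open>T h\<close> and for \<open>T (T h)\<close>. The first comes with \<open>h\<close>; the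
    second comes with the solution \<open>h'\<close> for \<open>T w\<close>, which equals
    \<open>T h\<close> by injectivity.\<close>
  proof -
    obtain C where C: "\<And>v. v \<in> vecs K \<Longrightarrow>
        \<exists>h\<in>vecs K. h - \<sigma> *\<^sub>C T h = v \<and> ip_norm K (T h) \<le> C * ip_norm K v"
      using resolvent_surj[OF \<sigma>] by blast
    have "\<exists>h\<in>T ` vecs K. h - \<sigma> *\<^sub>C T h = T w \<and> ip_norm step (T h) \<le> \<bar>C\<bar> * ip_norm step (T w)"
      if w: "w \<in> vecs K" for w
    proof -
      obtain h where h: "h \<in> vecs K" "h - \<sigma> *\<^sub>C T h = w" and le: "ip_norm K (T h) \<le> C * ip_norm K w"
        using C[OF w] by blast
      obtain h' where h': "h' \<in> vecs K" "h' - \<sigma> *\<^sub>C T h' = T w"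
          and le': "ip_norm K (T h') \<le> C * ip_norm K (T w)"
        using C[of "T w"] w by auto
      have T_w: "T h - \<sigma> *\<^sub>C T (T h) = T w"
        using h by (auto simp: T_linear)
      have "(T h - h') - \<sigma> *\<^sub>C T (T h - h') = (T h - \<sigma> *\<^sub>C T (T h)) - (h' - \<sigma> *\<^sub>C T h')"
        using h(1) h'(1) by (simp add: T_linear scaleC_simps)
      then have "T h - h' = \<sigma> *\<^sub>C T (T h - h')"
        unfolding T_w h'(2) by simp
      then have "T h - h' = 0"
        using h(1) h'(1) by (intro resolvent_inj[OF \<sigma>]) auto
      then have "ip_norm K (T (T h)) \<le> C * ip_norm K (T w)"
        using le' by simp
      then have "ip_norm step (T (T h)) \<le> \<bar>C\<bar> * ip_norm step (T w)"
        using h w le by (intro norm_step_mono) auto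
      then show ?thesis
        using h T_w by (intro bexI[of _ "T h"]) auto
    qed
    then show ?thesis by blast
  qed
  show "ip step (T x) y = - ip step x (T y)" if xy: "x \<in> T ` vecs K" "y \<in> T ` vecs K" for x y
  proof -
    obtain f g where *: "f \<in> vecs K" "g \<in> vecs K" "x = T f" "y = T g"
      using xy by blast
    then show ?thesis
      using T_skew[of "T f" "T g"] T_skew[of f g] by (simp add: ip_step)
  qed
  show "h = 0" if "\<sigma> \<notin> S" "h \<in> T ` vecs K" "h = \<sigma> *\<^sub>C T h" for \<sigma> h
    using that by (intro resolvent_inj[of \<sigma>]) auto
qed (auto simp: T_linear k_pos)

section \<open>Resolvent, spectrum and self-adjointness of the second-order operator\<close>

text \<open>The graph of \<open>k - D\<^sup>2\<close>, parametrized by \<open>h = D (D x)\<close>.\<close>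

definition opA :: "'v operator" where
  "opA = {(T (T h), of_real k *\<^sub>C T (T h) - h) | h. h \<in> vecs K}"

lemma opAI: "h \<in> vecs K \<Longrightarrow> (T (T h), of_real k *\<^sub>C T (T h) - h) \<in> opA"
  by (auto simp: opA_def)

lemma opAE:
  assumes "(x, y) \<in> opA"
  obtains h where "h \<in> vecs K" "x = T (T h)" "y = of_real k *\<^sub>C x - h"
  using assms by (auto simp: opA_def)

lemma opA_vecs: "(x, y) \<in> opA \<Longrightarrow> x \<in> vecs K \<and> y \<in> vecs K"
  by (auto elim!: opAE)

text \<open>With \<open>h\<close> standing for \<open>D (D x)\<close> and \<open>T h\<close> for
  \<open>D x\<close>, this is the remark that \<open>D x + \<sigma> x\<close> is an eigenvector of
  \<open>D\<close> for \<open>\<sigma>\<close> whenever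
  \<open>D (D x) = \<sigma>\<^sup>2 x\<close>.\<close>

lemma eigenvector_factor:
  assumes h: "h \<in> vecs K" "h = \<sigma>\<^sup>2 *\<^sub>C x" and x: "x = T (T h)"
  shows "T h + \<sigma> *\<^sub>C x = \<sigma> *\<^sub>C T (T h + \<sigma> *\<^sub>C x)"
proof -
  have xK: "x \<in> vecs K" using h(1) x by simp
  have Th: "T h = (\<sigma> * \<sigma>) *\<^sub>C T x"
    using arg_cong[OF h(2), of T] T_scale[OF xK] by (simp add: power2_eq_square)
  have "\<sigma> *\<^sub>C T (T h + \<sigma> *\<^sub>C x) = \<sigma> *\<^sub>C T (T h) + (\<sigma> * \<sigma>) *\<^sub>C T x"
    using h(1) xK by (simp add: T_linear scaleC_simps scaleC_scaleC)
  then show ?thesis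
    unfolding x[symmetric] Th[symmetric] by simp
qed

text \<open>Two first-order equations are solved in turn: \<open>D y - \<sigma> y = - v\<close> with
  \<open>y = T h1\<close>, and \<open>D x + \<sigma> x = y\<close> with \<open>x = T h2\<close>.
  Multiplying their bounds gives the resolvent bound, which uniqueness extends from the constructed
  preimage to every pair of the graph.\<close>

lemma opA_resolvent:
  assumes S: "\<sigma> \<notin> S" "- \<sigma> \<notin> S" and z: "of_real k - \<sigma>\<^sup>2 = z"
  shows "z \<in> resolvent_set K opA"
proof -
  obtain C1 where C1: "\<And>v. v \<in> vecs K \<Longrightarrow>
      \<exists>h\<in>vecs K. h - \<sigma> *\<^sub>C T h = v \<and> ip_norm K (T h) \<le> C1 * ip_norm K v"
    using resolvent_surj[OF S(1)] by blast
  obtain C2 where C2: "\<And>v. v \<in> vecs K \<Longrightarrow>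
      \<exists>h\<in>vecs K. h - (- \<sigma>) *\<^sub>C T h = v \<and> ip_norm K (T h) \<le> C2 * ip_norm K v"
    using resolvent_surj[OF S(2)] by blast
  have ex: "\<exists>x y. (x, y) \<in> opA \<and> y - z *\<^sub>C x = v \<and> ip_norm K x \<le> (\<bar>C2\<bar> * \<bar>C1\<bar>) * ip_norm K v"
    if v: "v \<in> vecs K" for v
  proof -
    obtain h1 where h1: "h1 \<in> vecs K" "h1 - \<sigma> *\<^sub>C T h1 = - v"
      and le1: "ip_norm K (T h1) \<le> C1 * ip_norm K (- v)"
      using C1[of "- v"] v by auto
    obtain h2 where h2: "h2 \<in> vecs K" "h2 - (- \<sigma>) *\<^sub>C T h2 = T h1"
      and le2: "ip_norm K (T h2) \<le> C2 * ip_norm K (T h1)"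
      using C2[of "T h1"] h1 by auto
    \<comment> \<open>The value that \<open>D h2\<close> must have, read off by applying
      \<open>D\<close> to \<open>h2 + \<sigma> T h2 = T h1\<close>.\<close>
    define g where "g = h1 - \<sigma> *\<^sub>C h2"
    have g: "g \<in> vecs K" using h1 h2 by (simp add: g_def)
    have Tg: "T g = h2"
      using h1(1) h2 by (simp add: g_def T_linear algebra_simps)
    have "h1 = \<sigma> *\<^sub>C T h1 - v"
      using h1(2) by (simp add: algebra_simps)
    also have "T h1 = h2 + \<sigma> *\<^sub>C T h2"
      using h2(2) by simp
    finally have g_eq: "g = \<sigma>\<^sup>2 *\<^sub>C T h2 - v"
      by (simp add: g_def scaleC_simps scaleC_scaleC power2_eq_square)
    have "of_real k *\<^sub>C T (T g) - g - z *\<^sub>C T (T g) = v"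
      unfolding Tg by (subst g_eq) (simp add: z[symmetric] scaleC_simps)
    moreover have "ip_norm K (T (T g)) \<le> (\<bar>C2\<bar> * \<bar>C1\<bar>) * ip_norm K v"
    proof -
      have "ip_norm K (T (T g)) \<le> C2 * ip_norm K (T h1)"
        using le2 by (simp add: Tg)
      also have "\<dots> \<le> \<bar>C2\<bar> * ip_norm K (T h1)"
        using h1 by (intro mult_right_mono) auto
      also have "ip_norm K (T h1) \<le> \<bar>C1\<bar> * ip_norm K v"
        using le1 norm_scale[of v "-1"] v mult_right_mono[of C1 "\<bar>C1\<bar>" "ip_norm K v"]
            abs_ge_self[of C1] by simp
      finally show ?thesis by (simp add: mult_left_mono mult.assoc)
    qed
    ultimately show ?thesis using opAI[OF g] by blast
  qed
  have inj: "x = 0" if x: "(x, z *\<^sub>C x) \<in> opA" for x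
  proof -
    obtain h where h: "h \<in> vecs K" "x = T (T h)" "z *\<^sub>C x = of_real k *\<^sub>C x - h"
      using opAE[OF x] by blast
    then have "h = \<sigma>\<^sup>2 *\<^sub>C x"
      by (simp add: z[symmetric] scaleC_simps)
    \<comment> \<open>First \<open>D x + \<sigma> x\<close> vanishes since \<open>\<sigma>\<close>
      is not in \<open>S\<close>; what remains says that \<open>D x\<close> solves the eigenvalue
      equation for \<open>- \<sigma>\<close>, so it vanishes too.\<close>
    then have "T h + \<sigma> *\<^sub>C x = \<sigma> *\<^sub>C T (T h + \<sigma> *\<^sub>C x)"
      by (intro eigenvector_factor h(1,2))
    then have "T h + \<sigma> *\<^sub>C x = 0"
      using h resolvent_inj[OF S(1)] by simp
    then have "T h = (- \<sigma>) *\<^sub>C T (T h)"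
      using h(2) by (simp add: eq_neg_iff_add_eq_0)
    then have "T h = 0"
      using h resolvent_inj[OF S(2), of "T h"] by simp
    then show "x = 0" using h by simp
  qed
  have diff: "(x - x', (y - y')) \<in> opA" if xy: "(x, y) \<in> opA" "(x', y') \<in> opA" for x x' y y'
  proof -
    obtain h h' where *: "h \<in> vecs K" "x = T (T h)" "y = of_real k *\<^sub>C x - h"
       "h' \<in> vecs K" "x' = T (T h')" "y' = of_real k *\<^sub>C x' - h'"
      using opAE[OF xy(1)] opAE[OF xy(2)] by metis
    then show ?thesis
      using opAI[of "h - h'"] unfolding *(2,3,5,6) by (simp add: T_linear scaleC_simps algebra_simps)
  qed
  have uniq: "x = x'" if "(x, y) \<in> opA" "(x', y') \<in> opA" "y - z *\<^sub>C x = y' - z *\<^sub>C x'" for x x' y y'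
  proof -
    have "y - y' = z *\<^sub>C (x - x')"
      using that(3) by (simp add: scaleC_simps algebra_simps)
    then show ?thesis using inj[of "x - x'"] diff[OF that(1,2)] by simp
  qed
  have "\<exists>!x. \<exists>y. (x, y) \<in> opA \<and> y - z *\<^sub>C x = v" if "v \<in> vecs K" for v
    using ex[OF that] uniq by metis
  moreover have "\<forall>(x, y)\<in>opA. ip_norm K x \<le> (\<bar>C2\<bar> * \<bar>C1\<bar>) * ip_norm K (y - z *\<^sub>C x)"
  proof clarify
    fix x y assume xy: "(x, y) \<in> opA"
    then have "y - z *\<^sub>C x \<in> vecs K" using opA_vecs by auto
    then show "ip_norm K x \<le> (\<bar>C2\<bar> * \<bar>C1\<bar>) * ip_norm K (y - z *\<^sub>C x)"
      using ex uniq[OF xy] by metis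
  qed
  ultimately show ?thesis
    unfolding resolvent_set_def by blast
qed

lemma opA_eigenvector:
  assumes "\<tau> \<in> S"
  shows "\<exists>x\<in>eigenspace opA (of_real k - \<tau>\<^sup>2). x \<noteq> 0"
proof -
  obtain u where u: "u \<in> vecs K" "u \<noteq> 0" "T (\<tau> *\<^sub>C u) = u"
    using eigenvector[OF assms] by metis
  then have "T (T (\<tau> *\<^sub>C \<tau> *\<^sub>C u)) = u"
    by (metis T_scale vecs_closed(5))
  then have "u \<in> eigenspace opA (of_real k - \<tau>\<^sup>2)"
    using opAI[of "\<tau> *\<^sub>C \<tau> *\<^sub>C u"] u
    by (simp add: eigenspace_def scaleC_simps scaleC_scaleC power2_eq_square)
  then show ?thesis using u by blast
qed

text \<open>An eigenvector satisfies \<open>(u, u) = \<sigma> (T u, u)\<close>, and skew symmetry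
  makes \<open>(T u, u)\<close> purely imaginary.\<close>

lemma not_in_S_if_Im_0: "Im \<sigma> = 0 \<Longrightarrow> \<sigma> \<notin> S"
proof
  assume \<sigma>: "Im \<sigma> = 0" "\<sigma> \<in> S"
  obtain u where u: "u \<in> vecs K" "u \<noteq> 0" "T (\<sigma> *\<^sub>C u) = u"
    using eigenvector[OF \<sigma>(2)] by metis
  then have "ip K u u = \<sigma> * ip K (T u) u"
    by (metis T_scale T_in ip_scale_left)
  then have "Re (ip K u u) = 0"
    using Re_ip_T_self[OF u(1)] \<sigma> by simp
  then show False using ip_self_pos u by force
qed

theorem spectrum_opA: "spectrum K opA = (\<lambda>\<tau>. of_real k - \<tau>\<^sup>2) ` S"
proof
  show "spectrum K opA \<subseteq> (\<lambda>\<tau>. of_real k - \<tau>\<^sup>2) ` S"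
  proof
    fix z assume z: "z \<in> spectrum K opA"
    \<comment> \<open>Either square root will do: if neither \<open>\<sigma>\<close> nor
      \<open>- \<sigma>\<close> were in \<open>S\<close>, then \<open>z\<close> would be in the
      resolvent set.\<close>
    define \<sigma> where "\<sigma> = csqrt (of_real k - z)"
    have eq: "of_real k - \<sigma>\<^sup>2 = z" by (simp add: \<sigma>_def)
    then have "\<sigma> \<in> S \<or> - \<sigma> \<in> S"
      using opA_resolvent z unfolding spectrum_def by blast
    then show "z \<in> (\<lambda>\<tau>. of_real k - \<tau>\<^sup>2) ` S"
      using eq power2_minus[of \<sigma>] by (metis imageI)
  qed
  show "(\<lambda>\<tau>. of_real k - \<tau>\<^sup>2) ` S \<subseteq> spectrum K opA"
  proof (clarify)
    fix \<tau> assume \<tau>: "\<tau> \<in> S"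
    let ?z = "of_real k - \<tau>\<^sup>2"
    obtain x where "(x, ?z *\<^sub>C x) \<in> opA" "x \<noteq> 0"
      using opA_eigenvector[OF \<tau>] unfolding eigenspace_def by blast
    moreover have "(0, 0) \<in> opA" "0 - ?z *\<^sub>C 0 = 0" "?z *\<^sub>C x - ?z *\<^sub>C x = 0"
      using opAI[of 0] by simp_all
    \<comment> \<open>Both 0 and the eigenvector solve the homogeneous equation, which violates
      uniqueness in the definition of the resolvent set.\<close>
    ultimately have "\<not> (\<exists>!x. \<exists>y. (x, y) \<in> opA \<and> y - ?z *\<^sub>C x = 0)"
      by blast
    then show "?z \<in> spectrum K opA"
      unfolding spectrum_def resolvent_set_def by blast
  qed
qed

text \<open>Every eigenvector is \<open>x = (p - q) / (2 \<sigma>)\<close>, where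
  \<open>p = D x + \<sigma> x\<close> and \<open>q = D x - \<sigma> x\<close> lie in the
  finite-dimensional eigenspaces of \<open>D\<close> for \<open>\<sigma>\<close> and
  \<open>- \<sigma>\<close>. The division requires \<open>z\<close> to differ from
  \<open>k\<close>.\<close>

lemma eigenspace_opA_finite: "\<exists>B. finite B \<and> eigenspace opA z \<subseteq> complex_vector.span B"
  if "z \<noteq> of_real k"
proof -
  define \<sigma> where "\<sigma> = csqrt (of_real k - z)"
  have \<sigma>: "of_real k - \<sigma>\<^sup>2 = z" "\<sigma> \<noteq> 0" using that by (auto simp: \<sigma>_def)
  obtain B1 where B1: "finite B1" "{u \<in> vecs K. u = T (\<sigma> *\<^sub>C u)} \<subseteq> complex_vector.span B1"
    using eigenspace_finite by blast
  obtain B2 where B2: "finite B2" "{u \<in> vecs K. u = T ((- \<sigma>) *\<^sub>C u)} \<subseteq> complex_vector.span B2"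
    using eigenspace_finite by blast
  have "x \<in> complex_vector.span (B1 \<union> B2)" if x: "x \<in> eigenspace opA z" for x
  proof -
    obtain h where h: "h \<in> vecs K" "x = T (T h)" "z *\<^sub>C x = of_real k *\<^sub>C x - h"
      using x by (auto simp: eigenspace_def elim: opAE)
    then have h_eq: "h = \<sigma>\<^sup>2 *\<^sub>C x"
      by (simp add: \<sigma>(1)[symmetric] scaleC_simps)
    have xK: "x \<in> vecs K" using h(1,2) by simp
    define p q where "p = T h + \<sigma> *\<^sub>C x" and "q = T h + (- \<sigma>) *\<^sub>C x"
    have "\<sigma> *\<^sub>C T p = p" "(- \<sigma>) *\<^sub>C T q = q"
      unfolding p_def q_def by (intro eigenvector_factor[symmetric] h(1,2); simp add: h_eq)+
    moreover have K: "p \<in> vecs K" "q \<in> vecs K" using h(1) xK by (simp_all add: p_def q_def)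
    ultimately have "p \<in> complex_vector.span (B1 \<union> B2)" "q \<in> complex_vector.span (B1 \<union> B2)"
      using B1(2) B2(2) complex_vector.span_mono[of B1 "B1 \<union> B2"] complex_vector.span_mono[of B2 "B1 \<union> B2"]
        T_scale[OF K(1), of \<sigma>] T_scale[OF K(2), of "- \<sigma>"]
      by (metis (mono_tags, lifting) mem_Collect_eq subsetD Un_upper1 Un_upper2)+
    then have span: "(1 / (2 * \<sigma>)) *\<^sub>C (p - q) \<in> complex_vector.span (B1 \<union> B2)"
      by (intro complex_vector.span_scale complex_vector.span_diff)
    have "p - q = (2 * \<sigma>) *\<^sub>C x"
      unfolding mult_2 scaleC_add_left by (simp add: p_def q_def)
    then show ?thesis
      using span \<sigma>(2) by (simp add: scaleC_scaleC scaleC_one)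
  qed
  then show ?thesis using B1 B2 by (intro exI[of _ "B1 \<union> B2"]) auto
qed

text \<open>The excluded value \<open>z = k\<close> would need 0 in \<open>S\<close>, which skew
  symmetry forbids.\<close>

theorem purely_discrete_opA:
  assumes "\<And>z. z \<in> (\<lambda>\<tau>. of_real k - \<tau>\<^sup>2) ` S \<Longrightarrow> z isolated_in (\<lambda>\<tau>. of_real k - \<tau>\<^sup>2) ` S"
  shows "purely_discrete_point_spectrum K opA"
  unfolding purely_discrete_point_spectrum_def spectrum_opA
proof (intro ballI conjI assms)
  fix z assume z: "z \<in> (\<lambda>\<tau>. of_real k - \<tau>\<^sup>2) ` S"
  then show "\<exists>x\<in>eigenspace opA z. x \<noteq> 0" using opA_eigenvector by blast
  show "\<exists>B. finite B \<and> eigenspace opA z \<subseteq> complex_vector.span B"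
    using z not_in_S_if_Im_0[of 0] by (intro eigenspace_opA_finite) auto
qed

text \<open>The value 0 corresponds to the real roots \<open>\<sigma>\<close> = plus or minus
  \<open>sqrt k\<close>, neither of which lies in \<open>S\<close>.\<close>

lemma opA_onto: "v \<in> vecs K \<Longrightarrow> \<exists>x. (x, v) \<in> opA"
proof -
  assume v: "v \<in> vecs K"
  have "0 \<in> resolvent_set K opA"
    by (rule opA_resolvent[of "of_real (sqrt k)"])
      (use k_pos in \<open>auto simp: of_real_power[symmetric] simp del: of_real_power intro!: not_in_S_if_Im_0\<close>)
  then show ?thesis
    using v unfolding resolvent_set_def by fastforce
qed

theorem self_adjoint_opA: "self_adjoint K opA"
proof (rule self_adjointI[OF hilbert])
  show "linear_operator K opA"
    unfolding linear_operator_def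
  proof (intro conjI allI impI)
    show "opA \<subseteq> vecs K \<times> vecs K" using opA_vecs by auto
    show "single_valued opA"
    proof (rule single_valuedI)
      fix x y y' assume "(x, y) \<in> opA" "(x, y') \<in> opA"
      then obtain h h' where *: "h \<in> vecs K" "x = T (T h)" "y = of_real k *\<^sub>C x - h"
         "h' \<in> vecs K" "x = T (T h')" "y' = of_real k *\<^sub>C x - h'"
        by (elim opAE) blast
      then have "h = h'" by (metis D_T T_in)
      then show "y = y'" using * by simp
    qed
    show "(0, 0) \<in> opA" using opAI[of 0] by simp
  next
    fix x y x' y' assume "(x, y) \<in> opA" "(x', y') \<in> opA"
    then obtain h h' where *: "h \<in> vecs K" "x = T (T h)" "y = of_real k *\<^sub>C x - h"
       "h' \<in> vecs K" "x' = T (T h')" "y' = of_real k *\<^sub>C x' - h'"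
      by (elim opAE) blast
    then show "(x + x', y + y') \<in> opA"
      using opAI[of "h + h'"] unfolding *(2,3,5,6) by (simp add: T_linear scaleC_simps algebra_simps)
  next
    fix c x y assume "(x, y) \<in> opA"
    then obtain h where *: "h \<in> vecs K" "x = T (T h)" "y = of_real k *\<^sub>C x - h"
      by (elim opAE) blast
    then show "(c *\<^sub>C x, c *\<^sub>C y) \<in> opA"
      using opAI[of "c *\<^sub>C h"] by (simp add: T_linear scaleC_simps scaleC_scaleC mult.commute)
  qed
  show "ip K w y = ip K x z" if "(x, w) \<in> opA" "(y, z) \<in> opA" for x w y z
  proof -
    obtain f g where *: "f \<in> vecs K" "x = T (T f)" "w = of_real k *\<^sub>C x - f"
       "g \<in> vecs K" "y = T (T g)" "z = of_real k *\<^sub>C y - g"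
      using opAE[OF \<open>(x, w) \<in> opA\<close>] opAE[OF \<open>(y, z) \<in> opA\<close>] by metis
    then show ?thesis
      using T_skew[of f "T g"] T_skew[of "T f" g] by (simp add: ip_simps)
  qed
qed (rule opA_onto)

text \<open>Skew symmetry gives \<open>(A x, x) = k (x, x) + (D x, D x)\<close>.\<close>

lemma bounded_below_opA: "bounded_below_by K opA k"
  unfolding bounded_below_by_def
proof clarify
  fix x y assume "(x, y) \<in> opA"
  then obtain h where *: "h \<in> vecs K" "x = T (T h)" "y = of_real k *\<^sub>C x - h"
    by (elim opAE) blast
  then have "ip K y x = of_real k * ip K x x + ip K (T h) (T h)"
    using T_skew[of h "T h"] by (simp add: ip_simps)
  then show "k * Re (ip K x x) \<le> Re (ip K y x)"
    using ip_self_nonneg[of "T h"] * by simp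
qed

end

section \<open>Iterated spaces and powers of the operator\<close>

context skew_inverse
begin

primrec sobolev :: "nat \<Rightarrow> 'v ipspace" where
  "sobolev 0 = K"
| "sobolev (Suc n) = skew_inverse.step (sobolev n) T D k"

lemma sobolev_skew_inverse: "skew_inverse (sobolev n) T D k S"
  by (induction n) (simp_all add: skew_inverse_axioms skew_inverse.step_skew_inverse)

lemma vecs_sobolev_Suc: "vecs (sobolev (Suc n)) = T ` vecs (sobolev n)"
  by (simp add: skew_inverse.vecs_step[OF sobolev_skew_inverse])

lemma ip_sobolev_Suc:
  "ip (sobolev (Suc n)) x y = of_real k * ip (sobolev n) x y + ip (sobolev n) (D x) (D y)"
  by (simp add: skew_inverse.ip_step[OF sobolev_skew_inverse])

declare sobolev.simps(2) [simp del]

lemma sobolev_Suc_subset: "vecs (sobolev (Suc n)) \<subseteq> vecs (sobolev n)"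
  using skew_inverse.T_in[OF sobolev_skew_inverse] by (auto simp: vecs_sobolev_Suc)

lemma sobolev_antimono: "m \<le> n \<Longrightarrow> vecs (sobolev n) \<subseteq> vecs (sobolev m)"
  using sobolev_Suc_subset by (rule lift_Suc_antimono_le)

lemma sobolev_subset: "vecs (sobolev n) \<subseteq> vecs K"
  using sobolev_antimono[of 0 n] by simp

lemma sobolev_inner_product: "inner_product (sobolev n)"
  using skew_inverse.hilbert[OF sobolev_skew_inverse] by (rule inner_productI)

lemma sobolev_closed:
  "x \<in> vecs (sobolev n) \<Longrightarrow> y \<in> vecs (sobolev n) \<Longrightarrow> x - y \<in> vecs (sobolev n)"
  "x \<in> vecs (sobolev n) \<Longrightarrow> c *\<^sub>C x \<in> vecs (sobolev n)"
  using inner_product.vecs_closed[OF sobolev_inner_product] by auto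

lemma T_T_in_sobolev: "h \<in> vecs (sobolev n) \<Longrightarrow> T (T h) \<in> vecs (sobolev (n + 2))"
  by (simp add: vecs_sobolev_Suc)

text \<open>Elliptic regularity, by bootstrapping \<open>h = k T (T h) - v\<close>.\<close>

lemma opA_regular:
  assumes h: "h \<in> vecs K" and v: "of_real k *\<^sub>C T (T h) - h \<in> vecs (sobolev m)"
  shows "h \<in> vecs (sobolev m)"
  using v
proof (induction m)
  case 0
  then show ?case using h by simp
next
  case (Suc m)
  let ?v = "of_real k *\<^sub>C T (T h) - h"
  have "h \<in> vecs (sobolev m)"
    using Suc sobolev_Suc_subset by blast
  then have TT: "T (T h) \<in> vecs (sobolev (Suc m))"
    using T_T_in_sobolev[of h m] sobolev_antimono[of "Suc m" "m + 2"] by auto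
  show ?case
    using sobolev_closed(1)[OF sobolev_closed(2)[OF TT, of "of_real k"] Suc.prems] by simp
qed

lemma opA_regularE:
  assumes xy: "(x, y) \<in> opA" and y: "y \<in> vecs (sobolev m)"
  obtains h where "h \<in> vecs (sobolev m)" "x = T (T h)" "y = of_real k *\<^sub>C x - h"
proof -
  obtain h where h: "h \<in> vecs K" "x = T (T h)" "y = of_real k *\<^sub>C x - h"
    using opAE[OF xy] by blast
  have "h \<in> vecs (sobolev m)"
    by (rule opA_regular[OF h(1)]) (use y h(2,3) in simp)
  then show thesis using that h by blast
qed

lemma relpow_opA_regular:
  assumes "(x, w) \<in> opA ^^ n" "w \<in> vecs (sobolev m)"
  shows "x \<in> vecs (sobolev (m + 2 * n))"
  using assms
proof (induction n arbitrary: x)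
  case (Suc n)
  obtain v where v: "(x, v) \<in> opA" "(v, w) \<in> opA ^^ n"
    using relpow_Suc_D2[OF Suc.prems(1)] by blast
  obtain h where "h \<in> vecs (sobolev (m + 2 * n))" "x = T (T h)"
    using opA_regularE[OF v(1) Suc.IH[OF v(2) Suc.prems(2)]] by blast
  then show ?case using T_T_in_sobolev[of h "m + 2 * n"] by simp
qed auto

text \<open>The premise on \<open>x\<close> covers the power zero, which is the identity relation on
  the whole type.\<close>

lemma relpow_opA_vecs: "\<lbrakk>(x, w) \<in> opA ^^ n; x \<in> vecs K\<rbrakk> \<Longrightarrow> w \<in> vecs K"
  by (induction n arbitrary: w) (auto dest: opA_vecs)

lemma relpow_opA_onto: "w \<in> vecs K \<Longrightarrow> \<exists>x. (x, w) \<in> opA ^^ n"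
proof (induction n)
  case (Suc n)
  then obtain v where v: "(v, w) \<in> opA ^^ n" by blast
  then have "v \<in> vecs K"
    using relpow_opA_regular[of v w n 0] Suc.prems sobolev_subset by auto
  then show ?case using v opA_onto relpow_Suc_I2 by metis
qed auto

text \<open>One inclusion is regularity, gaining two levels per factor. For the other,
  \<open>of_real k *\<^sub>C T (T h) - h\<close> is only as regular as \<open>h\<close>, exactly
  what the next factor requires.\<close>

lemma Domain_relpow_opA:
  assumes "0 < n"
  shows "Domain (opA ^^ n) = vecs (sobolev (2 * n))"
proof
  show "Domain (opA ^^ n) \<subseteq> vecs (sobolev (2 * n))"
  proof clarify
    fix x w assume xw: "(x, w) \<in> opA ^^ n"
    \<comment> \<open>A positive power has a first factor, which is what places \<open>x\<close> in
      \<open>K\<close>.\<close>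
    obtain v where "(x, v) \<in> opA"
      using relpow_E2[OF xw] assms by (metis less_numeral_extra(3))
    then have "w \<in> vecs K" using relpow_opA_vecs[OF xw] opA_vecs by blast
    then show "x \<in> vecs (sobolev (2 * n))"
      using relpow_opA_regular[OF xw, of 0] by simp
  qed
  have "x \<in> Domain (opA ^^ n)" if "x \<in> vecs (sobolev (2 * n))" for x n
    using that
  proof (induction n arbitrary: x)
    case (Suc n)
    then obtain h where h: "h \<in> vecs (sobolev (2 * n))" "x = T (T h)"
      by (auto simp: vecs_sobolev_Suc)
    have TT: "T (T h) \<in> vecs (sobolev (2 * n))"
      using T_T_in_sobolev[OF h(1)] sobolev_antimono[of "2 * n" "2 * n + 2"] by auto
    have "of_real k *\<^sub>C T (T h) - h \<in> Domain (opA ^^ n)"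
      by (intro Suc.IH sobolev_closed TT h(1))
    then obtain w where "(of_real k *\<^sub>C T (T h) - h, w) \<in> opA ^^ n"
      by blast
    with opAI[OF subsetD[OF sobolev_subset h(1)]] have "(T (T h), w) \<in> opA ^^ Suc n"
      by (rule relpow_Suc_I2)
    then show ?case unfolding h(2) by (rule DomainI)
  qed auto
  then show "vecs (sobolev (2 * n)) \<subseteq> Domain (opA ^^ n)" by blast
qed

text \<open>Each level trades one factor of \<open>A\<close> for one derivative on each side:
  \<open>k (x, y) + (D x, D y) = (A x, y)\<close> by skew symmetry, in the inner product one level
  down.\<close>

lemma ip_sobolev_relpow:
  assumes "(x, w) \<in> opA ^^ n" "w \<in> vecs K" "y \<in> vecs (sobolev n)"
  shows "ip (sobolev n) x y = ip K w y"
  using assms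
proof (induction n arbitrary: x y)
  case (Suc n)
  obtain v where v: "(x, v) \<in> opA" "(v, w) \<in> opA ^^ n"
    using relpow_Suc_D2[OF Suc.prems(1)] by blast
  \<comment> \<open>The intermediate vector must be regular enough for its \<open>h\<close> to lie
    in \<open>sobolev n\<close>, where skew symmetry is then applied.\<close>
  have "v \<in> vecs (sobolev (2 * n))"
    using relpow_opA_regular[OF v(2), of 0] Suc.prems(2) by simp
  then have "v \<in> vecs (sobolev n)"
    using sobolev_antimono[of n "2 * n"] by auto
  then obtain h where h: "h \<in> vecs (sobolev n)" "x = T (T h)" "v = of_real k *\<^sub>C x - h"
    using opA_regularE[OF v(1)] by blast
  obtain g where g: "g \<in> vecs (sobolev n)" "y = T g"
    using Suc.prems(3) by (auto simp: vecs_sobolev_Suc)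
  interpret n: skew_inverse "sobolev n" T D k S by (rule sobolev_skew_inverse)
  have "ip (sobolev (Suc n)) x y = of_real k * ip (sobolev n) x y + ip (sobolev n) (T h) g"
    using g h by (simp add: ip_sobolev_Suc)
  also have "\<dots> = ip (sobolev n) v y"
    using g h n.T_skew[of h g] by (simp add: n.ip_simps)
  also have "\<dots> = ip K w y"
    using Suc.IH[OF v(2) Suc.prems(2)] g by auto
  finally show ?case .
qed auto

lemma sobolev_lower_bound:
  "x \<in> vecs (sobolev n) \<Longrightarrow> k ^ n * Re (ip K x x) \<le> Re (ip (sobolev n) x x)"
proof (induction n)
  case (Suc n)
  interpret n: skew_inverse "sobolev n" T D k S by (rule sobolev_skew_inverse)
  obtain g where g: "g \<in> vecs (sobolev n)" "x = T g"
    using Suc.prems by (auto simp: vecs_sobolev_Suc)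
  then have "k ^ n * Re (ip K x x) \<le> Re (ip (sobolev n) x x)" "0 \<le> Re (ip (sobolev n) g g)"
    using Suc.IH n.ip_self_nonneg by auto
  then show ?case
    using g k_pos mult_left_mono[of "k ^ n * Re (ip K x x)" "Re (ip (sobolev n) x x)" k]
    by (simp add: ip_sobolev_Suc mult.assoc add_increasing2)
qed simp

text \<open>Density follows from surjectivity of \<open>A ^^ n\<close>: a vector \<open>y\<close>
  orthogonal to the domain is orthogonal to a preimage \<open>x\<close> of \<open>y\<close>, and
  \<open>(x, y)\<close> at level \<open>n\<close> equals \<open>(y, y)\<close> in
  \<open>K\<close>.\<close>

theorem left_definite_sobolev:
  assumes n: "0 < n"
  shows "left_definite_space K opA k n (sobolev n)"
proof -
  interpret n: skew_inverse "sobolev n" T D k S by (rule sobolev_skew_inverse)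
  note dom = Domain_relpow_opA[OF n]
  have sub: "complex_vector.subspace (Domain (opA ^^ n))"
    unfolding dom by (rule inner_product.subspace_vecs[OF sobolev_inner_product])
  have le: "Domain (opA ^^ n) \<subseteq> vecs (sobolev n)"
    unfolding dom by (rule sobolev_antimono) simp
  have vecs: "w \<in> vecs K" if "(x, w) \<in> opA ^^ n" for x w
    using that le sobolev_subset relpow_opA_vecs by blast
  have "dense_in (sobolev n) (Domain (opA ^^ n))"
  proof (rule dense_in_if_orthogonal_trivial[OF n.hilbert sub le])
    fix y assume y: "y \<in> vecs (sobolev n)"
      and orth: "\<And>d. d \<in> Domain (opA ^^ n) \<Longrightarrow> ip (sobolev n) d y = 0"
    have yK: "y \<in> vecs K" using y sobolev_subset by blast
    obtain x where x: "(x, y) \<in> opA ^^ n"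
      using relpow_opA_onto[OF yK] by blast
    then have "ip K y y = 0"
      using ip_sobolev_relpow[OF x yK y] orth[OF DomainI[OF x]] by simp
    then show "y = 0" using yK ip_self_eq_0 by blast
  qed
  moreover have "ip (sobolev n) x y = ip K w y"
    if "(x, w) \<in> opA ^^ n" "y \<in> vecs (sobolev n)" for x w y
    using ip_sobolev_relpow[OF that(1) vecs[OF that(1)] that(2)] .
  ultimately show ?thesis
    unfolding left_definite_space_def
    by (intro conjI ballI hilbert self_adjoint_opA k_pos bounded_below_opA n n.subspace_vecs
        sobolev_subset n.hilbert sub le sobolev_lower_bound) auto
qed

section \<open>Arbitrary left-definite spaces and their operators\<close>

context
  fixes n :: nat and L :: "'v ipspace"
  assumes n: "0 < n" and L: "left_definite_space K opA k n L"
begin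

lemma left_definite_vecs: "vecs L = vecs (sobolev n)"
  by (rule left_definite_space_unique(1)[OF L left_definite_sobolev[OF n]])

lemma left_definite_skew_inverse: "skew_inverse L T D k S"
proof (rule skew_inverse_cong[OF sobolev_skew_inverse left_definite_vecs])
  show "ip L x y = ip (sobolev n) x y"
    if "x \<in> vecs (sobolev n)" "y \<in> vecs (sobolev n)" for x y
    using that left_definite_space_unique(2)[OF L left_definite_sobolev[OF n], of x y]
    by (simp add: left_definite_vecs)
qed

text \<open>A self-adjoint restriction of \<open>A\<close> takes values in \<open>L\<close>, so
  regularity puts its graph inside the operator built from \<open>T\<close> on \<open>L\<close>; two
  self-adjoint operators, one inside the other, coincide.\<close>

theorem left_definite_operator_iff:
  "left_definite_operator K opA k n L B \<longleftrightarrow> B = skew_inverse.opA L T k"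
proof -
  interpret L: skew_inverse L T D k S by (rule left_definite_skew_inverse)
  have LK: "vecs L \<subseteq> vecs K"
    using sobolev_subset left_definite_vecs by simp
  have "B \<subseteq> L.opA" if sa: "self_adjoint L B" and BA: "B \<subseteq> opA"
  proof (rule subrelI)
    fix x y assume xy: "(x, y) \<in> B"
    then have "(x, y) \<in> opA" and y: "y \<in> vecs L"
      using BA sa by (auto simp: self_adjoint_def linear_operator_def)
    then obtain h where "h \<in> vecs L" "x = T (T h)" "y = of_real k *\<^sub>C x - h"
      using opA_regularE left_definite_vecs by metis
    then show "(x, y) \<in> L.opA" using L.opAI by simp
  qed
  moreover have "L.opA \<subseteq> opA"
    using LK by (auto simp: L.opA_def opA_def)
  ultimately show ?thesis
    unfolding left_definite_operator_def
    using L L.self_adjoint_opA self_adjoint_maximal by blast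
qed

end

end

section \<open>Absolutely continuous functions\<close>

lemma absolutely_continuous_funD:
  assumes "absolutely_continuous_fun a b f" "e > 0"
  obtains d where "d > 0"
    "\<And>I. \<lbrakk>finite I; \<And>u v. (u, v) \<in> I \<Longrightarrow> a \<le> u \<and> u \<le> v \<and> v \<le> b;
      disjoint_family_on (\<lambda>(u, v). {u<..<v}) I; (\<Sum>(u, v)\<in>I. v - u) < d\<rbrakk>
      \<Longrightarrow> (\<Sum>(u, v)\<in>I. norm (f v - f u)) < e"
proof -
  obtain d where d: "d > 0" and *: "\<forall>I :: (real \<times> real) set.
        finite I \<and> (\<forall>(u, v)\<in>I. a \<le> u \<and> u \<le> v \<and> v \<le> b) \<and>
        disjoint_family_on (\<lambda>(u, v). {u<..<v}) I \<and> (\<Sum>(u, v)\<in>I. v - u) < d \<longrightarrow>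
        (\<Sum>(u, v)\<in>I. norm (f v - f u)) < e"
    using assms unfolding absolutely_continuous_fun_def by blast
  show thesis
    by (rule that[OF d], rule *[rule_format]) (auto simp: case_prod_beta)
qed

lemma absolutely_continuous_funI:
  assumes "\<And>e. e > 0 \<Longrightarrow> \<exists>d>0. \<forall>I. finite I \<longrightarrow> (\<forall>(u, v)\<in>I. a \<le> u \<and> u \<le> v \<and> v \<le> b) \<longrightarrow>
        disjoint_family_on (\<lambda>(u, v). {u<..<v}) I \<longrightarrow> (\<Sum>(u, v)\<in>I. v - u) < d \<longrightarrow>
        (\<Sum>(u, v)\<in>I. norm (f v - f u)) < e"
  shows "absolutely_continuous_fun a b f"
  using assms unfolding absolutely_continuous_fun_def by meson

lemma absolutely_continuous_fun_cong:
  assumes "absolutely_continuous_fun a b f" "\<And>x. x \<in> {a..b} \<Longrightarrow> f x = g x"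
  shows "absolutely_continuous_fun a b g"
proof (rule absolutely_continuous_funI)
  fix e :: real assume "e > 0"
  then obtain d where d: "d > 0" and *: "\<And>I. \<lbrakk>finite I;
      \<And>u v. (u, v) \<in> I \<Longrightarrow> a \<le> u \<and> u \<le> v \<and> v \<le> b;
      disjoint_family_on (\<lambda>(u, v). {u<..<v}) I; (\<Sum>(u, v)\<in>I. v - u) < d\<rbrakk>
      \<Longrightarrow> (\<Sum>(u, v)\<in>I. norm (f v - f u)) < e"
    using absolutely_continuous_funD[OF assms(1)] by blast
  have "(\<Sum>(u, v)\<in>I. norm (g v - g u)) < e"
    if "finite I" "\<forall>(u, v)\<in>I. a \<le> u \<and> u \<le> v \<and> v \<le> b"
      "disjoint_family_on (\<lambda>(u, v). {u<..<v}) I" "(\<Sum>(u, v)\<in>I. v - u) < d" for I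
  proof -
    have "(\<Sum>(u, v)\<in>I. norm (g v - g u)) = (\<Sum>(u, v)\<in>I. norm (f v - f u))"
      using that(2) assms(2) by (intro sum.cong) fastforce+
    then show ?thesis using *[of I] that by fastforce
  qed
  then show "\<exists>d>0. \<forall>I. finite I \<longrightarrow> (\<forall>(u, v)\<in>I. a \<le> u \<and> u \<le> v \<and> v \<le> b) \<longrightarrow>
        disjoint_family_on (\<lambda>(u, v). {u<..<v}) I \<longrightarrow> (\<Sum>(u, v)\<in>I. v - u) < d \<longrightarrow>
        (\<Sum>(u, v)\<in>I. norm (g v - g u)) < e"
    using d by blast
qed

lemma absolutely_continuous_fun_cnj:
  "absolutely_continuous_fun a b f \<Longrightarrow> absolutely_continuous_fun a b (\<lambda>x. cnj (f x))"
  unfolding absolutely_continuous_fun_def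
  by (simp add: complex_cnj_diff[symmetric] del: complex_cnj_diff)

lemma absolutely_continuous_fun_imp_continuous_on:
  assumes "absolutely_continuous_fun a b f"
  shows "continuous_on {a..b} f"
  unfolding continuous_on_iff
proof (intro ballI allI impI)
  fix x and e :: real assume x: "x \<in> {a..b}" and "e > 0"
  then obtain d where d: "d > 0" and *: "\<And>I. \<lbrakk>finite I;
      \<And>u v. (u, v) \<in> I \<Longrightarrow> a \<le> u \<and> u \<le> v \<and> v \<le> b;
      disjoint_family_on (\<lambda>(u, v). {u<..<v}) I; (\<Sum>(u, v)\<in>I. v - u) < d\<rbrakk>
      \<Longrightarrow> (\<Sum>(u, v)\<in>I. norm (f v - f u)) < e"
    using absolutely_continuous_funD[OF assms] by blast
  have "dist (f y) (f x) < e" if y: "y \<in> {a..b}" "dist y x < d" for y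
  proof (cases "x \<le> y")
    case True
    then show ?thesis
      using *[of "{(x, y)}"] x y by (auto simp: disjoint_family_on_def dist_norm)
  next
    case False
    then show ?thesis
      using *[of "{(y, x)}"] x y by (auto simp: disjoint_family_on_def dist_norm norm_minus_commute)
  qed
  then show "\<exists>d>0. \<forall>y\<in>{a..b}. dist y x < d \<longrightarrow> dist (f y) (f x) < e"
    using d by blast
qed

text \<open>Both factors are bounded, being continuous on a compact interval, so an increment of the
  product is controlled by the two separate increments. The summand 1 in \<open>M\<close> keeps the
  division by \<open>2 * M\<close> legitimate.\<close>

lemma absolutely_continuous_fun_mult:
  assumes f: "absolutely_continuous_fun a b f" and g: "absolutely_continuous_fun a b g"
  shows "absolutely_continuous_fun a b (\<lambda>x. f x * g x)"
proof (rule absolutely_continuous_funI)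
  fix e :: real assume e: "e > 0"
  have "bounded (f ` {a..b})" "bounded (g ` {a..b})"
    using f g by (auto intro!: compact_imp_bounded compact_continuous_image
        absolutely_continuous_fun_imp_continuous_on)
  then obtain M1 M2 where M1: "\<And>x. x \<in> {a..b} \<Longrightarrow> norm (f x) \<le> M1"
    and M2: "\<And>x. x \<in> {a..b} \<Longrightarrow> norm (g x) \<le> M2"
    unfolding bounded_iff by blast
  define M where "M = 1 + \<bar>M1\<bar> + \<bar>M2\<bar>"
  have M: "M > 0" and fM: "\<And>x. x \<in> {a..b} \<Longrightarrow> norm (f x) \<le> M"
    and gM: "\<And>x. x \<in> {a..b} \<Longrightarrow> norm (g x) \<le> M"
    using M1 M2 unfolding M_def by fastforce+
  have eM: "e / (2 * M) > 0" using e M by simp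
  obtain d1 where d1: "d1 > 0" and *: "\<And>I. \<lbrakk>finite I;
      \<And>u v. (u, v) \<in> I \<Longrightarrow> a \<le> u \<and> u \<le> v \<and> v \<le> b;
      disjoint_family_on (\<lambda>(u, v). {u<..<v}) I; (\<Sum>(u, v)\<in>I. v - u) < d1\<rbrakk>
      \<Longrightarrow> (\<Sum>(u, v)\<in>I. norm (f v - f u)) < e / (2 * M)"
    using absolutely_continuous_funD[OF f eM] by blast
  obtain d2 where d2: "d2 > 0" and **: "\<And>I. \<lbrakk>finite I;
      \<And>u v. (u, v) \<in> I \<Longrightarrow> a \<le> u \<and> u \<le> v \<and> v \<le> b;
      disjoint_family_on (\<lambda>(u, v). {u<..<v}) I; (\<Sum>(u, v)\<in>I. v - u) < d2\<rbrakk>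
      \<Longrightarrow> (\<Sum>(u, v)\<in>I. norm (g v - g u)) < e / (2 * M)"
    using absolutely_continuous_funD[OF g eM] by blast
  have "(\<Sum>(u, v)\<in>I. norm (f v * g v - f u * g u)) < e"
    if I: "finite I" "\<forall>(u, v)\<in>I. a \<le> u \<and> u \<le> v \<and> v \<le> b"
      "disjoint_family_on (\<lambda>(u, v). {u<..<v}) I" "(\<Sum>(u, v)\<in>I. v - u) < min d1 d2" for I
  proof -
    have "(\<Sum>(u, v)\<in>I. norm (f v * g v - f u * g u))
        \<le> (\<Sum>(u, v)\<in>I. M * norm (f v - f u) + M * norm (g v - g u))"
    proof (intro sum_mono, clarify)
      fix u v assume "(u, v) \<in> I"
      then have uv: "u \<in> {a..b}" "v \<in> {a..b}" using I(2) by fastforce+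
      have "f v * g v - f u * g u = g v * (f v - f u) + f u * (g v - g u)"
        by (simp add: algebra_simps)
      then have "norm (f v * g v - f u * g u) \<le> norm (g v) * norm (f v - f u) + norm (f u) * norm (g v - g u)"
        by (metis norm_mult norm_triangle_ineq)
      also have "\<dots> \<le> M * norm (f v - f u) + M * norm (g v - g u)"
        using fM[OF uv(1)] gM[OF uv(2)] by (intro add_mono mult_right_mono) auto
      finally show "norm (f v * g v - f u * g u) \<le> M * norm (f v - f u) + M * norm (g v - g u)" .
    qed
    also have "\<dots> = M * (\<Sum>(u, v)\<in>I. norm (f v - f u)) + M * (\<Sum>(u, v)\<in>I. norm (g v - g u))"
      by (simp add: case_prod_beta sum.distrib sum_distrib_left)
    also have "\<dots> < M * (e / (2 * M)) + M * (e / (2 * M))"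
      using *[of I] **[of I] I M by (intro add_strict_mono mult_strict_left_mono) auto
    also have "\<dots> = e" using M by simp
    finally show ?thesis .
  qed
  then show "\<exists>d>0. \<forall>I. finite I \<longrightarrow> (\<forall>(u, v)\<in>I. a \<le> u \<and> u \<le> v \<and> v \<le> b) \<longrightarrow>
        disjoint_family_on (\<lambda>(u, v). {u<..<v}) I \<longrightarrow> (\<Sum>(u, v)\<in>I. v - u) < d \<longrightarrow>
        (\<Sum>(u, v)\<in>I. norm (f v * g v - f u * g u)) < e"
    using d1 d2 by (intro exI[of _ "min d1 d2"]) auto
qed

text \<open>
  The fundamental theorem of calculus for absolutely continuous functions, proved with the gauge
  integral: tags in the exceptional null set \<open>N\<close> are forced into intervals contained in a small
  open neighbourhood of \<open>N\<close>, over which absolute continuity makes the increments small.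
\<close>

theorem has_integral_derivative_absolutely_continuous:
  fixes f :: "real \<Rightarrow> complex"
  assumes ab: "a < b" and ac: "absolutely_continuous_fun a b f" and N: "negligible N"
    and deriv: "\<And>x. x \<in> {a..b} - N \<Longrightarrow> (f has_vector_derivative f' x) (at x within {a..b})"
  shows "(f' has_integral (f b - f a)) {a..b}"
proof (rule has_integral_spike[OF N, of _ _ "\<lambda>x. if x \<in> N then 0 else f' x"])
  \<comment> \<open>With the integrand zero on \<open>N\<close>, a tag in \<open>N\<close>
    contributes only the increment of \<open>f\<close> over its interval.\<close>
  let ?g = "\<lambda>x. if x \<in> N then 0 else f' x"
  show "(?g has_integral (f b - f a)) {a..b}"
    unfolding has_integral_factor_content box_real[symmetric]
  proof safe
    fix e :: real
    assume e: "e > 0"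
    have "\<forall>x. \<exists>d>0. x \<in> {a..b} - N \<longrightarrow>
         (\<forall>y\<in>{a..b}. norm (y-x) < d \<longrightarrow> norm (f y - f x - (y-x) *\<^sub>R f' x) \<le> e/2 * norm (y-x))"
      using deriv[unfolded has_vector_derivative_def has_derivative_within_alt] e
      by (meson half_gt_zero zero_less_one)
    then obtain d where d: "\<And>x. 0 < d x"
                   "\<And>x y. \<lbrakk>x \<in> {a..b} - N; y \<in> {a..b}; norm (y-x) < d x\<rbrakk>
                          \<Longrightarrow> norm (f y - f x - (y-x) *\<^sub>R f' x) \<le> e/2 * norm (y-x)"
      by metis
    \<comment> \<open>The permitted error is \<open>e\<close> times the length of the interval; tags
      inside \<open>N\<close> and tags outside receive half of it each.\<close>
    have "e/2 * (b - a) > 0" using e ab by simp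
    then obtain \<delta> where \<delta>: "\<delta> > 0" and AC: "\<And>I. \<lbrakk>finite I;
        \<And>u v. (u, v) \<in> I \<Longrightarrow> a \<le> u \<and> u \<le> v \<and> v \<le> b;
        disjoint_family_on (\<lambda>(u, v). {u<..<v}) I; (\<Sum>(u, v)\<in>I. v - u) < \<delta>\<rbrakk>
        \<Longrightarrow> (\<Sum>(u, v)\<in>I. norm (f v - f u)) < e/2 * (b - a)"
      using absolutely_continuous_funD[OF ac] by blast
    have N0: "N \<in> null_sets lebesgue" using N negligible_iff_null_sets by blast
    obtain U where U: "open U" "N \<subseteq> U" "U - N \<in> lmeasurable" "emeasure lebesgue (U - N) < ennreal \<delta>"
      using sets_lebesgue_outer_open[OF null_setsD2[OF N0] \<delta>] by blast
    have "U = (U - N) \<union> N" using U by blast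
    then have Um: "U \<in> lmeasurable"
      using U(3) negligible_imp_measurable[OF N] fmeasurable.Un by metis
    have "emeasure lebesgue U = emeasure lebesgue (U - N)"
      using emeasure_Un_null_set[OF fmeasurableD[OF U(3)] N0] \<open>U = (U - N) \<union> N\<close> by simp
    then have U\<delta>: "measure lebesgue U < \<delta>"
      using U(4) Um by (metis emeasure_eq_measure2 ennreal_less_iff measure_nonneg)
    define \<gamma> where "\<gamma> = (\<lambda>x. if x \<in> N then U else ball x (d x))"
    show "\<exists>\<gamma>. gauge \<gamma> \<and> (\<forall>p. p tagged_division_of (cbox a b) \<and> \<gamma> fine p \<longrightarrow>
      norm ((\<Sum>(x, k)\<in>p. measure lborel k *\<^sub>R ?g x) - (f b - f a)) \<le> e * measure lborel (cbox a b))"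
    proof (rule exI[of _ \<gamma>], safe)
      show "gauge \<gamma>"
        using U d(1) by (auto simp: \<gamma>_def gauge_def)
    next
      fix p
      assume ptag: "p tagged_division_of cbox a b" and finep: "\<gamma> fine p"
      have finp: "finite p" using ptag by blast
      have ba: "b - a = (\<Sum>(x,K)\<in>p. Sup K - Inf K)" "f b - f a = (\<Sum>(x,K)\<in>p. f(Sup K) - f(Inf K))"
        using additive_tagged_division_1[OF less_imp_le[OF ab] ptag[unfolded box_real], of "\<lambda>x. x"]
          additive_tagged_division_1[OF less_imp_le[OF ab] ptag[unfolded box_real], of f] by simp_all
      have pK: "\<exists>u v. K = {u..v} \<and> u \<le> x \<and> x \<le> v \<and> Inf K = u \<and> Sup K = v \<and> a \<le> u \<and> v \<le> b"
        if xK: "(x, K) \<in> p" for x K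
      proof -
        have "x \<in> K" "K \<subseteq> cbox a b" using ptag xK by blast+
        moreover obtain u v where "K = cbox u v" using ptag xK by blast
        ultimately show ?thesis by (intro exI[of _ u] exI[of _ v]) auto
      qed
      \<comment> \<open>Degenerate intervals are left out because several of them may share their
        end points, which would destroy injectivity of \<open>J\<close>; their increments vanish
        anyway.\<close>
      define q where "q = {(x, K) \<in> p. x \<in> N \<and> Inf K < Sup K}"
      have q: "q \<subseteq> p" "finite q" using finp by (auto simp: q_def intro: finite_subset)
      have disj: "{Inf K<..<Sup K} \<inter> {Inf K'<..<Sup K'} = {}"
        if "(x, K) \<in> p" "(x', K') \<in> p" "(x, K) \<noteq> (x', K')" for x K x' K'
      proof -
        have "interior K \<inter> interior K' = {}"
          using ptag that by (metis tagged_division_ofD(5))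
        moreover have "{Inf K<..<Sup K} = interior K" "{Inf K'<..<Sup K'} = interior K'"
          using pK[OF that(1)] pK[OF that(2)] interior_atLeastAtMost_real by metis+
        ultimately show ?thesis by simp
      qed
      define J where "J = (\<lambda>(x :: real, K). (Inf K, Sup K :: real))"
      have injJ: "inj_on J q"
      proof (rule inj_onI)
        fix s t assume st: "s \<in> q" "t \<in> q" "J s = J t"
        obtain x K x' K' where s: "s = (x, K)" and t: "t = (x', K')" by fastforce
        have "{Inf K<..<Sup K} \<inter> {Inf K'<..<Sup K'} \<noteq> {}"
          using st s t by (auto simp: q_def J_def intro: dense)
        then show "s = t" using disj[of x K x' K'] st s t q(1) by blast
      qed
      have disjJ: "disjoint_family_on (\<lambda>(u, v). {u<..<v}) (J ` q)"
        unfolding disjoint_family_on_def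
      proof (intro ballI impI)
        fix m n assume mn: "m \<in> J ` q" "n \<in> J ` q" "m \<noteq> n"
        obtain x K x' K' where K: "(x, K) \<in> q" "m = J (x, K)" "(x', K') \<in> q" "n = J (x', K')"
          using mn(1,2) by auto
        then have "(x, K) \<in> p" "(x', K') \<in> p" "(x, K) \<noteq> (x', K')"
          "m = (Inf K, Sup K)" "n = (Inf K', Sup K')"
          using q(1) mn(3) by (auto simp: J_def)
        then show "(case m of (u, v) \<Rightarrow> {u<..<v}) \<inter> (case n of (u, v) \<Rightarrow> {u<..<v}) = {}"
          using disj by simp
      qed
      have JU: "(case i of (u, v) \<Rightarrow> {u<..<v}) \<subseteq> U" if i: "i \<in> J ` q" for i
      proof -
        obtain x K where xK: "(x, K) \<in> p" "x \<in> N" "i = (Inf K, Sup K)"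
          using i by (auto simp: J_def q_def)
        have "K \<subseteq> \<gamma> x" using finep xK(1) unfolding fine_def by fast
        then have "K \<subseteq> U" using xK(2) by (simp add: \<gamma>_def)
        moreover obtain u v where "K = {u..v}" "Inf K = u" "Sup K = v"
          using pK[OF xK(1)] by blast
        ultimately show ?thesis using xK(3) by auto
      qed
      have fin: "emeasure lborel {u<..<v} \<noteq> top" for u v :: real
        using emeasure_bounded_finite[of "{u<..<v}"] bounded_subset[OF bounded_closed_interval[of u v]]
        by (auto simp: less_top subset_iff)
      \<comment> \<open>The total length is the measure of a disjoint union inside \<open>U\<close>,
        hence below the threshold of absolute continuity.\<close>
      have "(\<Sum>(u, v)\<in>J ` q. v - u) = (\<Sum>i\<in>J ` q. measure lebesgue (case i of (u, v) \<Rightarrow> {u<..<v}))"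
        by (intro sum.cong) (auto simp: J_def q_def)
      also have "\<dots> = measure lebesgue (\<Union>i\<in>J ` q. case i of (u, v) \<Rightarrow> {u<..<v})"
        using q(2) disjJ fin by (intro measure_finite_Union[symmetric]) (auto split: prod.splits)
      also have "\<dots> \<le> measure lebesgue U"
        using q(2) JU Um by (intro measure_mono_fmeasurable UN_least JU sets.finite_UN)
          (auto split: prod.splits)
      finally have "(\<Sum>(u, v)\<in>J ` q. norm (f v - f u)) < e/2 * (b - a)"
        using U\<delta> disjJ q pK by (intro AC) (fastforce simp: J_def)+
      then have sumq: "(\<Sum>(x, K)\<in>q. norm (f (Sup K) - f (Inf K))) < e/2 * (b - a)"
        by (subst (asm) sum.reindex[OF injJ]) (simp add: J_def case_prod_beta)
      have "norm ((\<Sum>(x, K)\<in>p. measure lborel K *\<^sub>R ?g x) - (f b - f a))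
          = norm (\<Sum>(x, K)\<in>p. measure lborel K *\<^sub>R ?g x - (f (Sup K) - f (Inf K)))"
        unfolding ba(2) by (simp add: case_prod_beta sum_subtractf)
      also have "\<dots> \<le> (\<Sum>(x, K)\<in>p. norm (measure lborel K *\<^sub>R ?g x - (f (Sup K) - f (Inf K))))"
        unfolding case_prod_beta by (rule norm_sum)
      also have "\<dots> \<le> (\<Sum>(x, K)\<in>p. e/2 * (Sup K - Inf K) +
          (if (x, K) \<in> q then norm (f (Sup K) - f (Inf K)) else 0))"
      proof (rule sum_mono, clarify)
        fix x K assume xK: "(x, K) \<in> p"
        obtain u v where uv: "K = {u..v}" "u \<le> x" "x \<le> v" "Inf K = u" "Sup K = v" "a \<le> u" "v \<le> b"
          using pK[OF xK] by blast
        show "norm (measure lborel K *\<^sub>R ?g x - (f (Sup K) - f (Inf K))) \<le> e/2 * (Sup K - Inf K) +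
          (if (x, K) \<in> q then norm (f (Sup K) - f (Inf K)) else 0)"
        proof (cases "x \<in> N")
          case True
          show ?thesis
          proof (cases "u < v")
            case True
            with \<open>x \<in> N\<close> show ?thesis
              using e xK uv by (simp add: q_def norm_minus_commute[of "f u"])
          next
            case False
            then have "u = v" using uv by simp
            then show ?thesis using \<open>x \<in> N\<close> uv by simp
          qed
        next
          case False
          have xin: "x \<in> {a..b} - N" using False uv by auto
          have "K \<subseteq> \<gamma> x" using finep xK unfolding fine_def by fast
          then have ball: "K \<subseteq> ball x (d x)" using False by (simp add: \<gamma>_def)
          have "u \<in> K" "v \<in> K" using uv by auto
          then have du: "norm (u - x) < d x" and dv: "norm (v - x) < d x"
            using ball by (auto simp: dist_real_def)
          \<comment> \<open>The tag separates \<open>u\<close> from \<open>v\<close>, so the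
            distances of both ends from \<open>x\<close> add up to \<open>v - u\<close> and the two
            linearization errors combine without loss.\<close>
          have "norm ((v - u) *\<^sub>R f' x - (f v - f u)) =
              norm (f u - f x - (u - x) *\<^sub>R f' x - (f v - f x - (v - x) *\<^sub>R f' x))"
            by (auto simp: algebra_simps)
          also have "\<dots> \<le> norm (f u - f x - (u - x) *\<^sub>R f' x) + norm (f v - f x - (v - x) *\<^sub>R f' x)"
            by (rule norm_triangle_ineq4)
          also have "\<dots> \<le> e/2 * norm (u - x) + e/2 * norm (v - x)"
            using uv by (intro add_mono d(2) xin du dv) auto
          also have "\<dots> = e/2 * (v - u)"
            using uv by (simp add: field_simps)
          finally show ?thesis using uv False by (simp add: q_def)
        qed
      qed
      also have "\<dots> = e/2 * (b - a) + (\<Sum>(x, K)\<in>q. norm (f (Sup K) - f (Inf K)))"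
      proof -
        have "(\<Sum>(x, K)\<in>p. (if (x, K) \<in> q then norm (f (Sup K) - f (Inf K)) else 0))
            = (\<Sum>(x, K)\<in>q. norm (f (Sup K) - f (Inf K)))"
          using q finp by (subst sum.mono_neutral_right[of p q]) (auto intro!: sum.cong)
        then show ?thesis
          unfolding ba(1) by (simp add: case_prod_beta sum.distrib sum_distrib_left)
      qed
      also have "\<dots> \<le> e * measure lborel (cbox a b)"
        using sumq ab by simp
      finally show "norm ((\<Sum>(x, K)\<in>p. measure lborel K *\<^sub>R ?g x) - (f b - f a)) \<le> e * measure lborel (cbox a b)" .
    qed
  qed
qed auto

text \<open>The differentiation theorem at hand takes averages to the right of the point only;
  averages to the left come from the reflected function, whose exceptional set is reflected back.
  Extension by zero makes every average meaningful.\<close>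

lemma Lebesgue_differentiation_interval:
  fixes g :: "real \<Rightarrow> complex"
  assumes g: "g integrable_on {a..b}"
  obtains N where "negligible N"
    "\<And>x. x \<in> {a..b} - N \<Longrightarrow> ((\<lambda>x. integral {a..x} g) has_vector_derivative g x) (at x within {a..b})"
proof -
  define f where "f x = (if x \<in> {a..b} then g x else 0)" for x
  have f: "f integrable_on cbox u v" for u v
    using g integrable_restrict_UNIV[of "{a..b}" g] integrable_on_subcbox[of f UNIV u v]
    by (simp add: f_def[abs_def])
  then have f': "(\<lambda>x. f (- x)) integrable_on cbox u v" for u v
    using integrable_reflect[of f "- u" "- v"] f[of "- v" "- u"] unfolding minus_minus by blast
  obtain N1 where N1: "negligible N1" "\<And>x e. \<lbrakk>x \<notin> N1; 0 < e\<rbrakk> \<Longrightarrow>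
      \<exists>d>0. \<forall>h. 0 < h \<and> h < d \<longrightarrow> norm (integral {x..x + h} f /\<^sub>R h - f x) < e"
    using integrable_ccontinuous_explicit[OF f] by (simp add: Basis_real_def) blast
  obtain N2 where N2: "negligible N2" "\<And>x e. \<lbrakk>x \<notin> N2; 0 < e\<rbrakk> \<Longrightarrow>
      \<exists>d>0. \<forall>h. 0 < h \<and> h < d \<longrightarrow> norm (integral {x..x + h} (\<lambda>x. f (- x)) /\<^sub>R h - f (- x)) < e"
    using integrable_ccontinuous_explicit[OF f'] by (simp add: Basis_real_def) blast
  have sub: "integral {a..y} g - integral {a..x} g = integral {x..y} f"
    if "a \<le> x" "x \<le> y" "y \<le> b" for x y
  proof -
    have "integral {a..x} g + integral {x..y} g = integral {a..y} g"
      using that g by (intro Henstock_Kurzweil_Integration.integral_combine integrable_subinterval_real[OF g]) auto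
    moreover have "integral {x..y} f = integral {x..y} g"
      using that by (intro integral_cong) (auto simp: f_def)
    ultimately show ?thesis by (metis add_diff_cancel_left')
  qed
  have bound: "norm (I - h *\<^sub>R z) \<le> e * h" if "norm (I /\<^sub>R h - z) < e" "0 < h"
    for I z :: complex and h e :: real
  proof -
    have "I - h *\<^sub>R z = h *\<^sub>R (I /\<^sub>R h - z)"
      using that by (simp add: scaleR_diff_right)
    then show ?thesis using that by (simp add: mult.commute)
  qed
  show thesis
  proof
    show "negligible (N1 \<union> uminus ` N2)"
      using N1(1) N2(1) by (intro negligible_Un negligible_differentiable_image_negligible linear_imp_differentiable_on)
          (auto simp: linear_iff)
    fix x assume x: "x \<in> {a..b} - (N1 \<union> uminus ` N2)"
    then have x1: "x \<notin> N1" and x2: "- x \<notin> N2" and xab: "x \<in> {a..b}" and fx: "f x = g x"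
      by (auto simp: f_def image_iff)
    show "((\<lambda>x. integral {a..x} g) has_vector_derivative g x) (at x within {a..b})"
      unfolding has_vector_derivative_def has_derivative_within_alt
    proof (intro conjI allI impI bounded_linear_scaleR_left)
      fix e :: real assume e: "e > 0"
      obtain d1 where d1: "d1 > 0" "\<And>h. 0 < h \<and> h < d1 \<Longrightarrow> norm (integral {x..x + h} f /\<^sub>R h - f x) < e"
        using N1(2)[OF x1 e] by blast
      obtain d2 where d2: "d2 > 0" "\<And>h. 0 < h \<and> h < d2 \<Longrightarrow>
          norm (integral {-x..-x + h} (\<lambda>x. f (- x)) /\<^sub>R h - f x) < e"
        using N2(2)[OF x2 e] by auto
      show "\<exists>d>0. \<forall>y\<in>{a..b}. norm (y - x) < d \<longrightarrow>
          norm (integral {a..y} g - integral {a..x} g - (y - x) *\<^sub>R g x) \<le> e * norm (y - x)"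
      proof (intro exI[of _ "min d1 d2"] conjI ballI impI)
        fix y assume y: "y \<in> {a..b}" "norm (y - x) < min d1 d2"
        consider "y = x" | "y > x" | "y < x" by linarith
        then show "norm (integral {a..y} g - integral {a..x} g - (y - x) *\<^sub>R g x) \<le> e * norm (y - x)"
        proof cases
          case 2
          then show ?thesis
            using bound[OF d1(2)[of "y - x"]] y xab fx sub[of x y] by simp
        next
          case 3
          have "integral {-x..-y} (\<lambda>x. f (- x)) = integral {y..x} f"
            by (rule Henstock_Kurzweil_Integration.integral_reflect_real)
          then have "norm (integral {y..x} f - (x - y) *\<^sub>R g x) \<le> e * (x - y)"
            using bound[OF d2(2)[of "x - y"]] y 3 fx by simp
          moreover have "integral {a..y} g - integral {a..x} g - (y - x) *\<^sub>R g x =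
              - (integral {y..x} f - (x - y) *\<^sub>R g x)"
            using sub[of y x] y xab 3 by (simp add: algebra_simps)
          moreover have "norm (y - x) = x - y" using 3 by simp
          ultimately show ?thesis by (metis norm_minus_cancel)
        qed simp
      qed (use d1 d2 in auto)
    qed
  qed
qed

text \<open>The sum is the integral over the union of the open intervals; the end points are
  negligible.\<close>

lemma sum_integral_disjoint_le:
  fixes q :: "real \<Rightarrow> real"
  assumes q: "q integrable_on {a..b}" and nonneg: "\<And>x. x \<in> {a..b} \<Longrightarrow> 0 \<le> q x"
    and I: "finite I" "\<And>u v. (u, v) \<in> I \<Longrightarrow> a \<le> u \<and> u \<le> v \<and> v \<le> b"
      "disjoint_family_on (\<lambda>(u, v). {u<..<v}) I"
  shows "(\<Sum>(u, v)\<in>I. integral {u..v} q) \<le> integral {a..b} q"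
proof -
  have "(q has_integral (\<Sum>i\<in>I. integral {fst i..snd i} q)) (\<Union>i\<in>I. {fst i<..<snd i})"
  proof (intro has_integral_UN[OF I(1)])
    fix i assume "i \<in> I"
    then have "{fst i..snd i} \<subseteq> {a..b}" using I(2)[of "fst i" "snd i"] by auto
    then have "(q has_integral integral {fst i..snd i} q) {fst i..snd i}"
      using integrable_subinterval_real[OF q] by blast
    then show "(q has_integral integral {fst i..snd i} q) {fst i<..<snd i}"
      by (simp add: has_integral_Icc_iff_Ioo)
  next
    show "pairwise (\<lambda>i i'. negligible ({fst i<..<snd i} \<inter> {fst i'<..<snd i'})) I"
      using I(3) unfolding pairwise_def disjoint_family_on_def by (auto simp: case_prod_beta)
  qed
  moreover have "(q has_integral integral {a..b} q) {a..b}" using q by blast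
  moreover have "(\<Union>i\<in>I. {fst i<..<snd i}) \<subseteq> {a..b}" using I(2) by fastforce
  ultimately have "(\<Sum>i\<in>I. integral {fst i..snd i} q) \<le> integral {a..b} q"
    using nonneg by (intro has_integral_subset_le) auto
  then show ?thesis by (simp add: case_prod_beta)
qed

text \<open>Expand the square of \<open>t * norm z - 1\<close>.\<close>

lemma norm_le_square_AMGM:
  fixes z :: complex
  assumes "0 < t"
  shows "norm z \<le> t / 2 * (norm z)\<^sup>2 + 1 / (2 * t)"
  using assms zero_le_power2[of "t * norm z - 1"] by (simp add: field_simps power2_eq_square)

text \<open>The estimate \<open>|g| \<le> t |g|\<^sup>2 / 2 + 1 / (2 t)\<close> with small \<open>t\<close> replaces the Cauchy-Schwarz inequality.\<close>

lemma absolutely_continuous_fun_indefinite_integral: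
  fixes g :: "real \<Rightarrow> complex"
  assumes g: "g integrable_on {a..b}" and g2: "(\<lambda>x. (norm (g x))\<^sup>2) integrable_on {a..b}"
  shows "absolutely_continuous_fun a b (\<lambda>x. c + integral {a..x} g)"
proof (rule absolutely_continuous_funI)
  fix e :: real assume e: "e > 0"
  let ?q = "\<lambda>x. (norm (g x))\<^sup>2"
  define M where "M = integral {a..b} ?q"
  have M: "M \<ge> 0" unfolding M_def by (rule integral_nonneg[OF g2]) auto
  \<comment> \<open>Balances the two terms: \<open>t\<close> times half the total square integral
    stays below \<open>e / 2\<close>, with \<open>M + 1\<close> keeping the denominator positive,
    and total length below \<open>t * e\<close> keeps the other term below
    \<open>e / 2\<close>.\<close>
  define t where "t = e / (M + 1)"
  have t: "t > 0" using e M by (simp add: t_def)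
  have tM: "t / 2 * M < e / 2" using e M by (simp add: t_def field_simps)
  have uv: "norm (integral {u..v} g) \<le> t / 2 * integral {u..v} ?q + (v - u) / (2 * t)"
    if "a \<le> u" "u \<le> v" "v \<le> b" for u v
  proof -
    have i: "g integrable_on {u..v}" "?q integrable_on {u..v}"
      using that by (auto intro: integrable_subinterval_real[OF g] integrable_subinterval_real[OF g2])
    have "norm (integral {u..v} g) \<le> integral {u..v} (\<lambda>x. t / 2 * ?q x + 1 / (2 * t))"
      using i norm_le_square_AMGM[OF t]
      by (intro integral_norm_bound_integral integrable_add integrable_on_mult_right) auto
    also have "\<dots> = t / 2 * integral {u..v} ?q + integral {u..v} (\<lambda>x. 1 / (2 * t))"
      using i by (subst integral_add) (auto intro: integrable_on_mult_right simp del: integral_const)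
    finally show ?thesis using that by simp
  qed
  have "(\<Sum>(u, v)\<in>I. norm ((c + integral {a..v} g) - (c + integral {a..u} g))) < e"
    if I: "finite I" "\<forall>(u, v)\<in>I. a \<le> u \<and> u \<le> v \<and> v \<le> b"
      "disjoint_family_on (\<lambda>(u, v). {u<..<v}) I" "(\<Sum>(u, v)\<in>I. v - u) < t * e" for I
  proof -
    have "(\<Sum>(u, v)\<in>I. norm ((c + integral {a..v} g) - (c + integral {a..u} g)))
        \<le> (\<Sum>(u, v)\<in>I. t / 2 * integral {u..v} ?q + (v - u) / (2 * t))"
    proof (intro sum_mono, clarify)
      fix u v assume "(u, v) \<in> I"
      then have *: "a \<le> u" "u \<le> v" "v \<le> b" using I(2) by auto
      have "integral {a..u} g + integral {u..v} g = integral {a..v} g"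
        using * by (intro Henstock_Kurzweil_Integration.integral_combine) (auto intro: integrable_subinterval_real[OF g])
      then have "(c + integral {a..v} g) - (c + integral {a..u} g) = integral {u..v} g"
        by (simp add: algebra_simps)
      then show "norm ((c + integral {a..v} g) - (c + integral {a..u} g))
          \<le> t / 2 * integral {u..v} ?q + (v - u) / (2 * t)"
        using uv[OF *] by simp
    qed
    also have "\<dots> = t / 2 * (\<Sum>(u, v)\<in>I. integral {u..v} ?q) + (\<Sum>(u, v)\<in>I. v - u) / (2 * t)"
      by (simp add: case_prod_beta sum.distrib sum_distrib_left sum_divide_distrib)
    also have "\<dots> < e / 2 + e / 2"
    proof (rule add_strict_mono)
      have "(\<Sum>(u, v)\<in>I. integral {u..v} ?q) \<le> M"
        unfolding M_def using I by (intro sum_integral_disjoint_le g2) auto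
      then show "t / 2 * (\<Sum>(u, v)\<in>I. integral {u..v} ?q) < e / 2"
        using tM t by (meson divide_pos_pos mult_left_mono order_le_less_trans less_imp_le zero_less_numeral)
      show "(\<Sum>(u, v)\<in>I. v - u) / (2 * t) < e / 2"
        using I(4) t by (simp add: field_simps)
    qed
    finally show ?thesis by simp
  qed
  then show "\<exists>d>0. \<forall>I. finite I \<longrightarrow> (\<forall>(u, v)\<in>I. a \<le> u \<and> u \<le> v \<and> v \<le> b) \<longrightarrow>
        disjoint_family_on (\<lambda>(u, v). {u<..<v}) I \<longrightarrow> (\<Sum>(u, v)\<in>I. v - u) < d \<longrightarrow>
        (\<Sum>(u, v)\<in>I. norm ((c + integral {a..v} g) - (c + integral {a..u} g))) < e"
    using t e by (intro exI[of _ "t * e"]) auto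
qed

section \<open>The Hilbert space of square integrable functions\<close>

lemma integrable_norm_add_square:
  fixes f g :: "'a \<Rightarrow> complex"
  assumes [measurable]: "f \<in> borel_measurable M" "g \<in> borel_measurable M"
    and "integrable M (\<lambda>x. (norm (f x))\<^sup>2)" "integrable M (\<lambda>x. (norm (g x))\<^sup>2)"
  shows "integrable M (\<lambda>x. (norm (f x + g x))\<^sup>2)"
proof (rule Bochner_Integration.integrable_bound)
  show "integrable M (\<lambda>x. 2 * (norm (f x))\<^sup>2 + 2 * (norm (g x))\<^sup>2)"
    using assms by (intro Bochner_Integration.integrable_add integrable_mult_right)
  have "(norm (f x + g x))\<^sup>2 \<le> 2 * (norm (f x))\<^sup>2 + 2 * (norm (g x))\<^sup>2" for x
  proof -
    have "(norm (f x + g x))\<^sup>2 \<le> (norm (f x) + norm (g x))\<^sup>2"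
      by (intro power_mono norm_triangle_ineq) simp
    also have "\<dots> \<le> 2 * (norm (f x))\<^sup>2 + 2 * (norm (g x))\<^sup>2"
      using sum_squares_bound[of "norm (f x)" "norm (g x)"] by (simp add: power2_sum)
    finally show ?thesis .
  qed
  then show "AE x in M. norm ((norm (f x + g x))\<^sup>2) \<le> norm (2 * (norm (f x))\<^sup>2 + 2 * (norm (g x))\<^sup>2)"
    by simp
qed measurable

lemma integrable_norm_scale_square:
  fixes f :: "'a \<Rightarrow> complex"
  assumes "integrable M (\<lambda>x. (norm (f x))\<^sup>2)"
  shows "integrable M (\<lambda>x. (norm (c * f x))\<^sup>2)"
  using integrable_mult_right[OF assms, of "(norm c)\<^sup>2"] by (simp add: norm_mult power_mult_distrib)

lemma integrable_norm_diff_square: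
  fixes f g :: "'a \<Rightarrow> complex"
  assumes "f \<in> borel_measurable M" "g \<in> borel_measurable M"
    and "integrable M (\<lambda>x. (norm (f x))\<^sup>2)" "integrable M (\<lambda>x. (norm (g x))\<^sup>2)"
  shows "integrable M (\<lambda>x. (norm (f x - g x))\<^sup>2)"
  using integrable_norm_add_square[of f M "\<lambda>x. - g x"] assms by simp

lemma (in finite_measure) integrable_if_square_integrable:
  fixes f :: "'a \<Rightarrow> complex"
  assumes "f \<in> borel_measurable M" "integrable M (\<lambda>x. (norm (f x))\<^sup>2)"
  shows "integrable M f"
proof (rule Bochner_Integration.integrable_bound)
  show "integrable M (\<lambda>x. 1 / 2 * (norm (f x))\<^sup>2 + 1 / 2)"
    using assms by (intro Bochner_Integration.integrable_add integrable_mult_right integrable_const)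
  show "AE x in M. norm (f x) \<le> norm (1 / 2 * (norm (f x))\<^sup>2 + 1 / 2)"
    using norm_le_square_AMGM[of 1 "f _"] by (intro AE_I2) (simp add: order_trans[OF _ abs_ge_self])
qed (use assms in simp)

text \<open>A rapidly converging subsequence has increments summable in mean, so it converges almost
  everywhere; Fatou's lemma along it bounds the mean square distance of the full sequence to the
  limit.\<close>

theorem (in finite_measure) Riesz_Fischer:
  fixes f :: "nat \<Rightarrow> 'a \<Rightarrow> complex"
  assumes meas [measurable]: "\<And>i. f i \<in> borel_measurable M"
    and sq: "\<And>i. integrable M (\<lambda>x. (norm (f i x))\<^sup>2)"
    and cau: "\<And>e. e > 0 \<Longrightarrow> \<exists>N. \<forall>i\<ge>N. \<forall>j\<ge>N. (\<integral>x. (norm (f i x - f j x))\<^sup>2 \<partial>M) < e"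
  obtains F where "F \<in> borel_measurable M" "integrable M (\<lambda>x. (norm (F x))\<^sup>2)"
    "(\<lambda>i. \<integral>x. (norm (f i x - F x))\<^sup>2 \<partial>M) \<longlonglongrightarrow> 0"
proof -
  have sqd: "integrable M (\<lambda>x. (norm (f i x - f j x))\<^sup>2)" for i j
    by (intro integrable_norm_diff_square meas sq)
  \<comment> \<open>The rate 1/4 fits the weight \<open>2 ^ k\<close> used below in
    \<open>norm_le_square_AMGM\<close>: both resulting terms then decay like
    \<open>(1 / 2) ^ k\<close>.\<close>
  have "\<forall>k. \<exists>N. \<forall>i\<ge>N. \<forall>j\<ge>N. (\<integral>x. (norm (f i x - f j x))\<^sup>2 \<partial>M) < (1 / 4) ^ k"
    by (intro allI cau) simp
  then obtain N where N: "\<And>k i j. i \<ge> N k \<Longrightarrow> j \<ge> N k \<Longrightarrow>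
      (\<integral>x. (norm (f i x - f j x))\<^sup>2 \<partial>M) < (1 / 4) ^ k"
    by metis
  \<comment> \<open>Summing makes the indices increase, and the successor makes \<open>r k\<close>
    at least \<open>k\<close> as well as at least \<open>N k\<close>.\<close>
  define r where "r k = (\<Sum>l\<le>k. Suc (N l))" for k
  have rN: "r k \<ge> N k" for k
    unfolding r_def using member_le_sum[of k "{..k}" "\<lambda>l. Suc (N l)"] by simp
  have rk: "r k \<ge> k" for k
    unfolding r_def by (induction k) auto
  have rSuc: "r (Suc k) \<ge> r k" for k
    unfolding r_def by simp
  define d where "d k x = f (r (Suc k)) x - f (r k) x" for k x
  have [measurable]: "d k \<in> borel_measurable M" for k
    unfolding d_def[abs_def] by measurable
  define m where "m = measure M (space M)"
  have d_int: "(\<integral>\<^sup>+x. ennreal (norm (d k x)) \<partial>M) \<le> ennreal ((1 + m) / 2 * (1 / 2) ^ k)" for k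
  proof -
    have dsq: "integrable M (\<lambda>x. (norm (d k x))\<^sup>2)"
      unfolding d_def by (rule sqd)
    then have i: "integrable M (\<lambda>x. norm (d k x))"
      by (intro integrable_norm integrable_if_square_integrable) measurable
    have "(\<integral>x. norm (d k x) \<partial>M) \<le> (\<integral>x. 2 ^ k / 2 * (norm (d k x))\<^sup>2 + 1 / (2 * 2 ^ k) \<partial>M)"
      using dsq i by (intro integral_mono norm_le_square_AMGM) auto
    also have "\<dots> = 2 ^ k / 2 * (\<integral>x. (norm (d k x))\<^sup>2 \<partial>M) + m / (2 * 2 ^ k)"
      using dsq by (subst Bochner_Integration.integral_add) (auto simp: m_def)
    also have "\<dots> \<le> 2 ^ k / 2 * (1 / 4) ^ k + m / (2 * 2 ^ k)"
      using N[of k "r (Suc k)" "r k"] rN[of k] rSuc[of k] unfolding d_def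
      by (intro add_right_mono mult_left_mono) auto
    also have "\<dots> = (1 + m) / 2 * (1 / 2) ^ k"
    proof -
      have "(4 :: real) ^ k = 2 ^ k * 2 ^ k" by (simp add: power_mult_distrib[symmetric])
      then show ?thesis by (simp add: field_simps power_divide)
    qed
    finally have "ennreal (\<integral>x. norm (d k x) \<partial>M) \<le> ennreal ((1 + m) / 2 * (1 / 2) ^ k)"
      by (rule ennreal_leI)
    then show ?thesis using i by (simp add: nn_integral_eq_integral)
  qed
  have "(\<integral>\<^sup>+x. (\<Sum>k. ennreal (norm (d k x))) \<partial>M) = (\<Sum>k. \<integral>\<^sup>+x. ennreal (norm (d k x)) \<partial>M)"
    by (rule nn_integral_suminf) measurable
  also have "\<dots> \<le> (\<Sum>k. ennreal ((1 + m) / 2 * (1 / 2) ^ k))"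
    by (intro suminf_le d_int) auto
  also have "\<dots> = ennreal (\<Sum>k. (1 + m) / 2 * (1 / 2) ^ k)"
    by (intro suminf_ennreal2 summable_mult summable_geometric) (auto simp: m_def)
  also have "\<dots> < \<infinity>" by simp
  finally have "AE x in M. (\<Sum>k. ennreal (norm (d k x))) \<noteq> \<infinity>"
    by (intro nn_integral_PInf_AE) auto
  then have AE_sum: "AE x in M. summable (\<lambda>k. d k x)"
    by eventually_elim (rule summable_norm_cancel, rule summable_suminf_not_top, auto)
  \<comment> \<open>Defined everywhere by \<open>lim\<close> for the sake of measurability; the
    default value of \<open>lim\<close> is taken on a null set only.\<close>
  define F where "F x = lim (\<lambda>k. f (r k) x)" for x
  have F[measurable]: "F \<in> borel_measurable M"
    unfolding F_def[abs_def] by measurable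
  have AE_lim: "AE x in M. (\<lambda>k. f (r k) x) \<longlonglongrightarrow> F x"
    using AE_sum
  proof eventually_elim
    case (elim x)
    have "(\<lambda>n. \<Sum>k<n. d k x) \<longlonglongrightarrow> (\<Sum>k. d k x)"
      using elim by (rule summable_LIMSEQ)
    then have "(\<lambda>n. f (r 0) x + (\<Sum>k<n. d k x)) \<longlonglongrightarrow> f (r 0) x + (\<Sum>k. d k x)"
      by (intro tendsto_intros)
    then have "convergent (\<lambda>n. f (r n) x)"
      unfolding convergent_def d_def by (subst (asm) sum_lessThan_telescope) auto
    then show ?case unfolding F_def by (rule convergent_LIMSEQ_iff[THEN iffD1])
  qed
  have fatou: "\<exists>N. \<forall>i\<ge>N. (\<integral>\<^sup>+x. ennreal ((norm (f i x - F x))\<^sup>2) \<partial>M) \<le> ennreal e" if "e > 0" for e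
  proof -
    obtain N where N: "\<And>i j. i \<ge> N \<Longrightarrow> j \<ge> N \<Longrightarrow> (\<integral>x. (norm (f i x - f j x))\<^sup>2 \<partial>M) < e"
      using cau[OF \<open>e > 0\<close>] by blast
    have "(\<integral>\<^sup>+x. ennreal ((norm (f i x - F x))\<^sup>2) \<partial>M) \<le> ennreal e" if "i \<ge> N" for i
    proof -
      have "(\<integral>\<^sup>+x. ennreal ((norm (f i x - F x))\<^sup>2) \<partial>M) =
          (\<integral>\<^sup>+x. liminf (\<lambda>k. ennreal ((norm (f i x - f (r k) x))\<^sup>2)) \<partial>M)"
      proof (rule nn_integral_cong_AE, use AE_lim in eventually_elim)
        case (elim x)
        have "(\<lambda>k. ennreal ((norm (f i x - f (r k) x))\<^sup>2)) \<longlonglongrightarrow> ennreal ((norm (f i x - F x))\<^sup>2)"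
          by (intro tendsto_intros elim)
        then show ?case by (metis lim_imp_Liminf trivial_limit_sequentially)
      qed
      also have "\<dots> \<le> liminf (\<lambda>k. \<integral>\<^sup>+x. ennreal ((norm (f i x - f (r k) x))\<^sup>2) \<partial>M)"
        by (rule nn_integral_liminf) measurable
      also have "\<dots> \<le> ennreal e"
      proof (rule Liminf_le)
        show "\<forall>\<^sub>F k in sequentially. (\<integral>\<^sup>+x. ennreal ((norm (f i x - f (r k) x))\<^sup>2) \<partial>M) \<le> ennreal e"
          using eventually_ge_at_top[of N]
        proof eventually_elim
          case (elim k)
          then have "r k \<ge> N" using rk[of k] by simp
          then show ?case
            using N[OF \<open>i \<ge> N\<close>, of "r k"] sqd[of i "r k"]
            by (subst nn_integral_eq_integral) (auto intro!: ennreal_leI)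
        qed
      qed simp
      finally show ?thesis .
    qed
    then show ?thesis by blast
  qed
  have int_F: "integrable M (\<lambda>x. (norm (f i x - F x))\<^sup>2)"
    if "(\<integral>\<^sup>+x. ennreal ((norm (f i x - F x))\<^sup>2) \<partial>M) \<le> ennreal e" for i e
    using that by (intro integrableI_bounded) (auto simp: order_le_less_trans)
  \<comment> \<open>One finite distance suffices: \<open>F\<close> is the difference of
    \<open>f i\<close> and \<open>f i - F\<close>, both square integrable.\<close>
  obtain i where "\<forall>j\<ge>i. (\<integral>\<^sup>+x. ennreal ((norm (f j x - F x))\<^sup>2) \<partial>M) \<le> ennreal 1"
    using fatou[of 1] zero_less_one by blast
  then have "integrable M (\<lambda>x. (norm (f i x - F x))\<^sup>2)"
    by (intro int_F[of i 1]) blast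
  then have sqF: "integrable M (\<lambda>x. (norm (F x))\<^sup>2)"
    using integrable_norm_diff_square[of "f i" M "\<lambda>x. f i x - F x"] sq by simp
  have "(\<lambda>i. \<integral>x. (norm (f i x - F x))\<^sup>2 \<partial>M) \<longlonglongrightarrow> 0"
  proof (rule LIMSEQ_I)
    fix e :: real assume e: "e > 0"
    then obtain N where N: "\<And>i. i \<ge> N \<Longrightarrow> (\<integral>\<^sup>+x. ennreal ((norm (f i x - F x))\<^sup>2) \<partial>M) \<le> ennreal (e / 2)"
      using fatou[of "e / 2"] by auto
    have "(\<integral>x. (norm (f i x - F x))\<^sup>2 \<partial>M) \<le> e / 2" if "i \<ge> N" for i
      using N[OF that] int_F[OF N[OF that]] e by (simp add: nn_integral_eq_integral)
    then show "\<exists>N. \<forall>i\<ge>N. norm ((\<integral>x. (norm (f i x - F x))\<^sup>2 \<partial>M) - 0) < e"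
      using e by (intro exI[of _ N]) (fastforce simp: integral_nonneg_AE)
  qed
  with that F sqF show thesis by blast
qed

section \<open>Classes of functions on the interval\<close>

lemma finite_measure_lebesgue_on_interval: "finite_measure (lebesgue_on {a..b :: real})"
  by (rule finite_measureI) (use emeasure_bounded_finite[OF bounded_closed_interval[of a b]] in
      \<open>simp add: emeasure_restrict_space space_restrict_space\<close>)

lemma AE_lebesgue_on_interval_iff:
  "(AE x in lebesgue_on {a..b :: real}. P x) \<longleftrightarrow> (AE x in lebesgue. x \<in> {a..b} \<longrightarrow> P x)"
  by (rule AE_restrict_space_iff) simp

text \<open>Both extensions vanish off the interval, so comparing classes on the line amounts to
  comparing functions on the interval.\<close>

lemma ae_class_eq_iff: "ae_class a b f = ae_class a b g \<longleftrightarrow> (AE x in lebesgue_on {a..b}. f x = g x)"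
proof -
  have "ae_class a b f = ae_class a b g \<longleftrightarrow>
      (AE x in lebesgue. (if x \<in> {a..b} then f x else 0) = (if x \<in> {a..b} then g x else 0))"
    by (simp add: ae_class_def aefun.abs_eq_iff ae_eq_def)
  also have "\<dots> \<longleftrightarrow> (AE x in lebesgue. x \<in> {a..b} \<longrightarrow> f x = g x)"
    by (rule AE_cong) auto
  finally show ?thesis by (simp add: AE_lebesgue_on_interval_iff)
qed

lemma ae_class_cong: "(\<And>x. x \<in> {a..b} \<Longrightarrow> f x = g x) \<Longrightarrow> ae_class a b f = ae_class a b g"
  unfolding ae_class_def by (rule arg_cong[of _ _ abs_aefun]) auto

lemma ae_class_add: "ae_class a b f + ae_class a b g = ae_class a b (\<lambda>x. f x + g x)"
  and ae_class_diff: "ae_class a b f - ae_class a b g = ae_class a b (\<lambda>x. f x - g x)"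
  and ae_class_scale: "c *\<^sub>C ae_class a b f = ae_class a b (\<lambda>x. c * f x)"
  and ae_class_zero: "ae_class a b (\<lambda>x. 0) = 0"
  unfolding ae_class_def plus_aefun.abs_eq minus_aefun.abs_eq scaleC_aefun.abs_eq zero_aefun_def
  by (auto intro!: arg_cong[of _ _ abs_aefun])

lemma L2_ip_ae_class:
  "L2_ip a b (ae_class a b f) (ae_class a b g) = (LINT x|lebesgue_on {a..b}. f x * cnj (g x))"
  unfolding ae_class_def L2_ip.abs_eq
  by (intro Bochner_Integration.integral_cong) (auto simp: space_restrict_space)

lemma vecs_L2: "vecs (L2 a b) = ae_class a b ` {f. square_integrable a b f}"
  and ip_L2: "ip (L2 a b) = L2_ip a b"
  by (simp_all add: L2_def)

lemma square_integrable_zero: "square_integrable a b (\<lambda>x. 0)"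
  by (simp add: square_integrable_def)

lemma square_integrable_add:
  "\<lbrakk>square_integrable a b f; square_integrable a b g\<rbrakk> \<Longrightarrow> square_integrable a b (\<lambda>x. f x + g x)"
  by (auto simp: square_integrable_def intro: integrable_norm_add_square)

lemma square_integrable_scale:
  "square_integrable a b f \<Longrightarrow> square_integrable a b (\<lambda>x. c * f x)"
  by (auto simp: square_integrable_def intro: integrable_norm_scale_square)

lemma square_integrable_imp_integrable:
  assumes "square_integrable a b f"
  shows "integrable (lebesgue_on {a..b}) f"
proof -
  interpret finite_measure "lebesgue_on {a..b}" by (rule finite_measure_lebesgue_on_interval)
  show ?thesis
    using assms unfolding square_integrable_def by (elim conjE) (rule integrable_if_square_integrable)
qed

lemma integrable_mult_cnj:
  assumes "square_integrable a b f" "square_integrable a b g"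
  shows "integrable (lebesgue_on {a..b}) (\<lambda>x. f x * cnj (g x))"
proof (rule Bochner_Integration.integrable_bound)
  show "integrable (lebesgue_on {a..b}) (\<lambda>x. (norm (f x))\<^sup>2 + (norm (g x))\<^sup>2)"
    using assms by (auto simp: square_integrable_def)
  show "(\<lambda>x. f x * cnj (g x)) \<in> borel_measurable (lebesgue_on {a..b})"
    using assms unfolding square_integrable_def
    by (intro borel_measurable_times borel_measurable_continuous_on[of cnj] continuous_intros) auto
  have "norm (f x * cnj (g x)) \<le> (norm (f x))\<^sup>2 + (norm (g x))\<^sup>2" for x
    using sum_squares_bound[of "norm (f x)" "norm (g x)"] mult_nonneg_nonneg[of "norm (f x)" "norm (g x)"]
    unfolding norm_mult complex_mod_cnj mult.assoc by (smt (verit) norm_ge_zero)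
  then show "AE x in lebesgue_on {a..b}. norm (f x * cnj (g x)) \<le> norm ((norm (f x))\<^sup>2 + (norm (g x))\<^sup>2)"
    by (intro AE_I2) (simp add: order_trans[OF _ abs_ge_self])
qed

lemma square_integrable_continuous:
  assumes "continuous_on {a..b} f"
  shows "square_integrable a b f"
  using assms unfolding square_integrable_def
  by (auto intro!: continuous_imp_measurable_on_sets_lebesgue continuous_imp_integrable_real continuous_intros)

lemma L2_ip_self: "L2_ip a b (ae_class a b f) (ae_class a b f) =
    of_real (LINT x|lebesgue_on {a..b}. (norm (f x))\<^sup>2)"
  by (simp add: L2_ip_ae_class complex_norm_square[symmetric] del: of_real_power)

lemma norm_L2: "ip_norm (L2 a b) (ae_class a b f) = sqrt (LINT x|lebesgue_on {a..b}. (norm (f x))\<^sup>2)"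
  by (simp add: ip_norm_def ip_L2 L2_ip_self)

theorem hilbert_space_L2: "hilbert_space (L2 a b)"
proof -
  let ?M = "lebesgue_on {a..b}"
  interpret M: finite_measure ?M by (rule finite_measure_lebesgue_on_interval)
  have "inner_product_space (L2 a b)"
    unfolding inner_product_space_def vecs_L2 ip_L2
  proof (intro conjI ballI allI impI; (elim imageE CollectE)?)
    show "complex_vector.subspace (ae_class a b ` {f. square_integrable a b f})"
      unfolding complex_vector.subspace_def
      by (auto simp: ae_class_add ae_class_scale square_integrable_add square_integrable_scale
          intro!: image_eqI[of 0 "ae_class a b" "\<lambda>x. 0"] ae_class_zero[symmetric] square_integrable_zero)
  next
    fix x y z f g h assume *: "x = ae_class a b f" "y = ae_class a b g" "z = ae_class a b h"
      "square_integrable a b f" "square_integrable a b g" "square_integrable a b h"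
    show "L2_ip a b (x + y) z = L2_ip a b x z + L2_ip a b y z"
      unfolding * ae_class_add L2_ip_ae_class distrib_right
      by (intro Bochner_Integration.integral_add integrable_mult_cnj *)
  next
    fix c x y f g assume *: "x = ae_class a b f" "y = ae_class a b g"
      "square_integrable a b f" "square_integrable a b g"
    show "L2_ip a b (c *\<^sub>C x) y = c * L2_ip a b x y"
      unfolding * ae_class_scale L2_ip_ae_class by (simp add: mult.assoc)
  next
    fix x y f g assume *: "x = ae_class a b f" "y = ae_class a b g"
    show "L2_ip a b y x = cnj (L2_ip a b x y)"
      unfolding * L2_ip_ae_class by (subst Bochner_Integration.integral_cnj[symmetric]) (simp add: mult.commute)
  next
    fix x f assume *: "x = ae_class a b f" "square_integrable a b f" "x \<noteq> 0"
    have "\<not> (AE x in ?M. f x = 0)"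
      using *(1,3) ae_class_eq_iff[of a b f "\<lambda>x. 0"] by (simp add: ae_class_zero)
    then have "(LINT x|?M. (norm (f x))\<^sup>2) \<noteq> 0"
      using *(2) by (subst integral_nonneg_eq_0_iff_AE) (auto simp: square_integrable_def)
    then show "0 < Re (L2_ip a b x x)"
      unfolding * L2_ip_self by (simp add: less_le integral_nonneg_AE)
  qed
  moreover have "\<exists>x\<in>vecs (L2 a b). (\<lambda>i. ip_norm (L2 a b) (X i - x)) \<longlonglongrightarrow> 0"
    if X: "\<forall>i. X i \<in> vecs (L2 a b)"
      and cau: "\<forall>e>0. \<exists>N::nat. \<forall>i\<ge>N. \<forall>j\<ge>N. ip_norm (L2 a b) (X i - X j) < e" for X
  proof -
    have "\<forall>i. \<exists>f. square_integrable a b f \<and> X i = ae_class a b f"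
      using X unfolding vecs_L2 by blast
    then obtain f where f: "\<And>i. square_integrable a b (f i)" "\<And>i. X i = ae_class a b (f i)"
      by metis
    have "\<exists>N. \<forall>i\<ge>N. \<forall>j\<ge>N. (LINT x|?M. (norm (f i x - f j x))\<^sup>2) < e" if "e > 0" for e
    proof -
      have "sqrt e > 0" using that by simp
      then obtain N where "\<forall>i\<ge>N. \<forall>j\<ge>N. ip_norm (L2 a b) (X i - X j) < sqrt e"
        using cau by blast
      then show ?thesis by (simp add: f(2) ae_class_diff norm_L2) blast
    qed
    then obtain F where F: "F \<in> borel_measurable ?M" "integrable ?M (\<lambda>x. (norm (F x))\<^sup>2)"
      "(\<lambda>i. LINT x|?M. (norm (f i x - F x))\<^sup>2) \<longlonglongrightarrow> 0"
      using M.Riesz_Fischer[of f] f(1) unfolding square_integrable_def by blast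
    have "(\<lambda>i. sqrt (LINT x|?M. (norm (f i x - F x))\<^sup>2)) \<longlonglongrightarrow> sqrt 0"
      by (intro tendsto_intros F(3))
    then have "(\<lambda>i. ip_norm (L2 a b) (X i - ae_class a b F)) \<longlonglongrightarrow> 0"
      by (simp add: f(2) ae_class_diff norm_L2)
    moreover have "ae_class a b F \<in> vecs (L2 a b)"
      using F by (simp add: vecs_L2 square_integrable_def)
    ultimately show ?thesis by blast
  qed
  ultimately show ?thesis unfolding hilbert_space_def by blast
qed

section \<open>Semi-periodic functions\<close>

definition deriv1 :: "real \<Rightarrow> real \<Rightarrow> (real \<Rightarrow> complex) \<Rightarrow> real \<Rightarrow> complex" where
  "deriv1 a b f x = vector_derivative f (at x within {a..b})"

lemma deriv_on_0 [simp]: "deriv_on a b 0 f = f"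
  by (simp add: deriv_on_def)

text \<open>Peels off the derivative applied first, so that inductions descend from \<open>f\<close>
  to its derivative.\<close>

lemma deriv_on_Suc: "deriv_on a b (Suc j) f = deriv_on a b j (deriv1 a b f)"
  unfolding deriv_on_def funpow_Suc_right deriv1_def[abs_def] by simp

lemma has_vector_derivative_within_cong:
  assumes "\<And>y. y \<in> S \<Longrightarrow> f y = g y" "x \<in> S"
  shows "(f has_vector_derivative v) (at x within S) \<longleftrightarrow> (g has_vector_derivative v) (at x within S)"
  using assms has_vector_derivative_transform by (metis (no_types, lifting))

lemma differentiable_within_cong:
  fixes f g :: "real \<Rightarrow> complex"
  assumes "\<And>y. y \<in> S \<Longrightarrow> f y = g y" "x \<in> S"
  shows "f differentiable (at x within S) \<longleftrightarrow> g differentiable (at x within S)"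
proof -
  have "h differentiable (at x within S) \<longleftrightarrow> (\<exists>v. (h has_vector_derivative v) (at x within S))"
    for h :: "real \<Rightarrow> complex"
    using vector_derivative_works[of h] differentiableI_vector[of h] by blast
  then show ?thesis
    using has_vector_derivative_within_cong[OF assms] by simp
qed

lemma deriv1_cong:
  assumes "\<And>y. y \<in> {a..b} \<Longrightarrow> f y = g y" "x \<in> {a..b}"
  shows "deriv1 a b f x = deriv1 a b g x"
  unfolding deriv1_def vector_derivative_def
  using has_vector_derivative_within_cong[OF assms] by simp

lemma deriv1_eq:
  "\<lbrakk>a < b; x \<in> {a..b}; (f has_vector_derivative y) (at x within {a..b})\<rbrakk> \<Longrightarrow> deriv1 a b f x = y"
  by (simp add: deriv1_def vector_derivative_within_closed_interval)

lemma has_vector_derivative_deriv_on: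
  "f differentiable (at x within {a..b}) \<Longrightarrow>
    (f has_vector_derivative deriv1 a b f x) (at x within {a..b})"
  by (simp add: deriv1_def vector_derivative_works)

lemma negligible_iff_AE_lebesgue: "negligible {x. \<not> P x} \<longleftrightarrow> (AE x in lebesgue. P x)"
  by (simp add: eventually_ae_filter_negligible) (metis mem_Collect_eq negligible_subset subset_iff)

text \<open>Connects the measure-theoretic conditions with the exceptional sets of the gauge
  integral.\<close>

lemma AE_interval_iff_negligible:
  "(AE x in lebesgue_on {a..b :: real}. P x) \<longleftrightarrow> (\<exists>N. negligible N \<and> (\<forall>x\<in>{a..b} - N. P x))"
proof
  assume "AE x in lebesgue_on {a..b}. P x"
  then have "AE x in lebesgue. x \<in> {a..b} \<longrightarrow> P x"
    by (simp add: AE_lebesgue_on_interval_iff)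
  then have "negligible {x. \<not> (x \<in> {a..b} \<longrightarrow> P x)}"
    by (simp only: negligible_iff_AE_lebesgue)
  then show "\<exists>N. negligible N \<and> (\<forall>x\<in>{a..b} - N. P x)"
    by (intro exI[of _ "{x. \<not> (x \<in> {a..b} \<longrightarrow> P x)}"]) auto
next
  assume "\<exists>N. negligible N \<and> (\<forall>x\<in>{a..b} - N. P x)"
  then obtain N where N: "negligible N" "\<forall>x\<in>{a..b} - N. P x" by blast
  have "negligible {x. \<not> (x \<in> {a..b} \<longrightarrow> P x)}"
    by (rule negligible_subset[OF N(1)]) (use N(2) in blast)
  then show "AE x in lebesgue_on {a..b}. P x"
    by (simp only: negligible_iff_AE_lebesgue AE_lebesgue_on_interval_iff)
qed

lemma integrable_cong_AE_interval:
  fixes f g :: "real \<Rightarrow> 'b::euclidean_space"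
  assumes f: "integrable (lebesgue_on {a..b}) f" and eq: "AE x in lebesgue_on {a..b}. f x = g x"
  shows "integrable (lebesgue_on {a..b}) g"
proof -
  obtain N where N: "negligible N" "\<forall>x\<in>{a..b} - N. f x = g x"
    using eq unfolding AE_interval_iff_negligible by blast
  have "f absolutely_integrable_on {a..b}"
    using f by (simp add: set_integrable_def integrable_restrict_space)
  then have "g absolutely_integrable_on {a..b}"
    by (rule absolutely_integrable_spike[OF _ N(1)]) (use N(2) in auto)
  then show ?thesis by (simp add: set_integrable_def integrable_restrict_space)
qed

lemma square_integrable_cong_AE:
  assumes f: "square_integrable a b f" and eq: "AE x in lebesgue_on {a..b}. f x = g x"
  shows "square_integrable a b g"
  unfolding square_integrable_def
proof
  show "g \<in> borel_measurable (lebesgue_on {a..b})"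
    using integrable_cong_AE_interval[OF square_integrable_imp_integrable[OF f] eq] by simp
  show "integrable (lebesgue_on {a..b}) (\<lambda>x. (norm (g x))\<^sup>2)"
    by (rule integrable_cong_AE_interval[of _ _ "\<lambda>x. (norm (f x))\<^sup>2"])
      (use f eq in \<open>auto simp: square_integrable_def elim: eventually_mono\<close>)
qed

lemma square_integrable_cong:
  "\<lbrakk>square_integrable a b f; \<And>x. x \<in> {a..b} \<Longrightarrow> f x = g x\<rbrakk> \<Longrightarrow> square_integrable a b g"
  by (rule square_integrable_cong_AE) (auto intro: AE_I2)

text \<open>The distance of the values is continuous and nonnegative with integral zero.\<close>

lemma continuous_AE_eq_imp_eq:
  fixes f g :: "real \<Rightarrow> complex"
  assumes ab: "a < b" and f: "continuous_on {a..b} f" and g: "continuous_on {a..b} g"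
    and eq: "AE x in lebesgue_on {a..b}. f x = g x" and x: "x \<in> {a..b}"
  shows "f x = g x"
proof -
  obtain N where N: "negligible N" "\<forall>x\<in>{a..b} - N. f x = g x"
    using eq unfolding AE_interval_iff_negligible by blast
  have "((\<lambda>x. norm (f x - g x)) has_integral 0) {a..b}"
    by (rule has_integral_spike[OF N(1), of _ _ "\<lambda>x. 0"]) (use N(2) in auto)
  then have "norm (f x - g x) = 0"
    using f g ab x by (intro has_integral_0_cbox_imp_0[of a b]) (auto intro!: continuous_intros)
  then show ?thesis by simp
qed

lemma semi_periodic_funs_0: "semi_periodic_funs a b 0 = {f. square_integrable a b f}"
  by (simp add: semi_periodic_funs_def)

lemma semi_periodic_funs_1: "f \<in> semi_periodic_funs a b (Suc 0) \<longleftrightarrow>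
    absolutely_continuous_fun a b f \<and> f a = - f b \<and>
    (AE x in lebesgue_on {a..b}. f differentiable (at x within {a..b})) \<and>
    square_integrable a b (deriv1 a b f)"
  by (simp add: semi_periodic_funs_def deriv_on_Suc)

text \<open>The first level is excluded since there \<open>f\<close> need be differentiable only
  almost everywhere, as in \<open>semi_periodic_funs_1\<close>; from the second level on it is
  differentiable throughout.\<close>

lemma semi_periodic_funs_Suc:
  assumes "0 < n"
  shows "f \<in> semi_periodic_funs a b (Suc n) \<longleftrightarrow>
    absolutely_continuous_fun a b f \<and> f a = - f b \<and>
    (\<forall>x\<in>{a..b}. f differentiable (at x within {a..b})) \<and>
    deriv1 a b f \<in> semi_periodic_funs a b n"
proof -
  have *: "(\<forall>j. Suc j < Suc n \<longrightarrow> P j) \<longleftrightarrow> P 0 \<and> (\<forall>j. Suc j < n \<longrightarrow> P (Suc j))"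
    "(\<forall>j. Suc j = Suc n \<longrightarrow> P j) \<longleftrightarrow> (\<forall>j. Suc j = n \<longrightarrow> P (Suc j))" for P
    using assms less_Suc_eq_0_disj gr0_conv_Suc by auto
  show ?thesis
    unfolding semi_periodic_funs_def mem_Collect_eq * All_less_Suc2 deriv_on_Suc deriv_on_0 by blast
qed

text \<open>Derivatives are taken within the interval, also at its ends, so values off it never
  enter.\<close>

lemma semi_periodic_funs_cong:
  assumes "a \<le> b"
  shows "\<lbrakk>f \<in> semi_periodic_funs a b n; \<And>x. x \<in> {a..b} \<Longrightarrow> f x = g x\<rbrakk> \<Longrightarrow> g \<in> semi_periodic_funs a b n"
proof (induction n arbitrary: f g)
  case 0
  then show ?case
    using square_integrable_cong[of a b f g] by (simp add: semi_periodic_funs_0)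
next
  case (Suc n)
  note eq = Suc.prems(2)
  have d: "deriv1 a b f x = deriv1 a b g x" if "x \<in> {a..b}" for x
    by (rule deriv1_cong[OF eq that])
  have ends: "f a = - f b \<Longrightarrow> g a = - g b"
    using assms eq[of a] eq[of b] by simp
  have diff: "f differentiable (at x within {a..b}) \<longleftrightarrow> g differentiable (at x within {a..b})"
    if "x \<in> {a..b}" for x
    by (rule differentiable_within_cong[OF eq that])
  have ac: "absolutely_continuous_fun a b f \<Longrightarrow> absolutely_continuous_fun a b g"
    by (rule absolutely_continuous_fun_cong[OF _ eq])
  show ?case
  proof (cases "n = 0")
    case True
    have "AE x in lebesgue_on {a..b}. g differentiable (at x within {a..b})"
      if "AE x in lebesgue_on {a..b}. f differentiable (at x within {a..b})"
      using that diff unfolding AE_lebesgue_on_interval_iff by (auto elim: eventually_mono)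
    moreover have "square_integrable a b (deriv1 a b f) \<Longrightarrow> square_integrable a b (deriv1 a b g)"
      by (rule square_integrable_cong[OF _ d])
    ultimately show ?thesis
      using Suc.prems(1) ends ac unfolding \<open>n = 0\<close> semi_periodic_funs_1 by blast
  next
    case False
    then have "0 < n" by simp
    have "deriv1 a b f \<in> semi_periodic_funs a b n \<Longrightarrow> deriv1 a b g \<in> semi_periodic_funs a b n"
      by (rule Suc.IH[OF _ d])
    then show ?thesis
      using Suc.prems(1) ends ac diff unfolding semi_periodic_funs_Suc[OF \<open>0 < n\<close>] by blast
  qed
qed

lemma semi_periodic_funs_imp_continuous_on:
  "\<lbrakk>f \<in> semi_periodic_funs a b n; 0 < n\<rbrakk> \<Longrightarrow> continuous_on {a..b} f"
  unfolding semi_periodic_funs_def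
  by (auto dest!: spec[of _ 0] intro: absolutely_continuous_fun_imp_continuous_on)

lemma semi_periodic_funs_square_integrable:
  "f \<in> semi_periodic_funs a b n \<Longrightarrow> square_integrable a b f"
  by (cases "n = 0")
    (auto simp: semi_periodic_funs_0 intro: square_integrable_continuous semi_periodic_funs_imp_continuous_on)

lemma semi_periodic_funs_Suc_subset_1:
  "semi_periodic_funs a b (Suc n) \<subseteq> semi_periodic_funs a b (Suc 0)"
proof (cases "n = 0")
  case False
  then have n: "0 < n" by simp
  show ?thesis
  proof
    fix f assume f: "f \<in> semi_periodic_funs a b (Suc n)"
    then have "AE x in lebesgue_on {a..b}. f differentiable (at x within {a..b})"
      unfolding semi_periodic_funs_Suc[OF n] AE_interval_iff_negligible
      by (intro exI[of _ "{}"]) simp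
    then show "f \<in> semi_periodic_funs a b (Suc 0)"
      using f semi_periodic_funs_square_integrable[of "deriv1 a b f" a b n]
      unfolding semi_periodic_funs_Suc[OF n] semi_periodic_funs_1 by blast
  qed
qed simp

lemma deriv1_semi_periodic:
  "f \<in> semi_periodic_funs a b (Suc n) \<Longrightarrow> deriv1 a b f \<in> semi_periodic_funs a b n"
  by (cases "n = 0") (auto simp: semi_periodic_funs_0 semi_periodic_funs_1 semi_periodic_funs_Suc)

lemma semi_periodic_funs_Suc_subset:
  "semi_periodic_funs a b (Suc n) \<subseteq> semi_periodic_funs a b n"
proof (induction n)
  case 0
  show ?case
    using semi_periodic_funs_square_integrable by (auto simp: semi_periodic_funs_0)
next
  case (Suc n)
  show ?case
  proof (cases "n = 0")
    case True
    then show ?thesis using semi_periodic_funs_Suc_subset_1[of a b "Suc n"] by simp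
  next
    case False
    then have n: "0 < n" "0 < Suc n" by simp_all
    show ?thesis
    proof
      fix f assume "f \<in> semi_periodic_funs a b (Suc (Suc n))"
      then show "f \<in> semi_periodic_funs a b (Suc n)"
        using Suc by (subst semi_periodic_funs_Suc[OF n(1)], subst (asm) semi_periodic_funs_Suc[OF n(2)]) blast
    qed
  qed
qed

lemma absolutely_continuous_fun_subinterval:
  assumes "absolutely_continuous_fun a b f" "a \<le> c" "d \<le> b"
  shows "absolutely_continuous_fun c d f"
proof (rule absolutely_continuous_funI)
  fix e :: real assume "e > 0"
  then obtain \<delta> where \<delta>: "\<delta> > 0" and *: "\<And>I. \<lbrakk>finite I;
      \<And>u v. (u, v) \<in> I \<Longrightarrow> a \<le> u \<and> u \<le> v \<and> v \<le> b;
      disjoint_family_on (\<lambda>(u, v). {u<..<v}) I; (\<Sum>(u, v)\<in>I. v - u) < \<delta>\<rbrakk>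
      \<Longrightarrow> (\<Sum>(u, v)\<in>I. norm (f v - f u)) < e"
    using absolutely_continuous_funD[OF assms(1)] by blast
  show "\<exists>\<delta>>0. \<forall>I. finite I \<longrightarrow> (\<forall>(u, v)\<in>I. c \<le> u \<and> u \<le> v \<and> v \<le> d) \<longrightarrow>
        disjoint_family_on (\<lambda>(u, v). {u<..<v}) I \<longrightarrow> (\<Sum>(u, v)\<in>I. v - u) < \<delta> \<longrightarrow>
        (\<Sum>(u, v)\<in>I. norm (f v - f u)) < e"
    using \<delta> assms(2,3) by (intro exI[of _ \<delta>] conjI allI impI *) fastforce+
qed

lemma has_integral_deriv1:
  assumes f: "f \<in> semi_periodic_funs a b (Suc n)" and x: "x \<in> {a..b}"
  shows "(deriv1 a b f has_integral (f x - f a)) {a..x}"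
proof (cases "a = x")
  case True
  then show ?thesis using has_integral_refl(2) by simp
next
  case False
  then have ax: "a < x" using x by simp
  have f1: "f \<in> semi_periodic_funs a b (Suc 0)" using f semi_periodic_funs_Suc_subset_1 by blast
  then obtain N where N: "negligible N" "\<forall>x\<in>{a..b} - N. f differentiable (at x within {a..b})"
    unfolding semi_periodic_funs_1 AE_interval_iff_negligible by blast
  show ?thesis
  proof (rule has_integral_derivative_absolutely_continuous[OF ax _ N(1)])
    show "absolutely_continuous_fun a x f"
      using f1 x unfolding semi_periodic_funs_1
      by (auto intro: absolutely_continuous_fun_subinterval)
    fix y assume "y \<in> {a..x} - N"
    then show "(f has_vector_derivative deriv1 a b f y) (at y within {a..x})"
      using N(2) x has_vector_derivative_within_subset[OF has_vector_derivative_deriv_on, of f y a b "{a..x}"]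
      by auto
  qed
qed

section \<open>Semi-periodic primitives\<close>

text \<open>The primitive of \<open>g\<close> whose end values are opposite.\<close>

definition antideriv :: "real \<Rightarrow> real \<Rightarrow> (real \<Rightarrow> complex) \<Rightarrow> real \<Rightarrow> complex" where
  "antideriv a b g x = integral {a..x} g - integral {a..b} g / 2"

text \<open>Equality holds at every point, which lets the primitive descend to classes.\<close>

lemma antideriv_cong_AE:
  assumes eq: "AE x in lebesgue_on {a..b}. f x = g x" and x: "x \<in> {a..b}"
  shows "antideriv a b f x = antideriv a b g x"
proof -
  obtain N where N: "negligible N" "\<forall>x\<in>{a..b} - N. f x = g x"
    using eq unfolding AE_interval_iff_negligible by blast
  have "integral {a..y} f = integral {a..y} g" if "y \<in> {a..b}" for y
    by (rule integral_spike[OF N(1)]) (use N(2) that in auto)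
  then show ?thesis using x by (simp add: antideriv_def)
qed

lemma antideriv_cong:
  "\<lbrakk>\<And>x. x \<in> {a..b} \<Longrightarrow> f x = g x; x \<in> {a..b}\<rbrakk> \<Longrightarrow> antideriv a b f x = antideriv a b g x"
  by (rule antideriv_cong_AE) (auto intro: AE_I2)

lemma antideriv_ends: "a \<le> b \<Longrightarrow> antideriv a b g a = - antideriv a b g b"
  by (simp add: antideriv_def)

text \<open>The total integral of the derivative is \<open>f b - f a = - 2 * f a\<close>, which
  determines the constant of integration.\<close>

lemma semi_periodic_eq_antideriv:
  assumes "a \<le> b" "f \<in> semi_periodic_funs a b (Suc n)" "x \<in> {a..b}"
  shows "f x = antideriv a b (deriv1 a b f) x"
proof -
  have "integral {a..y} (deriv1 a b f) = f y - f a" if "y \<in> {a..b}" for y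
    using has_integral_deriv1[OF assms(2) that] by (rule integral_unique)
  moreover have "f a = - f b"
    using subsetD[OF semi_periodic_funs_Suc_subset_1 assms(2)] unfolding semi_periodic_funs_1 by blast
  ultimately show ?thesis using assms(1,3) by (simp add: antideriv_def)
qed

lemma square_integrable_integrable_on:
  assumes "square_integrable a b g"
  shows "g integrable_on {a..b}" "(\<lambda>x. (norm (g x))\<^sup>2) integrable_on {a..b}"
  using assms square_integrable_imp_integrable[OF assms]
  by (auto simp: square_integrable_def intro!: integrable_on_lebesgue_on)

lemma antideriv_has_vector_derivative:
  assumes "square_integrable a b g"
  obtains N where "negligible N"
    "\<And>x. x \<in> {a..b} - N \<Longrightarrow> (antideriv a b g has_vector_derivative g x) (at x within {a..b})"
proof -
  obtain N where N: "negligible N"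
    "\<And>x. x \<in> {a..b} - N \<Longrightarrow> ((\<lambda>x. integral {a..x} g) has_vector_derivative g x) (at x within {a..b})"
    using Lebesgue_differentiation_interval[OF square_integrable_integrable_on(1)[OF assms]]
    by blast
  show thesis
    by (rule that[OF N(1)], unfold antideriv_def[abs_def])
      (auto intro!: derivative_eq_intros N(2))
qed

lemma absolutely_continuous_antideriv:
  "square_integrable a b g \<Longrightarrow> absolutely_continuous_fun a b (antideriv a b g)"
  using absolutely_continuous_fun_indefinite_integral[of g a b "- integral {a..b} g / 2"]
    square_integrable_integrable_on[of a b g]
  by (simp add: antideriv_def[abs_def] algebra_simps)

lemma antideriv_semi_periodic_1:
  assumes ab: "a < b" and g: "square_integrable a b g"
  shows "antideriv a b g \<in> semi_periodic_funs a b (Suc 0)"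
    and "AE x in lebesgue_on {a..b}. deriv1 a b (antideriv a b g) x = g x"
proof -
  obtain N where N: "negligible N"
    "\<And>x. x \<in> {a..b} - N \<Longrightarrow> (antideriv a b g has_vector_derivative g x) (at x within {a..b})"
    using antideriv_has_vector_derivative[OF g] by blast
  then have "\<forall>x\<in>{a..b} - N. deriv1 a b (antideriv a b g) x = g x"
    using deriv1_eq[OF ab] by auto
  then show eq: "AE x in lebesgue_on {a..b}. deriv1 a b (antideriv a b g) x = g x"
    unfolding AE_interval_iff_negligible using N(1) by blast
  have "AE x in lebesgue_on {a..b}. g x = deriv1 a b (antideriv a b g) x"
    using eq by (auto elim: eventually_mono)
  moreover have "AE x in lebesgue_on {a..b}. antideriv a b g differentiable (at x within {a..b})"
    unfolding AE_interval_iff_negligible using N differentiableI_vector by blast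
  ultimately show "antideriv a b g \<in> semi_periodic_funs a b (Suc 0)"
    unfolding semi_periodic_funs_1
    using ab absolutely_continuous_antideriv[OF g] antideriv_ends[of a b g] square_integrable_cong_AE[OF g]
    by auto
qed

lemma antideriv_has_vector_derivative_continuous:
  assumes ab: "a < b" and g: "continuous_on {a..b} g" and x: "x \<in> {a..b}"
  shows "(antideriv a b g has_vector_derivative g x) (at x within {a..b})"
  unfolding antideriv_def[abs_def]
  by (auto intro!: derivative_eq_intros integral_has_vector_derivative g x)

text \<open>For square integrable \<open>g\<close> the derivative is recovered almost everywhere
  only; once \<open>g\<close> is continuous it is recovered at every point, as the higher levels
  demand.\<close>

lemma antideriv_semi_periodic:
  assumes ab: "a < b" and g: "g \<in> semi_periodic_funs a b n"
  shows "antideriv a b g \<in> semi_periodic_funs a b (Suc n)"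
proof (cases "n = 0")
  case True
  then show ?thesis
    using antideriv_semi_periodic_1(1)[OF ab] g by (simp add: semi_periodic_funs_0)
next
  case False
  then have n: "0 < n" by simp
  have g2: "square_integrable a b g"
    using g by (rule semi_periodic_funs_square_integrable)
  have d: "(antideriv a b g has_vector_derivative g x) (at x within {a..b})" if "x \<in> {a..b}" for x
    using antideriv_has_vector_derivative_continuous[OF ab semi_periodic_funs_imp_continuous_on[OF g n] that] .
  have "deriv1 a b (antideriv a b g) \<in> semi_periodic_funs a b n"
    by (rule semi_periodic_funs_cong[OF less_imp_le[OF ab] g]) (metis deriv1_eq[OF ab _ d])
  then show ?thesis
    unfolding semi_periodic_funs_Suc[OF n]
    using absolutely_continuous_antideriv[OF g2] antideriv_ends[OF less_imp_le[OF ab]] differentiableI_vector[OF d]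
    by blast
qed

lemma antideriv_add:
  assumes f: "f integrable_on {a..b}" and g: "g integrable_on {a..b}" and x: "x \<in> {a..b}"
  shows "antideriv a b (\<lambda>x. f x + g x) x = antideriv a b f x + antideriv a b g x"
proof -
  have "integral {a..y} (\<lambda>x. f x + g x) = integral {a..y} f + integral {a..y} g" if "y \<in> {a..b}" for y
    using that by (intro Henstock_Kurzweil_Integration.integral_add)
      (auto intro: integrable_subinterval_real[OF f] integrable_subinterval_real[OF g])
  then show ?thesis using x by (simp add: antideriv_def field_simps)
qed

lemma antideriv_scale: "antideriv a b (\<lambda>x. c * g x) x = c * antideriv a b g x"
  by (simp add: antideriv_def Henstock_Kurzweil_Integration.integral_mult_right right_diff_distrib)

lift_definition class_antideriv :: "real \<Rightarrow> real \<Rightarrow> aefun \<Rightarrow> aefun" is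
  "\<lambda>a b g x. if x \<in> {a..b} then antideriv a b g x else 0"
proof -
  fix a b :: real and g h :: "real \<Rightarrow> complex" assume "ae_eq g h"
  then have "AE x in lebesgue_on {a..b}. g x = h x"
    unfolding ae_eq_def AE_lebesgue_on_interval_iff by (auto elim: eventually_mono)
  then show "ae_eq (\<lambda>x. if x \<in> {a..b} then antideriv a b g x else 0)
      (\<lambda>x. if x \<in> {a..b} then antideriv a b h x else 0)"
    unfolding ae_eq_def by (intro always_eventually allI) (simp add: antideriv_cong_AE)
qed

lemma class_antideriv_ae_class:
  "class_antideriv a b (ae_class a b g) = ae_class a b (antideriv a b g)"
  unfolding ae_class_def class_antideriv.abs_eq
  by (rule arg_cong[of _ _ abs_aefun]) (auto intro!: ext antideriv_cong)

lemma class_antideriv_deriv1: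
  assumes "a < b" "f \<in> semi_periodic_funs a b (Suc n)"
  shows "class_antideriv a b (ae_class a b (deriv1 a b f)) = ae_class a b f"
  unfolding class_antideriv_ae_class
  by (rule ae_class_cong) (metis semi_periodic_eq_antideriv assms less_imp_le)

lemma vecs_L2_E:
  assumes "u \<in> vecs (L2 a b)"
  obtains f where "square_integrable a b f" "u = ae_class a b f"
  using assms by (auto simp: vecs_L2)

lemma square_integrable_mult_continuous:
  assumes h: "continuous_on {a..b} h" and g: "square_integrable a b g"
  shows "square_integrable a b (\<lambda>x. h x * g x)"
proof -
  have "bounded (h ` {a..b})"
    by (intro compact_imp_bounded compact_continuous_image h) simp
  then obtain M where M: "\<And>x. x \<in> {a..b} \<Longrightarrow> norm (h x) \<le> M"
    unfolding bounded_iff by blast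
  have hm: "h \<in> borel_measurable (lebesgue_on {a..b})"
    using h by (intro continuous_imp_measurable_on_sets_lebesgue) auto
  have gm: "g \<in> borel_measurable (lebesgue_on {a..b})"
    and gi: "integrable (lebesgue_on {a..b}) (\<lambda>x. (norm (g x))\<^sup>2)"
    using g by (auto simp: square_integrable_def)
  have meas: "(\<lambda>x. h x * g x) \<in> borel_measurable (lebesgue_on {a..b})"
    using hm gm by (rule borel_measurable_times)
  have "integrable (lebesgue_on {a..b}) (\<lambda>x. (norm (h x * g x))\<^sup>2)"
  proof (rule Bochner_Integration.integrable_bound)
    show "integrable (lebesgue_on {a..b}) (\<lambda>x. M\<^sup>2 * (norm (g x))\<^sup>2)"
      by (rule integrable_mult_right) (use gi in auto)
    have "(norm (h x * g x))\<^sup>2 \<le> M\<^sup>2 * (norm (g x))\<^sup>2" if "x \<in> {a..b}" for x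
      unfolding norm_mult power_mult_distrib
      using M[OF that] by (intro mult_right_mono power_mono) auto
    then show "AE x in lebesgue_on {a..b}. norm ((norm (h x * g x))\<^sup>2) \<le> norm (M\<^sup>2 * (norm (g x))\<^sup>2)"
      by (intro AE_I2) (simp add: space_restrict_space)
  qed (use meas in simp)
  then show ?thesis using meas by (simp add: square_integrable_def)
qed

section \<open>Exponentials and the first-order equation\<close>

lemma has_vector_derivative_cexp:
  fixes \<sigma> :: complex
  shows "((\<lambda>x. exp (\<sigma> * of_real (x - a))) has_vector_derivative \<sigma> * exp (\<sigma> * of_real (x - a))) (at x within S)"
proof -
  have "((\<lambda>z. exp (\<sigma> * (z - of_real a))) has_field_derivative \<sigma> * exp (\<sigma> * (of_real x - of_real a)))
      (at (of_real x))"
    by (auto intro!: derivative_eq_intros)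
  from has_vector_derivative_real_field[OF this, of S] show ?thesis by simp
qed

lemma continuous_on_cexp:
  fixes \<sigma> :: complex
  shows "continuous_on S (\<lambda>x. exp (\<sigma> * of_real (x - a)))"
  by (intro continuous_intros)

text \<open>The exponential is the integral of its own derivative; the summand 1 is its value at
  \<open>a\<close>.\<close>

lemma absolutely_continuous_cexp:
  "absolutely_continuous_fun a b (\<lambda>x. exp (\<sigma> * of_real (x - a)))"
proof (rule absolutely_continuous_fun_cong)
  let ?E = "\<lambda>x. exp (\<sigma> * of_real (x - a))"
  have c: "continuous_on {a..b} (\<lambda>x. \<sigma> * ?E x)"
    by (intro continuous_intros)
  show "absolutely_continuous_fun a b (\<lambda>x. 1 + integral {a..x} (\<lambda>x. \<sigma> * ?E x))"
    using square_integrable_integrable_on[OF square_integrable_continuous[OF c]]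
    by (intro absolutely_continuous_fun_indefinite_integral)
  fix x assume "x \<in> {a..b}"
  then have "((\<lambda>x. \<sigma> * ?E x) has_integral (?E x - ?E a)) {a..x}"
    by (intro fundamental_theorem_of_calculus has_vector_derivative_cexp) auto
  then have "integral {a..x} (\<lambda>x. \<sigma> * ?E x) = ?E x - ?E a"
    by (rule integral_unique)
  moreover have "?E a = 1" by simp
  ultimately show "1 + integral {a..x} (\<lambda>x. \<sigma> * ?E x) = ?E x"
    by (metis add.commute diff_add_cancel)
qed

text \<open>Variation of constants; the free constant is fixed by the boundary condition.\<close>

lemma semi_periodic_ode_solution:
  fixes \<sigma> :: complex
  assumes ab: "a < b" and nz: "exp (\<sigma> * of_real (b - a)) \<noteq> - 1"
  shows "\<exists>C. \<forall>g. square_integrable a b g \<longrightarrow>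
    (\<exists>f\<in>semi_periodic_funs a b (Suc 0).
      (AE x in lebesgue_on {a..b}. deriv1 a b f x = \<sigma> * f x + g x) \<and>
      (\<forall>x\<in>{a..b}. norm (f x) \<le> C * integral {a..b} (\<lambda>x. norm (g x))))"
proof -
  define E where "E x = exp (\<sigma> * of_real (x - a))" for x
  define E' where "E' x = exp (- \<sigma> * of_real (x - a))" for x
  have EE': "E x * E' x = 1" for x by (simp add: E_def E'_def exp_add[symmetric])
  have Eb: "1 + E b \<noteq> 0" using nz by (simp add: E_def add_eq_0_iff)
  define m where "m = exp (norm \<sigma> * (b - a))"
  have m: "m > 0" by (simp add: m_def)
  have Em: "norm (E x) \<le> m" "norm (E' x) \<le> m" if "x \<in> {a..b}" for x
  proof -
    have "norm \<sigma> * (x - a) \<le> norm \<sigma> * (b - a)"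
      using that by (intro mult_left_mono) auto
    moreover have "norm (E x) \<le> exp (norm \<sigma> * (x - a))" "norm (E' x) \<le> exp (norm \<sigma> * (x - a))"
      using norm_exp[of "\<sigma> * of_real (x - a)"] norm_exp[of "- \<sigma> * of_real (x - a)"] that
      by (simp_all add: E_def E'_def norm_mult del: of_real_diff)
    ultimately show "norm (E x) \<le> m" "norm (E' x) \<le> m"
      unfolding m_def using exp_le_cancel_iff order_trans by blast+
  qed
  \<comment> \<open>Collects three estimates: \<open>m\<close> bounds both exponentials,
    \<open>m\<close> times the integral of \<open>norm (g x)\<close> bounds \<open>G\<close>, and
    \<open>m * m / norm (1 + E b)\<close> times that integral bounds the free constant.\<close>
  define C where "C = m * (m * m / norm (1 + E b) + m)"
  have "\<exists>f\<in>semi_periodic_funs a b (Suc 0).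
      (AE x in lebesgue_on {a..b}. deriv1 a b f x = \<sigma> * f x + g x) \<and>
      (\<forall>x\<in>{a..b}. norm (f x) \<le> C * integral {a..b} (\<lambda>x. norm (g x)))"
    if g: "square_integrable a b g" for g
  proof -
    define w where "w x = E' x * g x" for x
    have "continuous_on {a..b} E'" unfolding E'_def by (rule continuous_on_cexp)
    then have w: "square_integrable a b w"
      unfolding w_def[abs_def] by (rule square_integrable_mult_continuous[OF _ g])
    note wi = square_integrable_integrable_on[OF w]
    define G where "G x = integral {a..x} w" for x
    \<comment> \<open>The solution of \<open>c + E b * (c + G b) = 0\<close>, which is the boundary
      condition; \<open>1 + E b\<close> is nonzero by hypothesis.\<close>
    define c where "c = - E b * G b / (1 + E b)"
    define f where "f x = E x * (c + G x)" for x
    have Ea: "E a = 1" "G a = 0" by (simp_all add: E_def G_def)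
    have "c * (1 + E b) = - E b * G b" using Eb by (simp add: c_def)
    then have "c = - (E b * (c + G b))" by algebra
    then have ends: "f a = - f b" by (simp add: f_def Ea)
    have ac: "absolutely_continuous_fun a b f"
      unfolding f_def[abs_def] E_def G_def
      by (intro absolutely_continuous_fun_mult absolutely_continuous_cexp
          absolutely_continuous_fun_indefinite_integral wi)
    obtain N where N: "negligible N"
      "\<And>x. x \<in> {a..b} - N \<Longrightarrow> (G has_vector_derivative w x) (at x within {a..b})"
      using Lebesgue_differentiation_interval[OF wi(1)] unfolding G_def by blast
    have fd: "(f has_vector_derivative \<sigma> * f x + g x) (at x within {a..b})" if x: "x \<in> {a..b} - N" for x
    proof -
      have "(f has_vector_derivative E x * w x + (\<sigma> * E x) * (c + G x)) (at x within {a..b})"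
        unfolding f_def[abs_def]
        using has_vector_derivative_cexp[of \<sigma> a x "{a..b}"] N(2)[OF x]
        by (intro has_vector_derivative_mult has_vector_derivative_add_const[THEN iffD2])
          (auto simp: E_def[abs_def] intro!: derivative_eq_intros)
      moreover have "E x * w x = g x"
        using EE'[of x] by (simp add: w_def mult.assoc[symmetric])
      ultimately show ?thesis by (simp add: f_def algebra_simps)
    qed
    have eq: "AE x in lebesgue_on {a..b}. deriv1 a b f x = \<sigma> * f x + g x"
      unfolding AE_interval_iff_negligible using N(1) fd deriv1_eq[OF ab] by blast
    have "square_integrable a b (\<lambda>x. \<sigma> * f x + g x)"
      by (intro square_integrable_add square_integrable_scale g square_integrable_continuous
          absolutely_continuous_fun_imp_continuous_on ac)
    then have "square_integrable a b (deriv1 a b f)"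
      by (rule square_integrable_cong_AE) (use eq in \<open>auto elim: eventually_mono\<close>)
    moreover have "AE x in lebesgue_on {a..b}. f differentiable (at x within {a..b})"
      unfolding AE_interval_iff_negligible using N(1) fd differentiableI_vector by blast
    ultimately have f: "f \<in> semi_periodic_funs a b (Suc 0)"
      unfolding semi_periodic_funs_1 using ac ends by blast
    define J where "J = integral {a..b} (\<lambda>x. norm (g x))"
    have gi: "(\<lambda>x. norm (g x)) integrable_on {a..b}"
      using square_integrable_imp_integrable[OF g] by (intro integrable_on_lebesgue_on integrable_norm) auto
    have J: "0 \<le> J" unfolding J_def by (rule integral_nonneg[OF gi]) simp
    have G: "norm (G x) \<le> m * J" if x: "x \<in> {a..b}" for x
    proof -
      have gx: "(\<lambda>x. norm (g x)) integrable_on {a..x}"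
        using x by (intro integrable_subinterval_real[OF gi]) auto
      have "norm (G x) \<le> integral {a..x} (\<lambda>x. m * norm (g x))"
        unfolding G_def
      proof (intro Henstock_Kurzweil_Integration.integral_norm_bound_integral)
        show "w integrable_on {a..x}" using x by (intro integrable_subinterval_real[OF wi(1)]) auto
        show "(\<lambda>x. m * norm (g x)) integrable_on {a..x}" by (rule integrable_on_mult_right[OF gx])
        show "norm (w y) \<le> m * norm (g y)" if "y \<in> {a..x}" for y
          using Em(2)[of y] that x by (simp add: w_def norm_mult mult_right_mono)
      qed
      also have "\<dots> = m * integral {a..x} (\<lambda>x. norm (g x))" by simp
      also have "\<dots> \<le> m * J"
        unfolding J_def using x m gi gx by (intro mult_left_mono integral_subset_le) auto
      finally show ?thesis .
    qed
    have "norm c = norm (E b) * norm (G b) / norm (1 + E b)"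
      by (simp add: c_def norm_mult norm_divide)
    also have "\<dots> \<le> m * (m * J) / norm (1 + E b)"
      using Em(1)[of b] G[of b] ab m J by (intro divide_right_mono mult_mono) auto
    finally have c: "norm c \<le> m * (m * J) / norm (1 + E b)" .
    have "norm (f x) \<le> C * J" if x: "x \<in> {a..b}" for x
    proof -
      have "norm (f x) \<le> m * (m * (m * J) / norm (1 + E b) + m * J)"
        unfolding f_def norm_mult
        using Em(1)[OF x] G[OF x] c m by (intro mult_mono order_trans[OF norm_triangle_ineq] add_mono) auto
      also have "\<dots> = C * J" by (simp add: C_def algebra_simps)
      finally show ?thesis .
    qed
    then show ?thesis using f eq unfolding J_def by blast
  qed
  then show ?thesis by blast
qed

text \<open>An eigenvector is represented by a primitive, hence by a continuous function, hence by a
  differentiable solution of \<open>f' = \<tau> f\<close>. The boundary condition leaves the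
  alternative that \<open>c\<close> vanishes or \<open>\<tau>\<close> lies in the spectrum; this
  serves both the eigenspaces and injectivity.\<close>

lemma class_antideriv_eigenvector:
  assumes ab: "a < b" and u: "u \<in> vecs (L2 a b)" and eig: "u = class_antideriv a b (\<tau> *\<^sub>C u)"
  obtains c where "u = ae_class a b (\<lambda>x. c * exp (\<tau> * of_real (x - a)))"
    "c * (1 + exp (\<tau> * of_real (b - a))) = 0"
proof -
  obtain g where g: "square_integrable a b g" "u = ae_class a b g"
    using u by (rule vecs_L2_E)
  define f where "f = antideriv a b (\<lambda>x. \<tau> * g x)"
  have uf: "u = ae_class a b f"
    using eig unfolding g(2) ae_class_scale class_antideriv_ae_class f_def .
  have f1: "f \<in> semi_periodic_funs a b (Suc 0)"
    unfolding f_def by (intro antideriv_semi_periodic_1 ab square_integrable_scale g)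
  then have cf: "continuous_on {a..b} f" by (rule semi_periodic_funs_imp_continuous_on) simp
  have "AE x in lebesgue_on {a..b}. g x = f x"
    using uf g(2) ae_class_eq_iff by metis
  then have "AE x in lebesgue_on {a..b}. \<tau> * g x = \<tau> * f x"
    by (auto elim: eventually_mono)
  then have f_eq: "antideriv a b (\<lambda>x. \<tau> * f x) x = f x" if "x \<in> {a..b}" for x
    unfolding f_def using antideriv_cong_AE that by metis
  have df: "(f has_vector_derivative \<tau> * f x) (at x within {a..b})" if x: "x \<in> {a..b}" for x
  proof (subst has_vector_derivative_within_cong[of _ f "antideriv a b (\<lambda>x. \<tau> * f x)"])
    show "(antideriv a b (\<lambda>x. \<tau> * f x) has_vector_derivative \<tau> * f x) (at x within {a..b})"
      by (intro antideriv_has_vector_derivative_continuous ab x continuous_intros cf)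
  qed (use f_eq x in auto)
  \<comment> \<open>Multiplication by the integrating factor makes the equation say that the
    derivative vanishes.\<close>
  define q where "q x = exp (- \<tau> * of_real (x - a)) * f x" for x
  have "(q has_vector_derivative 0) (at x within {a..b})" if x: "x \<in> {a..b}" for x
  proof -
    have "(q has_vector_derivative exp (- \<tau> * of_real (x - a)) * (\<tau> * f x) +
        (- \<tau> * exp (- \<tau> * of_real (x - a))) * f x) (at x within {a..b})"
      unfolding q_def[abs_def]
      by (intro has_vector_derivative_mult has_vector_derivative_cexp df x)
    then show ?thesis by (simp add: algebra_simps)
  qed
  then obtain c where c: "\<And>x. x \<in> {a..b} \<Longrightarrow> q x = c"
    using has_vector_derivative_zero_constant[of "{a..b}" q] by (metis convex_real_interval(5))
  have fx: "f x = c * exp (\<tau> * of_real (x - a))" if x: "x \<in> {a..b}" for x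
  proof -
    have "f x = (exp (\<tau> * of_real (x - a)) * exp (- \<tau> * of_real (x - a))) * f x"
      by (simp add: exp_add[symmetric])
    also have "\<dots> = exp (\<tau> * of_real (x - a)) * q x" by (simp add: q_def mult.assoc)
    finally show ?thesis using c[OF x] by (simp add: mult.commute)
  qed
  have "f a = - f b" using f1 unfolding semi_periodic_funs_1 by blast
  then have "c = - (c * exp (\<tau> * of_real (b - a)))"
    using fx[of a] fx[of b] ab by simp
  then have "c * (1 + exp (\<tau> * of_real (b - a))) = 0"
    by algebra
  moreover have "u = ae_class a b (\<lambda>x. c * exp (\<tau> * of_real (x - a)))"
    unfolding uf by (rule ae_class_cong[OF fx])
  ultimately show thesis using that by blast
qed

section \<open>The semi-periodic derivative\<close>

lemma norm_ae_class_le: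
  assumes f: "square_integrable a b f" and B: "\<And>x. x \<in> {a..b} \<Longrightarrow> norm (f x) \<le> B" and "0 \<le> B"
  shows "ip_norm (L2 a b) (ae_class a b f) \<le>
    B * sqrt (measure (lebesgue_on {a..b}) (space (lebesgue_on {a..b})))"
proof -
  interpret finite_measure "lebesgue_on {a..b}" by (rule finite_measure_lebesgue_on_interval)
  have "(LINT x|lebesgue_on {a..b}. (norm (f x))\<^sup>2) \<le> (LINT x|lebesgue_on {a..b}. B\<^sup>2)"
    using f B by (intro integral_mono) (auto simp: square_integrable_def space_restrict_space intro!: power_mono)
  also have "\<dots> = B\<^sup>2 * measure (lebesgue_on {a..b}) (space (lebesgue_on {a..b}))"
    by simp
  finally have "sqrt (LINT x|lebesgue_on {a..b}. (norm (f x))\<^sup>2) \<le>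
      sqrt (B\<^sup>2 * measure (lebesgue_on {a..b}) (space (lebesgue_on {a..b})))"
    by (rule real_sqrt_le_mono)
  then show ?thesis
    using \<open>0 \<le> B\<close> by (simp add: norm_L2 real_sqrt_mult)
qed

text \<open>Cauchy-Schwarz against the constant function 1. With \<open>norm_ae_class_le\<close> it
  turns the pointwise bound for the differential equation into a bound between norms of
  \<open>L2 a b\<close>.\<close>

lemma integral_norm_le_norm_L2:
  assumes g: "square_integrable a b g"
  shows "integral {a..b} (\<lambda>x. norm (g x)) \<le>
    ip_norm (L2 a b) (ae_class a b g) * ip_norm (L2 a b) (ae_class a b (\<lambda>x. 1))"
proof -
  interpret inner_product "L2 a b" by (rule inner_productI[OF hilbert_space_L2])
  let ?n = "\<lambda>x. complex_of_real (norm (g x))"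
  have n: "square_integrable a b ?n"
    using g by (auto simp: square_integrable_def)
  have one: "square_integrable a b (\<lambda>x. 1)"
    by (intro square_integrable_continuous continuous_intros)
  have "integral {a..b} (\<lambda>x. norm (g x)) = (LINT x|lebesgue_on {a..b}. norm (g x))"
    using square_integrable_imp_integrable[OF g] by (intro lebesgue_integral_eq_integral[symmetric]) auto
  also have "\<dots> \<le> cmod (ip (L2 a b) (ae_class a b ?n) (ae_class a b (\<lambda>x. 1)))"
    by (simp add: ip_L2 L2_ip_ae_class)
  also have "\<dots> \<le> ip_norm (L2 a b) (ae_class a b ?n) * ip_norm (L2 a b) (ae_class a b (\<lambda>x. 1))"
    using n one by (intro Cauchy_Schwarz) (auto simp: vecs_L2)
  also have "ip_norm (L2 a b) (ae_class a b ?n) = ip_norm (L2 a b) (ae_class a b g)"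
    by (simp add: norm_L2)
  finally show ?thesis .
qed

text \<open>Integration by parts. Both primitives change sign from one end to the other, so their
  product with conjugation has equal end values and no boundary term remains.\<close>

lemma class_antideriv_skew:
  assumes ab: "a < b" and u: "u \<in> vecs (L2 a b)" and v: "v \<in> vecs (L2 a b)"
  shows "ip (L2 a b) (class_antideriv a b u) v = - ip (L2 a b) u (class_antideriv a b v)"
proof -
  obtain f where f: "square_integrable a b f" "u = ae_class a b f" using u by (rule vecs_L2_E)
  obtain g where g: "square_integrable a b g" "v = ae_class a b g" using v by (rule vecs_L2_E)
  let ?F = "antideriv a b f" and ?G = "antideriv a b g"
  let ?M = "lebesgue_on {a..b}"
  obtain N1 where N1: "negligible N1"
    "\<And>x. x \<in> {a..b} - N1 \<Longrightarrow> (?F has_vector_derivative f x) (at x within {a..b})"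
    using antideriv_has_vector_derivative[OF f(1)] by blast
  obtain N2 where N2: "negligible N2"
    "\<And>x. x \<in> {a..b} - N2 \<Longrightarrow> (?G has_vector_derivative g x) (at x within {a..b})"
    using antideriv_has_vector_derivative[OF g(1)] by blast
  have F: "square_integrable a b ?F" and G: "square_integrable a b ?G"
    using absolutely_continuous_antideriv f(1) g(1)
    by (auto intro!: square_integrable_continuous absolutely_continuous_fun_imp_continuous_on)
  have i: "integrable ?M (\<lambda>x. ?F x * cnj (g x))" "integrable ?M (\<lambda>x. f x * cnj (?G x))"
    using F G f(1) g(1) by (auto intro: integrable_mult_cnj)
  have I1: "((\<lambda>x. ?F x * cnj (g x) + f x * cnj (?G x)) has_integral
      (?F b * cnj (?G b) - ?F a * cnj (?G a))) {a..b}"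
  proof (rule has_integral_derivative_absolutely_continuous[OF ab])
    show "absolutely_continuous_fun a b (\<lambda>x. ?F x * cnj (?G x))"
      by (intro absolutely_continuous_fun_mult absolutely_continuous_fun_cnj
          absolutely_continuous_antideriv f g)
    show "negligible (N1 \<union> N2)" using N1 N2 by simp
    fix x assume "x \<in> {a..b} - (N1 \<union> N2)"
    then show "((\<lambda>x. ?F x * cnj (?G x)) has_vector_derivative ?F x * cnj (g x) + f x * cnj (?G x))
        (at x within {a..b})"
      by (intro has_vector_derivative_mult has_vector_derivative_cnj N1(2) N2(2)) auto
  qed
  have I0: "?F b * cnj (?G b) - ?F a * cnj (?G a) = 0"
    using ab by (simp add: antideriv_ends)
  have I2: "((\<lambda>x. ?F x * cnj (g x) + f x * cnj (?G x)) has_integral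
      (LINT x|?M. ?F x * cnj (g x) + f x * cnj (?G x))) {a..b}"
    using i by (intro has_integral_integral_lebesgue_on Bochner_Integration.integrable_add) auto
  have "(LINT x|?M. ?F x * cnj (g x) + f x * cnj (?G x)) = 0"
    using has_integral_unique[OF I2 I1] I0 by (rule trans)
  then have "(LINT x|?M. ?F x * cnj (g x)) + (LINT x|?M. f x * cnj (?G x)) = 0"
    using i by simp
  then show ?thesis
    by (simp add: f(2) g(2) class_antideriv_ae_class ip_L2 L2_ip_ae_class eq_neg_iff_add_eq_0)
qed

text \<open>Primitives are continuous, so equality almost everywhere is equality on the whole
  interval, and differentiating recovers both classes.\<close>

lemma inj_on_class_antideriv:
  assumes ab: "a < b"
  shows "inj_on (class_antideriv a b) (vecs (L2 a b))"
proof (rule inj_onI)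
  fix u v assume u: "u \<in> vecs (L2 a b)" and v: "v \<in> vecs (L2 a b)"
    and eq: "class_antideriv a b u = class_antideriv a b v"
  obtain f where f: "square_integrable a b f" "u = ae_class a b f" using u by (rule vecs_L2_E)
  obtain g where g: "square_integrable a b g" "v = ae_class a b g" using v by (rule vecs_L2_E)
  let ?F = "antideriv a b f" and ?G = "antideriv a b g"
  have "AE x in lebesgue_on {a..b}. ?F x = ?G x"
    using eq unfolding f(2) g(2) class_antideriv_ae_class ae_class_eq_iff .
  then have "?F x = ?G x" if "x \<in> {a..b}" for x
    using continuous_AE_eq_imp_eq[OF ab _ _ _ that] f(1) g(1)
      absolutely_continuous_fun_imp_continuous_on absolutely_continuous_antideriv by blast
  then have d: "deriv1 a b ?F x = deriv1 a b ?G x" if "x \<in> {a..b}" for x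
    using deriv1_cong that by blast
  have "u = ae_class a b (deriv1 a b ?F)" "v = ae_class a b (deriv1 a b ?G)"
    using antideriv_semi_periodic_1(2)[OF ab f(1)] antideriv_semi_periodic_1(2)[OF ab g(1)]
    unfolding f(2) g(2) ae_class_eq_iff by (auto elim: eventually_mono)
  moreover have "ae_class a b (deriv1 a b ?F) = ae_class a b (deriv1 a b ?G)"
    by (rule ae_class_cong[OF d])
  ultimately show "u = v" by simp
qed

text \<open>Meaningful on the range of \<open>class_antideriv\<close> only; elsewhere
  \<open>inv_into\<close> returns an arbitrary value.\<close>

definition class_deriv :: "real \<Rightarrow> real \<Rightarrow> aefun \<Rightarrow> aefun" where
  "class_deriv a b = inv_into (vecs (L2 a b)) (class_antideriv a b)"

text \<open>The exponents whose exponential has opposite values at the ends of the interval.\<close>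

definition semi_periodic_deriv_spectrum :: "real \<Rightarrow> real \<Rightarrow> complex set" where
  "semi_periodic_deriv_spectrum a b = {\<sigma>. exp (\<sigma> * of_real (b - a)) = - 1}"

text \<open>The vector sought is the derivative of the solution \<open>f\<close> of
  \<open>f' - \<sigma> f = g\<close>, since the primitive of that derivative is \<open>f\<close>
  itself.\<close>

lemma class_antideriv_surj:
  assumes ab: "a < b" and \<sigma>: "\<sigma> \<notin> semi_periodic_deriv_spectrum a b"
  shows "\<exists>C. \<forall>v\<in>vecs (L2 a b). \<exists>h\<in>vecs (L2 a b). h - \<sigma> *\<^sub>C class_antideriv a b h = v \<and>
    ip_norm (L2 a b) (class_antideriv a b h) \<le> C * ip_norm (L2 a b) v"
proof -
  interpret inner_product "L2 a b" by (rule inner_productI[OF hilbert_space_L2])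
  obtain C0 where C0: "\<And>g. square_integrable a b g \<Longrightarrow> \<exists>f\<in>semi_periodic_funs a b (Suc 0).
      (AE x in lebesgue_on {a..b}. deriv1 a b f x = \<sigma> * f x + g x) \<and>
      (\<forall>x\<in>{a..b}. norm (f x) \<le> C0 * integral {a..b} (\<lambda>x. norm (g x)))"
    using semi_periodic_ode_solution[OF ab, of \<sigma>] \<sigma> unfolding semi_periodic_deriv_spectrum_def by auto
  define L where "L = sqrt (measure (lebesgue_on {a..b}) (space (lebesgue_on {a..b})))"
  define N where "N = ip_norm (L2 a b) (ae_class a b (\<lambda>x. 1))"
  have L: "L \<ge> 0" by (simp add: L_def)
  have "\<exists>h\<in>vecs (L2 a b). h - \<sigma> *\<^sub>C class_antideriv a b h = v \<and>
      ip_norm (L2 a b) (class_antideriv a b h) \<le> (\<bar>C0\<bar> * N * L) * ip_norm (L2 a b) v"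
    if v: "v \<in> vecs (L2 a b)" for v
  proof -
    obtain g where g: "square_integrable a b g" "v = ae_class a b g" using v by (rule vecs_L2_E)
    obtain f where f: "f \<in> semi_periodic_funs a b (Suc 0)"
      and eq: "AE x in lebesgue_on {a..b}. deriv1 a b f x = \<sigma> * f x + g x"
      and bound: "\<forall>x\<in>{a..b}. norm (f x) \<le> C0 * integral {a..b} (\<lambda>x. norm (g x))"
      using C0[OF g(1)] by blast
    let ?J = "integral {a..b} (\<lambda>x. norm (g x))"
    have gi: "(\<lambda>x. norm (g x)) integrable_on {a..b}"
      using square_integrable_imp_integrable[OF g(1)] by (intro integrable_on_lebesgue_on integrable_norm) auto
    have J: "0 \<le> ?J" by (rule integral_nonneg[OF gi]) simp
    define h where "h = ae_class a b (deriv1 a b f)"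
    have hv: "h \<in> vecs (L2 a b)"
      using f unfolding h_def vecs_L2 semi_periodic_funs_1 by blast
    have Th: "class_antideriv a b h = ae_class a b f"
      unfolding h_def by (rule class_antideriv_deriv1[OF ab f])
    have "h - \<sigma> *\<^sub>C class_antideriv a b h = v"
      unfolding Th unfolding h_def g(2) ae_class_scale ae_class_diff ae_class_eq_iff
      using eq by eventually_elim simp
    moreover have "ip_norm (L2 a b) (ae_class a b f) \<le> (\<bar>C0\<bar> * ?J) * L"
      unfolding L_def
    proof (rule norm_ae_class_le)
      show "square_integrable a b f" by (rule semi_periodic_funs_square_integrable[OF f])
      show "norm (f x) \<le> \<bar>C0\<bar> * ?J" if "x \<in> {a..b}" for x
        using bound that J by (meson abs_ge_self mult_right_mono order_trans)
    qed (use J in simp)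
    moreover have "(\<bar>C0\<bar> * ?J) * L \<le> (\<bar>C0\<bar> * (ip_norm (L2 a b) v * N)) * L"
      using integral_norm_le_norm_L2[OF g(1)] L unfolding g(2) N_def
      by (intro mult_right_mono mult_left_mono) auto
    ultimately show ?thesis
      using hv Th by (intro bexI[of _ h]) (auto simp: mult_ac)
  qed
  then show ?thesis by blast
qed

lemma semi_periodic_cexp:
  assumes ab: "a < b" and \<tau>: "exp (\<tau> * of_real (b - a)) = - 1"
  shows "(\<lambda>x. exp (\<tau> * of_real (x - a))) \<in> semi_periodic_funs a b (Suc 0)"
    and "x \<in> {a..b} \<Longrightarrow> deriv1 a b (\<lambda>x. exp (\<tau> * of_real (x - a))) x = \<tau> * exp (\<tau> * of_real (x - a))"
proof -
  let ?E = "\<lambda>x. exp (\<tau> * of_real (x - a))"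
  show d: "deriv1 a b ?E x = \<tau> * ?E x" if "x \<in> {a..b}" for x
    by (rule deriv1_eq[OF ab that has_vector_derivative_cexp])
  have "square_integrable a b (\<lambda>x. \<tau> * ?E x)"
    by (intro square_integrable_scale square_integrable_continuous continuous_on_cexp)
  then have "square_integrable a b (deriv1 a b ?E)"
    by (rule square_integrable_cong) (rule d[symmetric])
  moreover have "AE x in lebesgue_on {a..b}. ?E differentiable (at x within {a..b})"
    using differentiableI_vector[OF has_vector_derivative_cexp] by (intro AE_I2)
  moreover have "?E a = - ?E b" using \<tau> by simp
  ultimately show "?E \<in> semi_periodic_funs a b (Suc 0)"
    unfolding semi_periodic_funs_1 using absolutely_continuous_cexp by blast
qed

theorem skew_inverse_class_antideriv:
  assumes ab: "a < b" and k: "0 < k"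
  shows "skew_inverse (L2 a b) (class_antideriv a b) (class_deriv a b) k (semi_periodic_deriv_spectrum a b)"
proof -
  let ?T = "class_antideriv a b" and ?V = "vecs (L2 a b)" and ?S = "semi_periodic_deriv_spectrum a b"
  interpret inner_product "L2 a b" by (rule inner_productI[OF hilbert_space_L2])
  have T_in: "?T x \<in> ?V" if x: "x \<in> ?V" for x
  proof -
    obtain g where g: "square_integrable a b g" "x = ae_class a b g" using x by (rule vecs_L2_E)
    then show ?thesis
      using semi_periodic_funs_square_integrable[OF antideriv_semi_periodic_1(1)[OF ab g(1)]]
      by (simp add: class_antideriv_ae_class vecs_L2)
  qed
  have T_add: "?T (x + y) = ?T x + ?T y" if x: "x \<in> ?V" and y: "y \<in> ?V" for x y
  proof -
    obtain f where f: "square_integrable a b f" "x = ae_class a b f" using x by (rule vecs_L2_E)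
    obtain g where g: "square_integrable a b g" "y = ae_class a b g" using y by (rule vecs_L2_E)
    show ?thesis
      unfolding f(2) g(2) ae_class_add class_antideriv_ae_class
      by (intro ae_class_cong antideriv_add square_integrable_integrable_on f g)
  qed
  have T_scale: "?T (c *\<^sub>C x) = c *\<^sub>C ?T x" if x: "x \<in> ?V" for c x
  proof -
    obtain f where f: "square_integrable a b f" "x = ae_class a b f" using x by (rule vecs_L2_E)
    show ?thesis
      unfolding f(2) ae_class_scale class_antideriv_ae_class by (intro ae_class_cong antideriv_scale)
  qed
  \<comment> \<open>Boundedness of the primitive is the resolvent estimate at 0, where the equation
    reads \<open>h = v\<close>.\<close>
  have zero: "0 \<notin> ?S" by (simp add: semi_periodic_deriv_spectrum_def)
  have T_bounded: "\<exists>C. \<forall>x\<in>?V. ip_norm (L2 a b) (?T x) \<le> C * ip_norm (L2 a b) x"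
    using class_antideriv_surj[OF ab zero] by fastforce
  have D_T: "class_deriv a b (?T x) = x" if "x \<in> ?V" for x
    unfolding class_deriv_def by (rule inv_into_f_f[OF inj_on_class_antideriv[OF ab] that])
  have eigenvector: "\<exists>u\<in>?V. u \<noteq> 0 \<and> u = ?T (\<tau> *\<^sub>C u)" if \<tau>: "\<tau> \<in> ?S" for \<tau>
  proof -
    let ?E = "\<lambda>x. exp (\<tau> * of_real (x - a))"
    have e: "exp (\<tau> * of_real (b - a)) = - 1"
      using \<tau> by (simp add: semi_periodic_deriv_spectrum_def)
    have "?T (\<tau> *\<^sub>C ae_class a b ?E) = ?T (ae_class a b (deriv1 a b ?E))"
      unfolding ae_class_scale
      by (rule arg_cong[of _ _ ?T], rule ae_class_cong) (rule semi_periodic_cexp(2)[OF ab e, symmetric])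
    also have "\<dots> = ae_class a b ?E"
      by (rule class_antideriv_deriv1[OF ab semi_periodic_cexp(1)[OF ab e]])
    finally have "ae_class a b ?E = ?T (\<tau> *\<^sub>C ae_class a b ?E)" ..
    moreover have "ae_class a b ?E \<noteq> 0"
    proof
      assume "ae_class a b ?E = 0"
      then have "AE x in lebesgue_on {a..b}. ?E x = 0"
        unfolding ae_class_zero[of a b, symmetric] ae_class_eq_iff .
      then have "?E a = 0"
        using ab by (intro continuous_AE_eq_imp_eq[OF ab continuous_on_cexp continuous_on_const]) auto
      then show False by simp
    qed
    moreover have "ae_class a b ?E \<in> ?V"
      using square_integrable_continuous[OF continuous_on_cexp] by (auto simp: vecs_L2)
    ultimately show ?thesis by blast
  qed
  have finite: "\<exists>B. finite B \<and> {u \<in> ?V. u = ?T (\<tau> *\<^sub>C u)} \<subseteq> complex_vector.span B" for \<tau>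
  proof -
    let ?e = "ae_class a b (\<lambda>x. exp (\<tau> * of_real (x - a)))"
    have "u \<in> complex_vector.span {?e}" if u: "u \<in> ?V" "u = ?T (\<tau> *\<^sub>C u)" for u
    proof -
      obtain c where "u = ae_class a b (\<lambda>x. c * exp (\<tau> * of_real (x - a)))"
        using class_antideriv_eigenvector[OF ab u] by blast
      then have "u = c *\<^sub>C ?e" by (simp add: ae_class_scale)
      then show ?thesis
        by (simp add: complex_vector.span_scale complex_vector.span_base)
    qed
    then show ?thesis by (intro exI[of _ "{?e}"]) auto
  qed
  have inj: "h = 0" if \<sigma>: "\<sigma> \<notin> ?S" and h: "h \<in> ?V" "h = \<sigma> *\<^sub>C ?T h" for \<sigma> h
  proof -
    obtain c where c: "h = ae_class a b (\<lambda>x. c * exp (\<sigma> * of_real (x - a)))"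
      "c * (1 + exp (\<sigma> * of_real (b - a))) = 0"
      using class_antideriv_eigenvector[OF ab h(1), of \<sigma>] h(2) T_scale[OF h(1)] by metis
    have "1 + exp (\<sigma> * of_real (b - a)) \<noteq> 0"
      using \<sigma> unfolding semi_periodic_deriv_spectrum_def mem_Collect_eq add_eq_0_iff by metis
    then have "c = 0" using c(2) mult_eq_0_iff by blast
    then show ?thesis using c(1) by (simp add: ae_class_zero)
  qed
  show ?thesis
    by (intro skew_inverse.intro hilbert_space_L2 T_in T_add T_scale T_bounded D_T
        class_antideriv_skew[OF ab] k eigenvector finite inj class_antideriv_surj[OF ab])
qed

section \<open>The semi-periodic left-definite operators\<close>

lemma binomial_weighted_sum_Suc:
  fixes A :: "nat \<Rightarrow> complex" and k :: real
  shows "(\<Sum>j=0..Suc n. of_nat (Suc n choose j) * of_real (k ^ (Suc n - j)) * A j) =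
    of_real k * (\<Sum>j=0..n. of_nat (n choose j) * of_real (k ^ (n - j)) * A j) +
    (\<Sum>j=0..n. of_nat (n choose j) * of_real (k ^ (n - j)) * A (Suc j))"
proof -
  have "of_real k * (\<Sum>j=0..n. of_nat (n choose j) * of_real (k ^ (n - j)) * A j) =
      (\<Sum>j=0..n. of_nat (n choose j) * of_real (k ^ (Suc n - j)) * A j)"
    unfolding sum_distrib_left by (intro sum.cong) (auto simp: Suc_diff_le)
  \<comment> \<open>The additional term is zero because \<open>n choose Suc n\<close> is; both sums
    can then be shifted alike and joined by Pascal's rule.\<close>
  also have "\<dots> = (\<Sum>j=0..Suc n. of_nat (n choose j) * of_real (k ^ (Suc n - j)) * A j)"
    by simp
  also have "\<dots> = of_real (k ^ Suc n) * A 0 +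
      (\<Sum>j=0..n. of_nat (n choose Suc j) * of_real (k ^ (n - j)) * A (Suc j))"
    unfolding sum.atLeast0_atMost_Suc_shift by simp
  finally have "of_real k * (\<Sum>j=0..n. of_nat (n choose j) * of_real (k ^ (n - j)) * A j) =
      of_real (k ^ Suc n) * A 0 +
      (\<Sum>j=0..n. of_nat (n choose Suc j) * of_real (k ^ (n - j)) * A (Suc j))" .
  then show ?thesis
    unfolding sum.atLeast0_atMost_Suc_shift[of "\<lambda>j. of_nat (Suc n choose j) * of_real (k ^ (Suc n - j)) * A j"]
    by (simp add: distrib_right sum.distrib)
qed

lemma semi_periodic_ip_Suc:
  "semi_periodic_ip a b k (Suc n) f g =
    of_real k * semi_periodic_ip a b k n f g + semi_periodic_ip a b k n (deriv1 a b f) (deriv1 a b g)"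
  unfolding semi_periodic_ip_def binomial_weighted_sum_Suc deriv_on_Suc ..

lemma class_deriv_ae_class:
  assumes ab: "a < b" and f: "f \<in> semi_periodic_funs a b (Suc n)"
  shows "class_deriv a b (ae_class a b f) = ae_class a b (deriv1 a b f)"
proof -
  have "ae_class a b (deriv1 a b f) \<in> vecs (L2 a b)"
    using semi_periodic_funs_square_integrable[OF deriv1_semi_periodic[OF f]] by (simp add: vecs_L2)
  then show ?thesis
    unfolding class_deriv_def class_antideriv_deriv1[OF ab f, symmetric]
    by (rule inv_into_f_f[OF inj_on_class_antideriv[OF ab]])
qed

lemma ae_class_semi_periodic_Suc:
  assumes ab: "a < b"
  shows "ae_class a b ` semi_periodic_funs a b (Suc n) =
    class_antideriv a b ` ae_class a b ` semi_periodic_funs a b n"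
proof
  show "ae_class a b ` semi_periodic_funs a b (Suc n) \<subseteq>
      class_antideriv a b ` ae_class a b ` semi_periodic_funs a b n"
  proof (rule image_subsetI)
    fix f assume f: "f \<in> semi_periodic_funs a b (Suc n)"
    show "ae_class a b f \<in> class_antideriv a b ` ae_class a b ` semi_periodic_funs a b n"
      unfolding class_antideriv_deriv1[OF ab f, symmetric]
      by (intro imageI deriv1_semi_periodic f)
  qed
  show "class_antideriv a b ` ae_class a b ` semi_periodic_funs a b n \<subseteq>
      ae_class a b ` semi_periodic_funs a b (Suc n)"
    using antideriv_semi_periodic[OF ab] by (auto simp: class_antideriv_ae_class)
qed

text \<open>The abstract parameter \<open>h\<close> is the class of the second derivative. Level 0
  yields \<open>A\<close> itself, level \<open>n\<close> yields the operator with two further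
  derivatives in its domain.\<close>

lemma opA_eq_semi_periodic_operator_on:
  assumes ab: "a < b" and M: "skew_inverse M (class_antideriv a b) (class_deriv a b) k S"
    and V: "vecs M = ae_class a b ` semi_periodic_funs a b n"
  shows "skew_inverse.opA M (class_antideriv a b) k =
    semi_periodic_operator_on a b k (semi_periodic_funs a b (n + 2))"
proof -
  interpret M: skew_inverse M "class_antideriv a b" "class_deriv a b" k S by (rule M)
  let ?T = "class_antideriv a b"
  have sub: "semi_periodic_funs a b (n + 2) = semi_periodic_funs a b (Suc (Suc n))" by simp
  have graph: "ae_class a b (\<lambda>x. - deriv_on a b 2 f x + of_real k * f x) =
      of_real k *\<^sub>C ae_class a b f - ae_class a b (deriv1 a b (deriv1 a b f))" for f
    unfolding ae_class_scale ae_class_diff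
    by (rule ae_class_cong) (simp add: numeral_2_eq_2 deriv_on_Suc)
  have TT: "?T (?T (ae_class a b (deriv1 a b (deriv1 a b f)))) = ae_class a b f"
    if "f \<in> semi_periodic_funs a b (Suc (Suc n))" for f
    using class_antideriv_deriv1[OF ab deriv1_semi_periodic[OF that]] class_antideriv_deriv1[OF ab that]
    by simp
  show ?thesis
  proof
    show "M.opA \<subseteq> semi_periodic_operator_on a b k (semi_periodic_funs a b (n + 2))"
    proof (rule subrelI)
      fix x y assume "(x, y) \<in> M.opA"
      then obtain h where h: "h \<in> vecs M" "x = ?T (?T h)" "y = of_real k *\<^sub>C x - h"
        by (rule M.opAE)
      have "x \<in> ae_class a b ` semi_periodic_funs a b (Suc (Suc n))"
        unfolding ae_class_semi_periodic_Suc[OF ab] h(2) using h(1) V by blast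
      then obtain f where f: "f \<in> semi_periodic_funs a b (Suc (Suc n))" "x = ae_class a b f"
        by blast
      let ?h = "ae_class a b (deriv1 a b (deriv1 a b f))"
      have h': "?h \<in> vecs M"
        unfolding V by (intro imageI deriv1_semi_periodic f)
      have "?T (?T ?h) = ?T (?T h)"
        using TT[OF f(1)] f(2) h(2) by simp
      then have "?h = h"
        unfolding M.T_eq_iff[OF M.T_in[OF h'] M.T_in[OF h(1)]] M.T_eq_iff[OF h' h(1)] .
      then show "(x, y) \<in> semi_periodic_operator_on a b k (semi_periodic_funs a b (n + 2))"
        unfolding semi_periodic_operator_on_def graph sub using f h(3) by blast
    qed
    show "semi_periodic_operator_on a b k (semi_periodic_funs a b (n + 2)) \<subseteq> M.opA"
    proof (rule subrelI)
      fix x y assume "(x, y) \<in> semi_periodic_operator_on a b k (semi_periodic_funs a b (n + 2))"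
      then obtain f where f: "f \<in> semi_periodic_funs a b (Suc (Suc n))" "x = ae_class a b f"
        and y: "y = of_real k *\<^sub>C ae_class a b f - ae_class a b (deriv1 a b (deriv1 a b f))"
        unfolding semi_periodic_operator_on_def graph sub by blast
      have "ae_class a b (deriv1 a b (deriv1 a b f)) \<in> vecs M"
        unfolding V by (intro imageI deriv1_semi_periodic f)
      from M.opAI[OF this] show "(x, y) \<in> M.opA"
        unfolding TT[OF f(1)] f(2) y .
    qed
  qed
qed

text \<open>The exponents are the odd multiples of \<open>\<i> * pi / (b - a)\<close>. Squaring
  identifies opposite ones, which reduces the integer index to a positive natural number.\<close>

lemma semi_periodic_spectrum_eq:
  assumes ab: "a < b"
  shows "(\<lambda>\<tau>. of_real k - \<tau>\<^sup>2) ` semi_periodic_deriv_spectrum a b =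
    {complex_of_real (((2 * real m - 1) * pi / (b - a))\<^sup>2 + k) | m :: nat. 1 \<le> m}" (is "?L = ?R")
proof -
  have L: "complex_of_real (b - a) \<noteq> 0" using ab by simp
  have exp_iff: "\<tau> \<in> semi_periodic_deriv_spectrum a b \<longleftrightarrow>
      (\<exists>n::int. \<tau> = \<i> * of_real ((2 * of_int n + 1) * pi / (b - a)))" for \<tau>
  proof -
    have "\<tau> \<in> semi_periodic_deriv_spectrum a b \<longleftrightarrow> exp (\<tau> * of_real (b - a)) = exp (\<i> * of_real pi)"
      by (simp add: semi_periodic_deriv_spectrum_def)
    also have "\<dots> \<longleftrightarrow> (\<exists>n::int. \<tau> * of_real (b - a) = \<i> * of_real pi + (of_int (2 * n) * pi) * \<i>)"
      by (rule exp_eq)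
    also have "\<dots> \<longleftrightarrow> (\<exists>n::int. \<tau> = \<i> * of_real ((2 * of_int n + 1) * pi / (b - a)))"
    proof (rule ex_cong1)
      fix n :: int
      have "\<i> * of_real pi + (of_int (2 * n) * pi) * \<i> = \<i> * of_real ((2 * of_int n + 1) * pi)"
        by (simp add: algebra_simps)
      then show "\<tau> * of_real (b - a) = \<i> * of_real pi + (of_int (2 * n) * pi) * \<i> \<longleftrightarrow>
          \<tau> = \<i> * of_real ((2 * of_int n + 1) * pi / (b - a))"
        using L by (simp add: eq_divide_eq del: of_real_diff)
    qed
    finally show ?thesis .
  qed
  have sq: "of_real k - (\<i> * of_real r)\<^sup>2 = complex_of_real (r\<^sup>2 + k)" for r :: real
    by (simp add: power_mult_distrib)
  show ?thesis
  proof
    show "?L \<subseteq> ?R"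
    proof (rule image_subsetI)
      fix \<tau> assume "\<tau> \<in> semi_periodic_deriv_spectrum a b"
      then obtain n :: int where n: "\<tau> = \<i> * of_real ((2 * of_int n + 1) * pi / (b - a))"
        unfolding exp_iff by blast
      \<comment> \<open>A nonnegative \<open>n\<close> corresponds to \<open>m = n + 1\<close>, a
        negative one to \<open>m = - n\<close>.\<close>
      have "\<exists>m::nat. 1 \<le> m \<and> (2 * real m - 1)\<^sup>2 = (2 * real_of_int n + 1)\<^sup>2"
      proof (cases "n \<ge> 0")
        case True
        then show ?thesis
          by (intro exI[of _ "nat n + 1"]) auto
      next
        case False
        then have "2 * real (nat (- n)) - 1 = - (2 * real_of_int n + 1)" by simp
        then have "(2 * real (nat (- n)) - 1)\<^sup>2 = (2 * real_of_int n + 1)\<^sup>2"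
          by (simp only: power2_minus)
        then show ?thesis using False by (intro exI[of _ "nat (- n)"]) auto
      qed
      then obtain m :: nat where m: "1 \<le> m" "(2 * real m - 1)\<^sup>2 = (2 * real_of_int n + 1)\<^sup>2"
        by blast
      have "((2 * real m - 1) * pi / (b - a))\<^sup>2 = ((2 * real_of_int n + 1) * pi / (b - a))\<^sup>2"
        unfolding power_divide power_mult_distrib m(2) ..
      then have "of_real k - \<tau>\<^sup>2 = complex_of_real (((2 * real m - 1) * pi / (b - a))\<^sup>2 + k)"
        unfolding n sq by simp
      then show "of_real k - \<tau>\<^sup>2 \<in> ?R" using m(1) by blast
    qed
    show "?R \<subseteq> ?L"
    proof clarify
      fix m :: nat assume m: "1 \<le> m"
      define \<tau> where "\<tau> = \<i> * of_real ((2 * of_int (int m - 1) + 1) * pi / (b - a))"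
      have "\<tau> \<in> semi_periodic_deriv_spectrum a b" unfolding exp_iff \<tau>_def by blast
      moreover have "complex_of_real (((2 * real m - 1) * pi / (b - a))\<^sup>2 + k) = of_real k - \<tau>\<^sup>2"
      proof -
        have "2 * real_of_int (int m - 1) + 1 = 2 * real m - 1" by simp
        then show ?thesis unfolding \<tau>_def sq by (simp only:)
      qed
      ultimately show "complex_of_real (((2 * real m - 1) * pi / (b - a))\<^sup>2 + k) \<in> ?L" by (rule rev_image_eqI)
    qed
  qed
qed

text \<open>The values grow at least like \<open>m * c\<close>, because \<open>m\<close> is at most
  \<open>(2 * m - 1)\<^sup>2\<close> for positive \<open>m\<close>; so a ball of radius 1 contains
  finitely many of them.\<close>

lemma semi_periodic_spectrum_isolated:
  assumes ab: "a < b" and k: "0 < k"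
    and z: "z \<in> {complex_of_real (((2 * real m - 1) * pi / (b - a))\<^sup>2 + k) | m :: nat. 1 \<le> m}" (is "z \<in> ?R")
  shows "z isolated_in ?R"
proof -
  define c where "c = (pi / (b - a))\<^sup>2"
  have c: "c > 0" using ab by (simp add: c_def)
  have fin: "finite (?R \<inter> ball z 1)"
  proof (rule finite_subset)
    show "finite ((\<lambda>m::nat. complex_of_real (((2 * real m - 1) * pi / (b - a))\<^sup>2 + k)) `
        {..nat \<lfloor>(norm z + 1) / c\<rfloor>})" by simp
    show "?R \<inter> ball z 1 \<subseteq> (\<lambda>m::nat. complex_of_real (((2 * real m - 1) * pi / (b - a))\<^sup>2 + k)) `
        {..nat \<lfloor>(norm z + 1) / c\<rfloor>}"
    proof clarify
      fix m :: nat assume m: "1 \<le> m"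
        and near: "complex_of_real (((2 * real m - 1) * pi / (b - a))\<^sup>2 + k) \<in> ball z 1"
      let ?y = "((2 * real m - 1) * pi / (b - a))\<^sup>2 + k"
      have "norm (complex_of_real ?y) < norm z + 1"
        using near norm_triangle_sub[of "complex_of_real ?y" z] by (simp add: dist_norm norm_minus_commute)
      moreover have "real m * c \<le> ?y"
      proof -
        have "1 * real m \<le> (2 * real m - 1) * (2 * real m - 1)"
          using m by (intro mult_mono) auto
        then have "real m \<le> (2 * real m - 1)\<^sup>2" by (simp add: power2_eq_square)
        then have "real m * c \<le> (2 * real m - 1)\<^sup>2 * c"
          using c by (intro mult_right_mono) auto
        also have "\<dots> = ((2 * real m - 1) * pi / (b - a))\<^sup>2"
          by (simp add: c_def power_divide power_mult_distrib)
        finally show ?thesis using k by simp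
      qed
      moreover have "?y \<le> norm (complex_of_real ?y)"
        unfolding norm_of_real by (rule abs_ge_self)
      ultimately have "real m * c \<le> norm z + 1" by linarith
      then have "real m \<le> (norm z + 1) / c" using c by (simp add: pos_le_divide_eq)
      then have "m \<in> {..nat \<lfloor>(norm z + 1) / c\<rfloor>}" by (simp add: le_nat_floor)
      then show "complex_of_real ?y \<in> (\<lambda>m::nat. complex_of_real (((2 * real m - 1) * pi / (b - a))\<^sup>2 + k)) `
          {..nat \<lfloor>(norm z + 1) / c\<rfloor>}" by (rule rev_image_eqI) simp
    qed
  qed
  have "\<not> z islimpt ?R"
  proof
    assume "z islimpt ?R"
    from this[unfolded islimpt_eq_infinite_ball, rule_format, OF zero_less_one] fin
    show False by contradiction
  qed
  then show ?thesis using z unfolding isolated_in_islimpt_iff by blast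
qed

section \<open>The abstract results for semi-periodic functions\<close>

context
  fixes a b k :: real
  assumes ab: "a < b" and k: "0 < k"
begin

interpretation sp: skew_inverse "L2 a b" "class_antideriv a b" "class_deriv a b" k
  "semi_periodic_deriv_spectrum a b"
  by (rule skew_inverse_class_antideriv[OF ab k])

lemma vecs_sobolev_eq: "vecs (sp.sobolev n) = ae_class a b ` semi_periodic_funs a b n"
  by (induction n)
    (simp_all add: vecs_L2 semi_periodic_funs_0 sp.vecs_sobolev_Suc ae_class_semi_periodic_Suc[OF ab]
      del: sp.sobolev.simps(2))

text \<open>Both sides obey the same recursion. As the left side sees classes only, the explicit
  inner product does not depend on the representatives.\<close>

lemma ip_sobolev_eq:
  "\<lbrakk>f \<in> semi_periodic_funs a b n; g \<in> semi_periodic_funs a b n\<rbrakk> \<Longrightarrow>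
    ip (sp.sobolev n) (ae_class a b f) (ae_class a b g) = semi_periodic_ip a b k n f g"
proof (induction n arbitrary: f g)
  case 0
  then show ?case by (simp add: ip_L2 L2_ip_ae_class semi_periodic_ip_def)
next
  case (Suc n)
  have "ip (sp.sobolev n) (ae_class a b f) (ae_class a b g) = semi_periodic_ip a b k n f g"
    using Suc.prems semi_periodic_funs_Suc_subset by (intro Suc.IH) blast+
  moreover have "ip (sp.sobolev n) (ae_class a b (deriv1 a b f)) (ae_class a b (deriv1 a b g)) =
      semi_periodic_ip a b k n (deriv1 a b f) (deriv1 a b g)"
    using Suc.prems deriv1_semi_periodic by (intro Suc.IH)
  ultimately show ?case
    unfolding sp.ip_sobolev_Suc semi_periodic_ip_Suc
    by (simp only: class_deriv_ae_class[OF ab Suc.prems(1)] class_deriv_ae_class[OF ab Suc.prems(2)])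
qed

lemma left_definite_semi_periodic_space:
  assumes n: "0 < n"
  shows "left_definite_space (L2 a b) sp.opA k n (semi_periodic_space a b k n)"
proof (rule left_definite_space_cong[OF sp.left_definite_sobolev[OF n]])
  show "vecs (semi_periodic_space a b k n) = vecs (sp.sobolev n)"
    by (simp add: semi_periodic_space_def vecs_sobolev_eq)
  have rep: "semi_periodic_rep a b n u \<in> semi_periodic_funs a b n"
    "ae_class a b (semi_periodic_rep a b n u) = u" if "u \<in> vecs (sp.sobolev n)" for u
  proof -
    have "\<exists>f. f \<in> semi_periodic_funs a b n \<and> ae_class a b f = u"
      using that unfolding vecs_sobolev_eq by blast
    from someI_ex[OF this] show "semi_periodic_rep a b n u \<in> semi_periodic_funs a b n"
      "ae_class a b (semi_periodic_rep a b n u) = u"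
      unfolding semi_periodic_rep_def by blast+
  qed
  show "ip (semi_periodic_space a b k n) x y = ip (sp.sobolev n) x y"
    if "x \<in> vecs (sp.sobolev n)" "y \<in> vecs (sp.sobolev n)" for x y
    using ip_sobolev_eq[OF rep(1)[OF that(1)] rep(1)[OF that(2)]]
    by (simp add: semi_periodic_space_def rep(2) that)
qed

lemma semi_periodic_A_eq: "semi_periodic_A a b k = sp.opA"
  using opA_eq_semi_periodic_operator_on[OF ab sp.skew_inverse_axioms, of 0]
  by (simp add: vecs_L2 semi_periodic_funs_0 numeral_2_eq_2)

text \<open>Stated for any left-definite space \<open>M\<close>: uniqueness supplies its vectors,
  and these determine which concrete operator arises on it.\<close>

lemma semi_periodic_left_definite:
  assumes n: "0 < n" and L: "left_definite_space (L2 a b) (semi_periodic_A a b k) k n M"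
  shows "skew_inverse M (class_antideriv a b) (class_deriv a b) k (semi_periodic_deriv_spectrum a b)"
    and "skew_inverse.opA M (class_antideriv a b) k = semi_periodic_A_n a b k n"
    and "left_definite_operator (L2 a b) (semi_periodic_A a b k) k n M B \<longleftrightarrow> B = semi_periodic_A_n a b k n"
proof -
  note L' = L[unfolded semi_periodic_A_eq]
  show M: "skew_inverse M (class_antideriv a b) (class_deriv a b) k (semi_periodic_deriv_spectrum a b)"
    by (rule sp.left_definite_skew_inverse[OF n L'])
  show opA: "skew_inverse.opA M (class_antideriv a b) k = semi_periodic_A_n a b k n"
    by (rule opA_eq_semi_periodic_operator_on[OF ab M])
      (simp add: sp.left_definite_vecs[OF n L'] vecs_sobolev_eq)
  show "left_definite_operator (L2 a b) (semi_periodic_A a b k) k n M B \<longleftrightarrow> B = semi_periodic_A_n a b k n"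
    unfolding semi_periodic_A_eq sp.left_definite_operator_iff[OF n L'] opA ..
qed

lemma spectrum_semi_periodic_A:
  "spectrum (L2 a b) (semi_periodic_A a b k) =
    {complex_of_real (((2 * real m - 1) * pi / (b - a))\<^sup>2 + k) | m :: nat. 1 \<le> m}"
  unfolding semi_periodic_A_eq sp.spectrum_opA by (rule semi_periodic_spectrum_eq[OF ab])

end

text \<open>The first conjunct exhibits a left-definite space, so the quantification over
  \<open>Hn\<close> is not vacuous.\<close>

theorem theorem4p5:
  fixes a b k :: real and n :: nat
  assumes "a < b" and "0 < k" and "1 \<le> n"
  shows "left_definite_space (L2 a b) (semi_periodic_A a b k) k n (semi_periodic_space a b k n) \<and>
    (\<forall>Hn. left_definite_space (L2 a b) (semi_periodic_A a b k) k n Hn \<longrightarrow>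
       left_definite_operator (L2 a b) (semi_periodic_A a b k) k n Hn (semi_periodic_A_n a b k n) \<and>
       (\<forall>B. left_definite_operator (L2 a b) (semi_periodic_A a b k) k n Hn B \<longrightarrow>
          B = semi_periodic_A_n a b k n) \<and>
       self_adjoint Hn (semi_periodic_A_n a b k n) \<and>
       purely_discrete_point_spectrum Hn (semi_periodic_A_n a b k n) \<and>
       spectrum Hn (semi_periodic_A_n a b k n) = spectrum (L2 a b) (semi_periodic_A a b k) \<and>
       spectrum (L2 a b) (semi_periodic_A a b k) =
         {complex_of_real (((2 * real m - 1) * pi / (b - a))\<^sup>2 + k) | m :: nat. 1 \<le> m})"
proof (intro conjI allI impI)
  have n: "0 < n" using assms(3) by simp
  show "left_definite_space (L2 a b) (semi_periodic_A a b k) k n (semi_periodic_space a b k n)"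
    unfolding semi_periodic_A_eq[OF assms(1,2)]
    by (rule left_definite_semi_periodic_space[OF assms(1,2) n])
  show spec: "spectrum (L2 a b) (semi_periodic_A a b k) =
         {complex_of_real (((2 * real m - 1) * pi / (b - a))\<^sup>2 + k) | m :: nat. 1 \<le> m}"
    by (rule spectrum_semi_periodic_A[OF assms(1,2)])
  fix Hn assume L: "left_definite_space (L2 a b) (semi_periodic_A a b k) k n Hn"
  note Hn = semi_periodic_left_definite[OF assms(1,2) n L]
  interpret Hn: skew_inverse Hn "class_antideriv a b" "class_deriv a b" k "semi_periodic_deriv_spectrum a b"
    by (rule Hn(1))
  show "left_definite_operator (L2 a b) (semi_periodic_A a b k) k n Hn (semi_periodic_A_n a b k n)"
    unfolding Hn(3) ..
  show "B = semi_periodic_A_n a b k n"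
    if "left_definite_operator (L2 a b) (semi_periodic_A a b k) k n Hn B" for B
    using that unfolding Hn(3) .
  show "self_adjoint Hn (semi_periodic_A_n a b k n)"
    unfolding Hn(2)[symmetric] by (rule Hn.self_adjoint_opA)
  show "purely_discrete_point_spectrum Hn (semi_periodic_A_n a b k n)"
    unfolding Hn(2)[symmetric]
    by (rule Hn.purely_discrete_opA, unfold semi_periodic_spectrum_eq[OF assms(1)])
      (rule semi_periodic_spectrum_isolated[OF assms(1,2)])
  show "spectrum Hn (semi_periodic_A_n a b k n) = spectrum (L2 a b) (semi_periodic_A a b k)"
    unfolding Hn(2)[symmetric] Hn.spectrum_opA spec by (rule semi_periodic_spectrum_eq[OF assms(1)])
qed

end
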